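(* Let $T>0$, $p\in[1,\infty)$ and let $(W^i)_{i\in\mathbb{N}}$ be a family of independent Brownian motions on $\mathbb{R}$. Let $I=[r_{min},r_{max}]\subset(0,\infty)$ be a closed interval and let $(r^i)_{i\in\mathbb{N}}\subset I$ be a sequence such that, with $R^{(N)}=(r^1,\dots,r^N)$, $$L^N(R^{(N)})=\frac1N\sum_{i=1}^N\delta_{r^i}\overset{\ast}{\rightharpoonup}\lambda\in\mathcal{P}_p(I).$$ With the data $\tau,\sigma,\mu_{Li},q,V$, the function $\Lambda$ and the initial value $a\in[0,1]$ described in the context, consider the system $$\left\{\begin{array}{l}dY^{i,N}_t=\frac1{\tau(r^i)}\big(\Lambda_t(\mu^N_t)-\mu_{Li}(Y^{i,N}_t)\big)dt+\sigma(r^i)\,dW^i_t-dk^{i,N}_t,\\ d|k^{i,N}|_t=1_{Y^{i,N}_t\in\{0,1\}}\,d|k^{i,N}|_t,\quad dk^{i,N}_t=n(Y^{i,N}_t)\,d|k^{i,N}|_t,\\ Y^{i,N}_0=a,\end{array}\right.\qquad i=1,\dots,N,$$ where $\mu^N_t=\frac1N\sum_{j=1}^N\delta_{(Y^{j,N}_t,r^j)}$. Then, for every $N\in\mathbb{N}$, this system admits a unique solution $(Y^{(N)},k^{(N)})=(Y^{i,N},k^{i,N})_{i=1,\dots,N}$. Moreover, $\mathbb{P}$-a.s. as $N\to\infty$, $$L^N(Y^{(N)},k^{(N)})\overset{\ast}{\rightharpoonup}\mathcal{L}(X,k),$$ where $(X,k)$ is a solution of $$\left\{\begin{array}{l}dX_t=\frac1{\tau(R)}\big(\Lambda_t(\mathcal{L}(X_t,R))-\mu_{Li}(X_t)\big)dt+\sigma(R)\,dW_t-dk_t,\quad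 X_0=a,\\ d|k|_t=1_{X_t\in\{0,1\}}\,d|k|_t,\quad dk_t=n(X_t)\,d|k|_t,\end{array}\right.$$ with input $(W,R)$ having law $\mu_{\mathcal{W}}\otimes\lambda$, $\mu_{\mathcal{W}}$ being the Wiener measure on $C([0,T],\mathbb{R})$.
   Context: $L^N(y^{(N)}):=\frac1N\sum_{i=1}^N\delta_{y^i}$; $\overset{\ast}{\rightharpoonup}$ is weak convergence of probability measures; $\mathcal{L}$ denotes law; $\mathcal{P}_p$ denotes probability measures with finite $p$-th moment. Data: $\tau:I\to\mathbb{R}$ (positive) with $\tau$ and $1/\tau$ Lipschitz and bounded; $\sigma:I\to\mathbb{R}$ Lipschitz and bounded; $\mu_{Li}:\mathbb{R}\to\mathbb{R}$ Lipschitz and bounded; $q:[0,T]\to\mathbb{R}$ a given $C^1$ function with derivative $\dot q$; $V(r)=4\pi r^3/3$. For a probability measure $\nu$ on $\mathbb{R}\times I$, $$\Lambda_t(\nu)=\frac{\int\big[V(r)\dot q_t+\mu_{Li}(x)\frac{V(r)}{\tau(r)}\big]\nu(d(x,r))}{\int\frac{V(r)}{\tau(r)}\,\nu(d(x,r))}.$$ Reflection: the processes $Y^{i,N}$, $X$ are continuous and $[0,1]$-valued; $k^{i,N}$, $k$ are continuous of bounded variation on $[0,T]$, started at $0$; $|k|$ denotes the total variation process of $k$ (not its modulus); $n(x)=(-1)^{x+1}$, $x\in\{0,1\}$, is the outer unit normal of $(0,1)$. Solutions are pathwise: the equations hold in integrated form for a.e. $\omega$, and uniqueness is up to almost sure equality.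 $L^N(Y^{(N)},k^{(N)})$ is a random probability measure on $C([0,T],[0,1])\times C([0,T],\mathbb{R})$. *)

theory Defs
  imports "HOL-Probability.Probability"
begin

definition borel_of :: "'a topology \<Rightarrow> 'a measure" where
  "borel_of X = sigma (topspace X) {U. openin X U}"

lemma space_borel_of [simp]: "space (borel_of X) = topspace X"
  unfolding borel_of_def by (rule space_measure_of) (auto dest: openin_subset)

lemma sets_borel_of: "sets (borel_of X) = sigma_sets (topspace X) {U. openin X U}"
  unfolding borel_of_def by (rule sets_measure_of) (auto dest: openin_subset)

definition weak_conv_on :: "'a topology \<Rightarrow> (nat \<Rightarrow> 'a measure) \<Rightarrow> 'a measure \<Rightarrow> bool" where
  "weak_conv_on X \<mu> \<nu> \<longleftrightarrow>
    (\<forall>f. continuous_map X euclideanreal f \<and> bounded (f ` topspace X) \<longrightarrow>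
      (\<lambda>N. \<integral>x. f x \<partial>\<mu> N) \<longlonglongrightarrow> (\<integral>x. f x \<partial>\<nu>))"

text \<open>The indices \<open>1, \<dots>, N\<close> are shifted to \<open>0, \<dots>, N - 1\<close>.\<close>

definition empirical :: "'a topology \<Rightarrow> nat \<Rightarrow> (nat \<Rightarrow> 'a) \<Rightarrow> 'a measure" where
  "empirical X N y = distr (uniform_count_measure {..<N}) (borel_of X) y"

lemma emeasure_empirical:
  assumes "N \<ge> 1" and "\<And>i. i < N \<Longrightarrow> y i \<in> topspace X" and A: "A \<in> sets (borel_of X)"
  shows "emeasure (empirical X N y) A = (\<Sum>i<N. emeasure (return (borel_of X) (y i)) A) / N"
proof -
  have "(\<Sum>i<N. emeasure (return (borel_of X) (y i)) A) = of_nat (card {i. i < N \<and> y i \<in> A})"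
    using A by (simp add: indicator_def if_distrib sum.If_cases Int_def cong: if_cong)
  moreover have "y -` A \<inter> {..<N} = {i. i < N \<and> y i \<in> A}"
    by auto
  moreover have "emeasure (empirical X N y) A = emeasure (uniform_count_measure {..<N}) (y -` A \<inter> {..<N})"
    unfolding empirical_def using assms
    by (subst emeasure_distr)
       (auto simp: measurable_def space_uniform_count_measure sets_uniform_count_measure)
  ultimately show ?thesis
    using assms(1) emeasure_uniform_count_measure[of "{..<N}" "{i. i < N \<and> y i \<in> A}"]
    by (auto simp: ennreal_of_nat_eq_real_of_nat divide_ennreal)
qed

definition finite_moment_measure :: "real \<Rightarrow> real set \<Rightarrow> real measure \<Rightarrow> bool" where
  "finite_moment_measure p I \<nu> \<longleftrightarrow>
    prob_space \<nu> \<and> sets \<nu> = sets (borel_of (top_of_set I)) \<and> integrable \<nu> (\<lambda>x. \<bar>x\<bar> powr p)"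

text \<open>\<open>C([0,T], S)\<close> with the supremum distance. Its elements are extensional, that is,
  \<open>undefined\<close> outside \<open>[0,T]\<close>, so equality of paths is equality on \<open>[0,T]\<close>.\<close>

definition path_space :: "real \<Rightarrow> real set \<Rightarrow> (real \<Rightarrow> real) topology" where
  "path_space T S = mtopology_of (cfunspace (top_of_set {0..T}) (submetric euclidean_metric S))"

definition brownian_motion :: "real \<Rightarrow> 'w measure \<Rightarrow> ('w \<Rightarrow> real \<Rightarrow> real) \<Rightarrow> bool" where
  "brownian_motion T M W \<longleftrightarrow>
    prob_space M \<and>
    W \<in> M \<rightarrow>\<^sub>M borel_of (path_space T UNIV) \<and>
    (AE \<omega> in M. W \<omega> 0 = 0) \<and>
    (\<forall>s t. 0 \<le> s \<and> s < t \<and> t \<le> T \<longrightarrow>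
      distributed M lborel (\<lambda>\<omega>. W \<omega> t - W \<omega> s) (normal_density 0 (sqrt (t - s)))) \<and>
    (\<forall>u::nat \<Rightarrow> real. mono u \<and> range u \<subseteq> {0..T} \<longrightarrow>
      prob_space.indep_vars M (\<lambda>_. borel) (\<lambda>j \<omega>. W \<omega> (u (Suc j)) - W \<omega> (u j)) UNIV)"

definition wiener_measure :: "real \<Rightarrow> (real \<Rightarrow> real) measure \<Rightarrow> bool" where
  "wiener_measure T \<mu> \<longleftrightarrow>
    sets \<mu> = sets (borel_of (path_space T UNIV)) \<and> brownian_motion T \<mu> (\<lambda>w. w)"

text \<open>Every partition of a subinterval of \<open>[a,b]\<close> extends to a monotone sequence.\<close>

definition variation_sums :: "(real \<Rightarrow> real) \<Rightarrow> real \<Rightarrow> real \<Rightarrow> real set" where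
  "variation_sums f a b =
    {\<Sum>j<n. \<bar>f (u (Suc j)) - f (u j)\<bar> | n (u::nat \<Rightarrow> real). mono u \<and> range u \<subseteq> {a..b}}"

definition total_variation :: "(real \<Rightarrow> real) \<Rightarrow> real \<Rightarrow> real \<Rightarrow> real" where
  "total_variation f a b = Sup (variation_sums f a b)"

text \<open>The Lebesgue-Stieltjes measure \<open>d|k|\<close> on \<open>[0,T]\<close>, extended by zero.\<close>

definition variation_measure :: "real \<Rightarrow> (real \<Rightarrow> real) \<Rightarrow> real measure" where
  "variation_measure T k = interval_measure (\<lambda>t. total_variation k 0 (max 0 (min T t)))"

text \<open>The outer unit normal \<open>(-1)\<^sup>x\<^sup>+\<^sup>1\<close> of \<open>(0,1)\<close> at \<open>x \<in> {0,1}\<close>; only its values at these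
  two points matter.\<close>

definition outer_normal :: "real \<Rightarrow> real" where
  "outer_normal x = (if x = 0 then -1 else if x = 1 then 1 else 0)"

text \<open>Integrated form of
  \<open>dx = b dt + dz - dk\<close>, \<open>d|k| = 1{x \<in> {0,1}} d|k|\<close>, \<open>dk = n(x) d|k|\<close>, \<open>x\<^sub>0 = a\<close>,
  for a path \<open>z\<close> with \<open>z\<^sub>0 = 0\<close>. As the diffusion coefficients below do not depend on time,
  the stochastic integral of \<open>\<sigma>(r)\<close> against \<open>W\<close> is the path \<open>\<sigma>(r) W\<close>.\<close>

definition reflected_equation ::
    "real \<Rightarrow> real \<Rightarrow> (real \<Rightarrow> real) \<Rightarrow> (real \<Rightarrow> real) \<Rightarrow> (real \<Rightarrow> real) \<Rightarrow> (real \<Rightarrow> real) \<Rightarrow> bool" where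
  "reflected_equation T a b z x k \<longleftrightarrow>
    x 0 = a \<and> k 0 = 0 \<and> bdd_above (variation_sums k 0 T) \<and>
    set_integrable lborel {0..T} b \<and>
    (\<forall>t\<in>{0..T}.
      x t = a + (LINT s:{0..t}|lborel. b s) + z t - k t \<and>
      total_variation k 0 t = (LINT s:{0..t}|variation_measure T k. indicator {0,1} (x s)) \<and>
      k t = (LINT s:{0..t}|variation_measure T k. outer_normal (x s)))"

definition vol :: "real \<Rightarrow> real" where
  "vol r = 4 * pi * r ^ 3 / 3"

definition Lambda ::
    "(real \<Rightarrow> real) \<Rightarrow> (real \<Rightarrow> real) \<Rightarrow> (real \<Rightarrow> real) \<Rightarrow> real \<Rightarrow> (real \<times> real) measure \<Rightarrow> real" where
  "Lambda \<tau> \<mu>Li q' t \<nu> =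
    (\<integral>(x, r). vol r * q' t + \<mu>Li x * (vol r / \<tau> r) \<partial>\<nu>) / (\<integral>(x, r). vol r / \<tau> r \<partial>\<nu>)"

text \<open>Measures on \<open>\<real> \<times> I\<close>, not on the plane: \<open>\<tau>\<close> and \<open>\<sigma>\<close> are only controlled on \<open>I\<close>.\<close>

abbreviation state_space :: "real set \<Rightarrow> (real \<times> real) topology" where
  "state_space I \<equiv> prod_topology euclideanreal (top_of_set I)"

text \<open>\<open>Y i \<omega> t\<close> and \<open>K i \<omega> t\<close> for \<open>i < N\<close>; the values for \<open>i \<ge> N\<close> are irrelevant.\<close>

definition particle_solution ::
    "real \<Rightarrow> real set \<Rightarrow> (real \<Rightarrow> real) \<Rightarrow> (real \<Rightarrow> real) \<Rightarrow> (real \<Rightarrow> real) \<Rightarrow> (real \<Rightarrow> real) \<Rightarrow> real \<Rightarrow>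
      (nat \<Rightarrow> real) \<Rightarrow> 'w measure \<Rightarrow> (nat \<Rightarrow> 'w \<Rightarrow> real \<Rightarrow> real) \<Rightarrow> nat \<Rightarrow>
      (nat \<Rightarrow> 'w \<Rightarrow> real \<Rightarrow> real) \<Rightarrow> (nat \<Rightarrow> 'w \<Rightarrow> real \<Rightarrow> real) \<Rightarrow> bool" where
  "particle_solution T I \<tau> \<sigma> \<mu>Li q' a r M W N Y K \<longleftrightarrow>
    (\<forall>i<N.
      Y i \<in> M \<rightarrow>\<^sub>M borel_of (path_space T {0..1}) \<and>
      K i \<in> M \<rightarrow>\<^sub>M borel_of (path_space T UNIV)) \<and>
    (AE \<omega> in M. \<forall>i<N.
      reflected_equation T a
        (\<lambda>s. 1 / \<tau> (r i) *
          (Lambda \<tau> \<mu>Li q' s (empirical (state_space I) N (\<lambda>j. (Y j \<omega> s, r j))) - \<mu>Li (Y i \<omega> s)))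
        (\<lambda>t. \<sigma> (r i) * W i \<omega> t)
        (Y i \<omega>) (K i \<omega>))"

definition limit_input ::
    "real \<Rightarrow> real set \<Rightarrow> (real \<Rightarrow> real) measure \<Rightarrow> real measure \<Rightarrow>
      'v measure \<Rightarrow> ('v \<Rightarrow> real \<Rightarrow> real) \<Rightarrow> ('v \<Rightarrow> real) \<Rightarrow> bool" where
  "limit_input T I \<mu>W lam M W R \<longleftrightarrow>
    prob_space M \<and>
    W \<in> M \<rightarrow>\<^sub>M borel_of (path_space T UNIV) \<and>
    R \<in> M \<rightarrow>\<^sub>M borel_of (top_of_set I) \<and>
    distr M (borel_of (path_space T UNIV) \<Otimes>\<^sub>M borel_of (top_of_set I)) (\<lambda>\<omega>. (W \<omega>, R \<omega>))
      = \<mu>W \<Otimes>\<^sub>M lam"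

lemma limit_input_canonical:
  assumes "wiener_measure T \<mu>W" and "finite_moment_measure p I lam"
  shows "limit_input T I \<mu>W lam (\<mu>W \<Otimes>\<^sub>M lam) fst snd"
proof -
  have ps: "prob_space \<mu>W" "prob_space lam"
    and s [measurable_cong]: "sets \<mu>W = sets (borel_of (path_space T UNIV))"
      "sets lam = sets (borel_of (top_of_set I))"
    using assms by (auto simp: wiener_measure_def brownian_motion_def finite_moment_measure_def)
  interpret P: pair_prob_space \<mu>W lam
    using ps by (simp add: pair_prob_space_def pair_sigma_finite_def prob_space_imp_sigma_finite)
  have "sets (\<mu>W \<Otimes>\<^sub>M lam)
      = sets (borel_of (path_space T UNIV) \<Otimes>\<^sub>M borel_of (top_of_set I))"
    by (rule sets_pair_measure_cong) (rule s)+
  then have "distr (\<mu>W \<Otimes>\<^sub>M lam) (borel_of (path_space T UNIV) \<Otimes>\<^sub>M borel_of (top_of_set I))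
      (\<lambda>\<omega>. (fst \<omega>, snd \<omega>)) = \<mu>W \<Otimes>\<^sub>M lam"
    by (simp add: distr_id2)
  then show ?thesis
    unfolding limit_input_def by (auto intro: P.prob_space_axioms)
qed

definition limit_solution ::
    "real \<Rightarrow> real set \<Rightarrow> (real \<Rightarrow> real) \<Rightarrow> (real \<Rightarrow> real) \<Rightarrow> (real \<Rightarrow> real) \<Rightarrow> (real \<Rightarrow> real) \<Rightarrow> real \<Rightarrow>
      'v measure \<Rightarrow> ('v \<Rightarrow> real \<Rightarrow> real) \<Rightarrow> ('v \<Rightarrow> real) \<Rightarrow>
      ('v \<Rightarrow> real \<Rightarrow> real) \<Rightarrow> ('v \<Rightarrow> real \<Rightarrow> real) \<Rightarrow> bool" where
  "limit_solution T I \<tau> \<sigma> \<mu>Li q' a M W R X k \<longleftrightarrow>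
    X \<in> M \<rightarrow>\<^sub>M borel_of (path_space T {0..1}) \<and>
    k \<in> M \<rightarrow>\<^sub>M borel_of (path_space T UNIV) \<and>
    (AE \<omega> in M.
      reflected_equation T a
        (\<lambda>s. 1 / \<tau> (R \<omega>) *
          (Lambda \<tau> \<mu>Li q' s (distr M (borel_of (state_space I)) (\<lambda>\<omega>'. (X \<omega>' s, R \<omega>')))
            - \<mu>Li (X \<omega> s)))
        (\<lambda>t. \<sigma> (R \<omega>) * W \<omega> t)
        (X \<omega>) (k \<omega>))"

abbreviation reflected_path_space :: "real \<Rightarrow> ((real \<Rightarrow> real) \<times> (real \<Rightarrow> real)) topology" where
  "reflected_path_space T \<equiv> prod_topology (path_space T {0..1}) (path_space T UNIV)"

end

(*
  The noise enters additively, so everything is pathwise. The pushing term of the reflection is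
  nondecreasing while the path avoids 0 and nonincreasing while it avoids 1; this makes it Lipschitz
  in the driving path for the supremum distance. Both the particle system and the limit equation
  are fixed point problems for a mean field entering a reflected equation with given input, and
  Picard iteration solves them. For the convergence, each particle is compared with the limit
  dynamics driven by its own noise and radius: the distance is controlled by the difference of the
  two mean fields along the limit dynamics, which is an average of continuous functions of the
  inputs and hence vanishes by the law of large numbers.
*)

theory Submission
  imports Defs
begin

section \<open>The Skorokhod problem on the unit interval\<close>

text \<open>The equations are posed with the Stieltjes measure of the total variation of
  \<open>k\<close>, whereas comparison and construction only use order. Passing from the measure to
  order is short; the converse needs the total variation explicitly, which is available because on a
  fine grid every window avoids one of the two barriers. In the limit theorem the obstacle is the
  coupling: the particles are dependent, so no law of large numbers applies to them directly. With
  the field of the limit equation frozen, a solution becomes a function of its own input (noise path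
  and radius) alone. This function is defined for every input, not just almost every one, and is
  continuous for the supremum distance. Weak convergence of the empirical measure of the inputs is
  then the only probabilistic fact, and the rest is an argument for a fixed sample point.
  Exponential weights in time let it, and the Picard iteration, cover \<open>[0,T]\<close> in one
  go.\<close>

definition skorokhod_on :: "real \<Rightarrow> real \<Rightarrow> (real \<Rightarrow> real) \<Rightarrow> (real \<Rightarrow> real) \<Rightarrow> bool" where
  "skorokhod_on c d y k \<longleftrightarrow> continuous_on {c..d} k \<and> (\<forall>t\<in>{c..d}. y t - k t \<in> {0..1}) \<and>
    (\<forall>s t. c \<le> s \<and> s \<le> t \<and> t \<le> d \<and> (\<forall>u\<in>{s<..t}. 0 < y u - k u) \<longrightarrow> k s \<le> k t) \<and>
    (\<forall>s t. c \<le> s \<and> s \<le> t \<and> t \<le> d \<and> (\<forall>u\<in>{s<..t}. y u - k u < 1) \<longrightarrow> k t \<le> k s)"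

definition skorokhod :: "real \<Rightarrow> (real \<Rightarrow> real) \<Rightarrow> (real \<Rightarrow> real) \<Rightarrow> bool" where
  "skorokhod T y k \<longleftrightarrow> skorokhod_on 0 T y k \<and> k 0 = 0"

text \<open>The reflected path is \<open>y - k\<close>, so \<open>k\<close> grows at the barrier 1
  and falls at the barrier 0, in accordance with \<open>outer_normal\<close>. The monotonicity
  conditions use \<open>{s<..t}\<close> because the path may still touch a barrier at the time
  \<open>s\<close> itself.\<close>

lemma skorokhod_onD:
  assumes "skorokhod_on c d y k"
  shows "continuous_on {c..d} k" "\<And>t. t \<in> {c..d} \<Longrightarrow> y t - k t \<in> {0..1}"
    "\<And>s t. c \<le> s \<Longrightarrow> s \<le> t \<Longrightarrow> t \<le> d \<Longrightarrow> (\<And>u. u \<in> {s<..t} \<Longrightarrow> 0 < y u - k u) \<Longrightarrow> k s \<le> k t"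
    "\<And>s t. c \<le> s \<Longrightarrow> s \<le> t \<Longrightarrow> t \<le> d \<Longrightarrow> (\<And>u. u \<in> {s<..t} \<Longrightarrow> y u - k u < 1) \<Longrightarrow> k t \<le> k s"
  using assms unfolding skorokhod_on_def by auto

text \<open>After the last time at which \<open>k - k' \<le> \<delta>\<close> the first solution lies strictly below the
  second one, so that \<open>k\<close> can only decrease and \<open>k'\<close> can only increase.\<close>

lemma skorokhod_compare_le:
  assumes k: "skorokhod T y k" and k': "skorokhod T y' k'" and t: "t \<in> {0..T}"
    and \<delta>: "\<And>s. s \<in> {0..t} \<Longrightarrow> \<bar>y s - y' s\<bar> \<le> \<delta>"
  shows "k t - k' t \<le> \<delta>"
proof (rule ccontr)
  assume gt: "\<not> k t - k' t \<le> \<delta>"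
  note K = skorokhod_onD[of 0 T y k] and K' = skorokhod_onD[of 0 T y' k']
  have sk: "skorokhod_on 0 T y k" "skorokhod_on 0 T y' k'" and 0: "k 0 = 0" "k' 0 = 0"
    using k k' by (auto simp: skorokhod_def)
  define S where "S = {0..t} \<inter> (\<lambda>s. k s - k' s) -` {..\<delta>}"
  have "continuous_on {0..t} (\<lambda>s. k s - k' s)"
    using K(1)[OF sk(1)] K'(1)[OF sk(2)] t
    by (intro continuous_on_diff) (auto elim!: continuous_on_subset)
  then have "closed S"
    unfolding S_def by (intro continuous_closed_preimage) auto
  moreover have "bounded S"
    unfolding S_def by (rule bounded_subset[of "{0..t}"]) auto
  ultimately have "compact S"
    by (simp add: compact_eq_bounded_closed)
  \<comment> \<open>Both pushing terms start at 0, so time 0 belongs to \<open>S\<close> and a last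
    time in \<open>S\<close> exists.\<close>
  moreover have "0 \<le> \<delta>"
    using \<delta>[of 0] t by auto
  then have "0 \<in> S"
    using t 0 by (auto simp: S_def)
  ultimately obtain s where s: "s \<in> S" and max: "\<And>u. u \<in> S \<Longrightarrow> u \<le> s"
    using compact_attains_sup[of S] by blast
  have st: "0 \<le> s" "s \<le> t" "k s - k' s \<le> \<delta>"
    using s by (auto simp: S_def)
  have *: "y u - k u < 1 \<and> 0 < y' u - k' u" if u: "u \<in> {s<..t}" for u
  proof -
    have "u \<notin> S" "u \<in> {0..t}" "u \<in> {0..T}"
      using max[of u] u st t by auto
    then show ?thesis
      using \<delta>[of u] K(2)[OF sk(1), of u] K'(2)[OF sk(2), of u] by (auto simp: S_def)
  qed
  have "k t \<le> k s"
    using * st t by (intro K(4)[OF sk(1)]) auto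
  moreover have "k' s \<le> k' t"
    using * st t by (intro K'(3)[OF sk(2)]) auto
  ultimately show False
    using st gt by auto
qed

lemma skorokhod_compare:
  assumes "skorokhod T y k" "skorokhod T y' k'" "t \<in> {0..T}"
    and "\<And>s. s \<in> {0..t} \<Longrightarrow> \<bar>y s - y' s\<bar> \<le> \<delta>"
  shows "\<bar>k t - k' t\<bar> \<le> \<delta>"
proof -
  have "k t - k' t \<le> \<delta>"
    using assms by (intro skorokhod_compare_le[of T y k y' k' t])
  moreover have "k' t - k t \<le> \<delta>"
    using assms by (intro skorokhod_compare_le[of T y' k' y k t]) (auto simp: abs_minus_commute)
  ultimately show ?thesis
    by auto
qed

text \<open>Between \<open>s\<close> and \<open>t\<close> the running supremum grows by no more than
  \<open>y\<close> rises above \<open>y s\<close>, so it inherits the modulus of continuity of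
  \<open>y\<close>.\<close>

lemma continuous_running_Sup:
  fixes y :: "real \<Rightarrow> real"
  assumes y: "continuous_on {c..d} y"
  shows "continuous_on {c..d} (\<lambda>s. Sup (y ` {c..s}))"
proof -
  have bdd: "bdd_above (y ` {c..s})" if "s \<in> {c..d}" for s
  proof (rule bdd_above_mono)
    show "bdd_above (y ` {c..d})"
      using y by (intro bounded_imp_bdd_above compact_imp_bounded compact_continuous_image) auto
  qed (use that in auto)
  have uc: "uniformly_continuous_on {c..d} y"
    using y by (intro compact_uniformly_continuous) auto
  have main: "\<bar>Sup (y ` {c..t}) - Sup (y ` {c..s})\<bar> \<le> e"
    if st: "s \<in> {c..d}" "t \<in> {c..d}" "s \<le> t" and e: "\<And>u. u \<in> {s..t} \<Longrightarrow> \<bar>y u - y s\<bar> \<le> e" for s t e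
  proof -
    have "0 \<le> e"
      using e[of s] st by auto
    have "y u \<le> Sup (y ` {c..s}) + e" if u: "u \<in> {c..t}" for u
    proof (cases "u \<le> s")
      case True
      then have "y u \<le> Sup (y ` {c..s})"
        using st u by (intro cSup_upper bdd) auto
      then show ?thesis
        using \<open>0 \<le> e\<close> by simp
    next
      case False
      have "y s \<le> Sup (y ` {c..s})"
        using st by (intro cSup_upper bdd) auto
      then show ?thesis
        using e[of u] False u by auto
    qed
    then have "Sup (y ` {c..t}) \<le> Sup (y ` {c..s}) + e"
      using st by (intro cSup_least) auto
    moreover have "Sup (y ` {c..s}) \<le> Sup (y ` {c..t})"
      using st by (intro cSup_subset_mono bdd) auto
    ultimately show ?thesis
      by auto
  qed
  show ?thesis
    unfolding continuous_on_iff
  proof (intro ballI allI impI)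
    fix s and e :: real assume s: "s \<in> {c..d}" and "0 < e"
    then obtain \<delta> where \<delta>: "0 < \<delta>" "\<And>u v. u \<in> {c..d} \<Longrightarrow> v \<in> {c..d} \<Longrightarrow> dist v u < \<delta> \<Longrightarrow> dist (y v) (y u) < e/2"
      using uc unfolding uniformly_continuous_on_def by (meson half_gt_zero)
    have "\<bar>Sup (y ` {c..t}) - Sup (y ` {c..s})\<bar> \<le> e/2" if t: "t \<in> {c..d}" "dist t s < \<delta>" for t
    proof (cases "s \<le> t")
      case True
      have "\<bar>y u - y s\<bar> \<le> e/2" if "u \<in> {s..t}" for u
        using that t s \<delta>(2)[of s u] by (auto simp: dist_real_def)
      then show ?thesis
        using t s True by (intro main) auto
    next
      case False
      have "\<bar>y u - y t\<bar> \<le> e/2" if "u \<in> {t..s}" for u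
        using that t s \<delta>(2)[of t u] by (auto simp: dist_real_def)
      then have "\<bar>Sup (y ` {c..s}) - Sup (y ` {c..t})\<bar> \<le> e/2"
        using t s False by (intro main) auto
      then show ?thesis
        by (simp add: abs_minus_commute)
    qed
    then show "\<exists>\<delta>>0. \<forall>t\<in>{c..d}. dist t s < \<delta> \<longrightarrow> dist (Sup (y ` {c..t})) (Sup (y ` {c..s})) < e"
      using \<delta>(1) \<open>0 < e\<close> by (intro exI[of _ \<delta>]) (force simp: dist_real_def)
  qed
qed

lemma running_Sup:
  fixes y :: "real \<Rightarrow> real"
  assumes y: "continuous_on {c..d} y" and t: "t \<in> {c..d}"
  shows "\<And>s. s \<in> {c..t} \<Longrightarrow> y s \<le> Sup (y ` {c..t})"
    and "\<exists>s\<in>{c..t}. y s = Sup (y ` {c..t})"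
proof -
  have "continuous_on {c..t} y"
    using y t by (auto elim!: continuous_on_subset)
  then obtain s where s: "s \<in> {c..t}" "\<And>u. u \<in> {c..t} \<Longrightarrow> y u \<le> y s"
    using continuous_attains_sup[of "{c..t}" y] t by auto
  then have "Sup (y ` {c..t}) = y s"
    by (intro cSup_eq_maximum) auto
  with s show "\<And>s. s \<in> {c..t} \<Longrightarrow> y s \<le> Sup (y ` {c..t})" "\<exists>s\<in>{c..t}. y s = Sup (y ` {c..t})"
    by auto
qed

text \<open>On a window where \<open>y\<close> oscillates by at most one, the two barriers do not interact.\<close>

lemma skorokhod_window:
  assumes cd: "c \<le> d" and y: "continuous_on {c..d} y" and kc: "y c - kc \<in> {0..1}"
    and osc: "\<And>s t. s \<in> {c..d} \<Longrightarrow> t \<in> {c..d} \<Longrightarrow> y s - y t \<le> 1"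
  shows "\<exists>k. skorokhod_on c d y k \<and> k c = kc"
proof -
  define M where "M s = Sup (y ` {c..s})" for s
  define m where "m s = - Sup ((\<lambda>u. - y u) ` {c..s})" for s
  \<comment> \<open>The barrier 0 alone forces \<open>k\<close> below the running minimum
    \<open>m\<close>, the barrier 1 alone forces it above \<open>M - 1\<close>. Since
    \<open>y\<close> oscillates by at most one, \<open>M - 1 \<le> m\<close> throughout, and
    clamping the initial value \<open>kc\<close> between the two obeys both.\<close>
  define k where "k s = max (min kc (m s)) (M s - 1)" for s
  have my: "continuous_on {c..d} (\<lambda>u. - y u)"
    using y by (intro continuous_intros)
  have M: "y u \<le> M s" if "s \<in> {c..d}" "u \<in> {c..s}" for s u
    using running_Sup(1)[OF y that] by (simp add: M_def)
  have m: "m s \<le> y u" if "s \<in> {c..d}" "u \<in> {c..s}" for s u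
    using running_Sup(1)[OF my that] by (simp add: m_def)
  have Ma: "\<exists>u\<in>{c..s}. y u = M s" if "s \<in> {c..d}" for s
    using running_Sup(2)[OF y that] by (simp add: M_def)
  have ma: "\<exists>u\<in>{c..s}. y u = m s" if s: "s \<in> {c..d}" for s
  proof -
    obtain u where "u \<in> {c..s}" "- y u = - m s"
      using running_Sup(2)[OF my s] by (auto simp: m_def)
    then show ?thesis by auto
  qed
  have Mm: "M s - 1 \<le> m t" if st: "s \<in> {c..d}" "t \<in> {c..d}" for s t
  proof -
    obtain u v where "u \<in> {c..s}" "y u = M s" "v \<in> {c..t}" "y v = m t"
      using Ma[OF st(1)] ma[OF st(2)] by auto
    then show ?thesis
      using osc[of u v] st by auto
  qed
  have Mmono: "M s \<le> M t" if "s \<in> {c..d}" "t \<in> {c..d}" "s \<le> t" for s t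
    using Ma[of s] M[of t] that by force
  have mmono: "m t \<le> m s" if "s \<in> {c..d}" "t \<in> {c..d}" "s \<le> t" for s t
    using ma[of s] m[of t] that by force
  have cont: "continuous_on {c..d} k"
    unfolding k_def M_def m_def
    by (intro continuous_on_max continuous_on_min continuous_intros continuous_running_Sup y my)
  have range: "y t - k t \<in> {0..1}" if t: "t \<in> {c..d}" for t
  proof -
    have "M t - 1 \<le> m t" "m t \<le> y t" "y t \<le> M t"
      using Mm[OF t t] m[OF t, of t] M[OF t, of t] t by auto
    then show ?thesis
      by (auto simp: k_def)
  qed
  have up: "k s \<le> k t" if st: "c \<le> s" "s \<le> t" "t \<le> d" "\<forall>u\<in>{s<..t}. 0 < y u - k u" for s t
  proof (rule ccontr)
    assume "\<not> k s \<le> k t"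
    have s: "s \<in> {c..d}" and t: "t \<in> {c..d}"
      using st by auto
    have *: "m t < kc" "m t < m s" "k t < k s"
      using \<open>\<not> k s \<le> k t\<close> Mmono[OF s t st(2)] mmono[OF s t st(2)] unfolding k_def by auto
    \<comment> \<open>A drop of \<open>k\<close> means that the running minimum has reached a new
      value after time \<open>s\<close>. Where this value is attained, \<open>k\<close> is at least
      \<open>y\<close>, so the path is at the barrier 0.\<close>
    obtain u where u: "u \<in> {c..t}" "y u = m t"
      using ma[OF t] by auto
    have us: "s < u"
      using m[OF s, of u] u * by force
    have u': "u \<in> {c..d}"
      using u t by auto
    have "m u = m t"
      using mmono[OF u' t] m[OF u', of u] u by auto
    then have "y u - k u \<le> 0"
      using u * by (auto simp: k_def)
    then show False
      using st(4) us u by force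
  qed
  have down: "k t \<le> k s" if st: "c \<le> s" "s \<le> t" "t \<le> d" "\<forall>u\<in>{s<..t}. y u - k u < 1" for s t
  proof (rule ccontr)
    assume "\<not> k t \<le> k s"
    have s: "s \<in> {c..d}" and t: "t \<in> {c..d}"
      using st by auto
    have *: "M s < M t" "k s < k t"
      using \<open>\<not> k t \<le> k s\<close> Mmono[OF s t st(2)] mmono[OF s t st(2)] unfolding k_def by auto
    obtain u where u: "u \<in> {c..t}" "y u = M t"
      using Ma[OF t] by auto
    have us: "s < u"
      using M[OF s, of u] u * by force
    have u': "u \<in> {c..d}"
      using u t by auto
    have Mu: "M u = M t"
      using Mmono[OF u' t] M[OF u', of u] u by auto
    \<comment> \<open>A rise of \<open>k\<close> can only come from the term \<open>M - 1\<close>.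
      This term is already the active one at the time \<open>u\<close> of the new maximum, which
      puts the path at the barrier 1 there.\<close>
    have "k t = M t - 1"
      using *(2) mmono[OF s t st(2)] unfolding k_def by (auto simp: max_def min_def split: if_splits)
    moreover have "k t > min kc (m s)"
      using *(2) by (simp add: k_def)
    ultimately have "min kc (m u) \<le> M u - 1"
      using mmono[OF s u'] us Mu by (auto simp: min_def split: if_splits)
    then have "y u - k u = 1"
      using u Mu by (auto simp: k_def)
    then show False
      using st(4) us u by force
  qed
  have "m c = y c" "M c = y c"
    using ma[of c] Ma[of c] cd by auto
  then have "k c = kc"
    using kc by (auto simp: k_def)
  then show ?thesis
    using cont range up down unfolding skorokhod_on_def by (intro exI[of _ k]) blast
qed

text \<open>A half-open interval \<open>{s<..t}\<close> containing \<open>m\<close> splits exactly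
  into \<open>{s<..m}\<close> and \<open>{m<..t}\<close>, so monotonicity over it is the composition
  of the conditions on the two sides.\<close>

lemma skorokhod_on_glue:
  assumes 1: "skorokhod_on c m y k1" and 2: "skorokhod_on m d y k2" and eq: "k1 m = k2 m"
    and cmd: "c \<le> m" "m \<le> d"
  shows "skorokhod_on c d y (\<lambda>t. if t \<le> m then k1 t else k2 t)"
proof -
  define k where "k t = (if t \<le> m then k1 t else k2 t)" for t
  note K1 = skorokhod_onD[OF 1] and K2 = skorokhod_onD[OF 2]
  have k1: "k t = k1 t" if "t \<le> m" for t
    using that by (simp add: k_def)
  have k2: "k t = k2 t" if "m \<le> t" for t
    using that eq by (cases "t = m") (auto simp: k_def)
  have "continuous_on ({c..m} \<union> {m..d}) k"
    unfolding k_def using K1(1) K2(1) eq by (intro continuous_on_If) auto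
  moreover have "{c..m} \<union> {m..d} = {c..d}"
    using cmd by auto
  ultimately have cont: "continuous_on {c..d} k"
    by simp
  have range: "y t - k t \<in> {0..1}" if "t \<in> {c..d}" for t
    using that K1(2)[of t] K2(2)[of t] k1[of t] k2[of t] by (cases "t \<le> m") auto
  have up: "k s \<le> k t" if st: "c \<le> s" "s \<le> t" "t \<le> d" "\<forall>u\<in>{s<..t}. 0 < y u - k u" for s t
  proof -
    consider "t \<le> m" | "m \<le> s" | "s < m" "m < t" by linarith
    then show ?thesis
    proof cases
      case 1
      then show ?thesis using st K1(3)[of s t] k1 by auto
    next
      case 2
      then show ?thesis using st K2(3)[of s t] k2 by auto
    next
      case 3
      have "0 < y u - k1 u" if "u \<in> {s<..m}" for u
        using bspec[OF st(4), of u] that k1[of u] 3 by auto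
      then have "k1 s \<le> k1 m"
        using st 3 by (intro K1(3)) auto
      moreover have "0 < y u - k2 u" if "u \<in> {m<..t}" for u
        using bspec[OF st(4), of u] that k2[of u] 3 by auto
      then have "k2 m \<le> k2 t"
        using st 3 by (intro K2(3)) auto
      ultimately show ?thesis
        using k1[of s] k2[of t] 3 eq by simp
    qed
  qed
  have down: "k t \<le> k s" if st: "c \<le> s" "s \<le> t" "t \<le> d" "\<forall>u\<in>{s<..t}. y u - k u < 1" for s t
  proof -
    consider "t \<le> m" | "m \<le> s" | "s < m" "m < t" by linarith
    then show ?thesis
    proof cases
      case 1
      then show ?thesis using st K1(4)[of s t] k1 by auto
    next
      case 2
      then show ?thesis using st K2(4)[of s t] k2 by auto
    next
      case 3
      have "y u - k2 u < 1" if "u \<in> {m<..t}" for u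
        using bspec[OF st(4), of u] that k2[of u] 3 by auto
      then have "k2 t \<le> k2 m"
        using st 3 by (intro K2(4)) auto
      moreover have "y u - k1 u < 1" if "u \<in> {s<..m}" for u
        using bspec[OF st(4), of u] that k1[of u] 3 by auto
      then have "k1 m \<le> k1 s"
        using st 3 by (intro K1(4)) auto
      ultimately show ?thesis
        using k1[of s] k2[of t] 3 eq by simp
    qed
  qed
  show ?thesis
    using cont range up down unfolding skorokhod_on_def k_def[symmetric] by blast
qed

text \<open>Uniform continuity, with a mesh that divides \<open>T\<close> exactly. It yields the
  windows for the construction of \<open>k\<close> and, applied to the reflected path, the windows
  on which \<open>k\<close> is monotone.\<close>

lemma uniform_grid:
  fixes y :: "real \<Rightarrow> real"
  assumes T: "0 < T" and y: "continuous_on {0..T} y" and e: "0 < e"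
  shows "\<exists>n h. 0 < h \<and> real n * h = T \<and>
    (\<forall>s\<in>{0..T}. \<forall>t\<in>{0..T}. \<bar>s - t\<bar> \<le> h \<longrightarrow> \<bar>y s - y t\<bar> < e)"
proof -
  have "uniformly_continuous_on {0..T} y"
    using y by (intro compact_uniformly_continuous) auto
  then obtain \<delta> where \<delta>: "0 < \<delta>"
    "\<And>u v. u \<in> {0..T} \<Longrightarrow> v \<in> {0..T} \<Longrightarrow> dist v u < \<delta> \<Longrightarrow> dist (y v) (y u) < e"
    using e unfolding uniformly_continuous_on_def by meson
  obtain n :: nat where n: "T / \<delta> < real n"
    using reals_Archimedean2 by blast
  moreover have "0 < T / \<delta>"
    using T \<delta> by simp
  ultimately have "0 < real n"
    by linarith
  then have "T / real n < \<delta>"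
    using n \<delta> by (simp add: field_simps)
  show ?thesis
  proof (intro exI[of _ n] exI[of _ "T / real n"] conjI ballI impI)
    show "0 < T / real n" "real n * (T / real n) = T"
      using T \<open>0 < real n\<close> by auto
    show "\<bar>y s - y t\<bar> < e" if "s \<in> {0..T}" "t \<in> {0..T}" "\<bar>s - t\<bar> \<le> T / real n" for s t
      using \<delta>(2)[of t s] that \<open>T / real n < \<delta>\<close> by (auto simp: dist_real_def)
  qed
qed

lemma skorokhod_exists:
  assumes T: "0 < T" and y: "continuous_on {0..T} y" and y0: "y 0 \<in> {0..1}"
  shows "\<exists>k. skorokhod T y k"
proof -
  obtain n h where h: "0 < h" "real n * h = T"
    and osc: "\<And>s t. s \<in> {0..T} \<Longrightarrow> t \<in> {0..T} \<Longrightarrow> \<bar>s - t\<bar> \<le> h \<Longrightarrow> \<bar>y s - y t\<bar> < 1"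
    using uniform_grid[OF T y zero_less_one] by blast
  have "j \<le> n \<Longrightarrow> \<exists>k. skorokhod_on 0 (real j * h) y k \<and> k 0 = 0" for j
  proof (induction j)
    case 0
    show ?case
      using skorokhod_window[of 0 0 y 0] y0 by auto
  next
    case (Suc j)
    then obtain k where k: "skorokhod_on 0 (real j * h) y k" "k 0 = 0"
      by auto
    have le: "real (Suc j) * h \<le> T"
      unfolding h(2)[symmetric] using Suc.prems h(1) by (intro mult_right_mono) auto
    have m0: "0 \<le> real j * h"
      using h(1) by simp
    have sub: "{real j * h..real (Suc j) * h} \<subseteq> {0..T}"
      using le m0 by auto
    have "\<exists>k'. skorokhod_on (real j * h) (real (Suc j) * h) y k' \<and> k' (real j * h) = k (real j * h)"
    proof (rule skorokhod_window)
      show "real j * h \<le> real (Suc j) * h"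
        using h(1) by (simp add: algebra_simps)
      show "continuous_on {real j * h..real (Suc j) * h} y"
        using y sub by (rule continuous_on_subset)
      show "y (real j * h) - k (real j * h) \<in> {0..1}"
        using skorokhod_onD(2)[OF k(1)] m0 by auto
      show "y s - y t \<le> 1"
        if "s \<in> {real j * h..real (Suc j) * h}" "t \<in> {real j * h..real (Suc j) * h}" for s t
      proof -
        have "\<bar>s - t\<bar> \<le> h"
          using that by (simp add: algebra_simps abs_le_iff)
        moreover have "s \<in> {0..T}" "t \<in> {0..T}"
          using that sub by blast+
        ultimately show ?thesis
          using osc[of s t] by simp
      qed
    qed
    then obtain k' where "skorokhod_on (real j * h) (real (Suc j) * h) y k'" "k' (real j * h) = k (real j * h)"
      by auto
    then have "skorokhod_on 0 (real (Suc j) * h) y (\<lambda>t. if t \<le> real j * h then k t else k' t)"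
      using k h(1) by (intro skorokhod_on_glue) (auto simp: algebra_simps)
    moreover have "(\<lambda>t. if t \<le> real j * h then k t else k' t) 0 = 0"
      using k(2) m0 by simp
    ultimately show ?case
      by (intro exI[of _ "\<lambda>t. if t \<le> real j * h then k t else k' t"] conjI)
  qed
  from this[of n] show ?thesis
    by (simp add: skorokhod_def h(2))
qed

text \<open>This holds for arbitrary \<open>F\<close>, monotone and right-continuous or not: if some
  measure extends the prescribed increments, the interval has the value \<open>F b - F a\<close>,
  and otherwise \<open>interval_measure\<close> is by definition the zero measure. Hence the
  variation measure of a given solution can be handled before anything is known about the regularity
  of its total variation.\<close>

lemma emeasure_interval_measure_Ioc_finite:
  assumes "a \<le> b"
  shows "emeasure (interval_measure F) {a<..b} < \<infinity>"
proof -
  let ?I = "{(a, b::real). a \<le> b}" and ?G = "\<lambda>(a, b::real). {a<..b}"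
    and ?\<mu> = "\<lambda>(a, b). ennreal (F b - F a)"
  let ?P = "\<lambda>\<mu>'. (\<forall>i\<in>?I. \<mu>' (?G i) = ?\<mu> i) \<and> measure_space UNIV (sigma_sets UNIV (?G ` ?I)) \<mu>'"
  have meas: "{a<..b} \<in> sigma_sets UNIV (?G ` ?I)"
    using assms by (intro sigma_sets.Basic) auto
  show ?thesis
  proof (cases "(\<exists>\<mu>'. ?P \<mu>') \<and> \<not> (\<forall>i\<in>?I. ?\<mu> i = 0)")
    case True
    have P: "?P (SOME \<mu>'. ?P \<mu>')"
      by (rule someI_ex[OF conjunct1[OF True]])
    have "interval_measure F = measure_of UNIV (?G ` ?I) (SOME \<mu>'. ?P \<mu>')"
      by (simp only: interval_measure_def extend_measure_def if_P[OF True])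
    then have "emeasure (interval_measure F) {a<..b} = (SOME \<mu>'. ?P \<mu>') {a<..b}"
      using P meas unfolding measure_space_def by (intro emeasure_measure_of) auto
    also have "\<dots> = ?\<mu> (a, b)"
      using P assms by force
    finally show ?thesis
      by simp
  next
    case False
    have "interval_measure F = measure_of UNIV (?G ` ?I) (\<lambda>_. 0)"
      by (simp only: interval_measure_def extend_measure_def if_not_P[OF False])
    then show ?thesis
      by (simp add: emeasure_sigma)
  qed
qed

section \<open>Contact times and the equivalence of the reflected equation with the Skorokhod
  problem\<close>

definition contact :: "(real \<Rightarrow> real) \<Rightarrow> real \<Rightarrow> real \<Rightarrow> real set" where
  "contact x c t = {s \<in> {0..t}. x s = c}"

lemma contact_borel:
  assumes "continuous_on {0..T} x" "t \<le> T"
  shows "contact x c t \<in> sets borel"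
proof -
  have "closed ({0..t} \<inter> x -` {c})"
    using assms by (intro continuous_closed_preimage) (auto elim!: continuous_on_subset)
  moreover have "{0..t} \<inter> x -` {c} = contact x c t"
    by (auto simp: contact_def)
  ultimately show ?thesis
    by (metis borel_closed)
qed

lemma contact_finite:
  assumes "0 \<le> t"
  shows "emeasure (variation_measure T k) (contact x c t) < \<infinity>"
proof -
  \<comment> \<open>The left end -1 makes the half-open interval include the time 0.\<close>
  have "emeasure (variation_measure T k) (contact x c t) \<le> emeasure (variation_measure T k) {-1<..t}"
    by (intro emeasure_mono) (auto simp: contact_def variation_measure_def)
  also have "\<dots> < \<infinity>"
    unfolding variation_measure_def using assms by (intro emeasure_interval_measure_Ioc_finite) auto
  finally show ?thesis .
qed

text \<open>Both integrands are combinations of indicators of the two contact sets, the sum for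
  \<open>indicator {0,1}\<close> and the difference for \<open>outer_normal\<close>; finiteness of
  these sets turns the integrals into measures.\<close>

lemma reflection_integrals:
  assumes x: "continuous_on {0..T} x" and t: "t \<in> {0..T}" and m: "m = variation_measure T k"
  shows "(LINT s:{0..t}|m. indicator {0,1} (x s)) = measure m (contact x 1 t) + measure m (contact x 0 t)"
    and "(LINT s:{0..t}|m. outer_normal (x s)) = measure m (contact x 1 t) - measure m (contact x 0 t)"
proof -
  have sets: "contact x c t \<in> sets m" for c
    using contact_borel[OF x, of t c] t by (simp add: m variation_measure_def)
  have fin: "emeasure m (contact x c t) < \<infinity>" for c
    using contact_finite[of t T k x c] t by (simp add: m)
  have int: "integrable m (indicator (contact x c t) :: real \<Rightarrow> real)" for c
    using sets fin by (intro integrable_real_indicator) auto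
  have "(LINT s:{0..t}|m. indicator {0,1} (x s)) =
    (\<integral>s. indicat_real (contact x 1 t) s + indicat_real (contact x 0 t) s \<partial>m)"
    unfolding set_lebesgue_integral_def
    by (intro Bochner_Integration.integral_cong) (auto simp: contact_def indicator_def)
  also have "\<dots> = measure m (contact x 1 t) + measure m (contact x 0 t)"
    using int sets by simp
  finally show "(LINT s:{0..t}|m. indicator {0,1} (x s)) = measure m (contact x 1 t) + measure m (contact x 0 t)" .
  have "(LINT s:{0..t}|m. outer_normal (x s)) =
    (\<integral>s. indicat_real (contact x 1 t) s - indicat_real (contact x 0 t) s \<partial>m)"
    unfolding set_lebesgue_integral_def
    by (intro Bochner_Integration.integral_cong) (auto simp: contact_def indicator_def outer_normal_def)
  also have "\<dots> = measure m (contact x 1 t) - measure m (contact x 0 t)"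
    using int sets by simp
  finally show "(LINT s:{0..t}|m. outer_normal (x s)) = measure m (contact x 1 t) - measure m (contact x 0 t)" .
qed

text \<open>The pushing term is the mass of the contact set at 1 minus the mass of the contact set
  at 0. Both grow with time, and each stands still as long as its barrier is not touched, which
  gives the two monotonicity rules.\<close>

lemma reflected_equation_imp_skorokhod:
  assumes eq: "reflected_equation T a b z x k"
    and x: "continuous_on {0..T} x" "x \<in> {0..T} \<rightarrow> {0..1}"
    and k: "continuous_on {0..T} k"
  shows "skorokhod T (\<lambda>t. a + (LINT s:{0..t}|lborel. b s) + z t) k"
    and "t \<in> {0..T} \<Longrightarrow> x t = a + (LINT s:{0..t}|lborel. b s) + z t - k t"
proof -
  define y where "y = (\<lambda>t. a + (LINT s:{0..t}|lborel. b s) + z t)"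
  define m where "m = variation_measure T k"
  have yx: "y t - k t = x t" if "t \<in> {0..T}" for t
    using eq that by (auto simp: reflected_equation_def y_def)
  have kt: "k t = measure m (contact x 1 t) - measure m (contact x 0 t)" if "t \<in> {0..T}" for t
    using eq that reflection_integrals(2)[OF x(1) that refl, of k]
    by (auto simp: reflected_equation_def m_def)
  have mono: "measure m (contact x c s) \<le> measure m (contact x c t)"
    if "0 \<le> s" "s \<le> t" "t \<le> T" for s t c
  proof -
    have "contact x c s \<in> sets m" "contact x c t \<in> sets m"
      using contact_borel[OF x(1), of _ c] that by (auto simp: m_def variation_measure_def)
    moreover have "emeasure m (contact x c t) < \<infinity>"
      using contact_finite[of t T k x c] that by (simp add: m_def)
    moreover have "contact x c s \<subseteq> contact x c t"
      using that by (auto simp: contact_def)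
    ultimately show ?thesis
      by (intro measure_mono_fmeasurable) (auto simp: fmeasurable_def)
  qed
  have same: "contact x c s = contact x c t"
    if "0 \<le> s" "s \<le> t" "t \<le> T" "\<And>u. u \<in> {s<..t} \<Longrightarrow> y u - k u \<noteq> c" for s t c
  proof -
    have "x u \<noteq> c" if u: "s < u" "u \<le> t" for u
      using \<open>\<And>u. u \<in> {s<..t} \<Longrightarrow> y u - k u \<noteq> c\<close>[of u] yx[of u] u \<open>0 \<le> s\<close> \<open>t \<le> T\<close> by auto
    then show ?thesis
      using that by (force simp: contact_def)
  qed
  have up: "k s \<le> k t" if st: "0 \<le> s" "s \<le> t" "t \<le> T" "\<forall>u\<in>{s<..t}. 0 < y u - k u" for s t
  proof -
    have "contact x 0 s = contact x 0 t"
      using st(1-3) by (rule same) (use st(4) in force)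
    then show ?thesis
      using kt[of s] kt[of t] mono[OF st(1-3), of 1] st by auto
  qed
  have down: "k t \<le> k s" if st: "0 \<le> s" "s \<le> t" "t \<le> T" "\<forall>u\<in>{s<..t}. y u - k u < 1" for s t
  proof -
    have "contact x 1 s = contact x 1 t"
      using st(1-3) by (rule same) (use st(4) in force)
    then show ?thesis
      using kt[of s] kt[of t] mono[OF st(1-3), of 0] st by auto
  qed
  have k0: "k 0 = 0"
    using eq by (auto simp: reflected_equation_def)
  have range: "\<forall>t\<in>{0..T}. y t - k t \<in> {0..1}"
    using yx x(2) by (auto simp: Pi_iff)
  show "skorokhod T (\<lambda>t. a + (LINT s:{0..t}|lborel. b s) + z t) k"
    using k k0 range up down unfolding skorokhod_def skorokhod_on_def y_def[symmetric] by blast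
  show "x t = a + (LINT s:{0..t}|lborel. b s) + z t - k t" if "t \<in> {0..T}"
    using yx[OF that] by (simp add: y_def)
qed

text \<open>\<open>D i\<close> is the part of the path run through on the window number \<open>i\<close>; it is stopped outside.\<close>

lemma total_variation_piecewise_monotone:
  fixes k :: "real \<Rightarrow> real" and tt :: "nat \<Rightarrow> real" and sg :: "nat \<Rightarrow> real"
  assumes tt: "mono tt" "tt 0 = 0" "tt n = T"
    and sg: "\<And>i. i < n \<Longrightarrow> sg i \<in> {-1, 1}"
    and mon': "\<forall>i<n. \<forall>u v. tt i \<le> u \<and> u \<le> v \<and> v \<le> tt (Suc i) \<longrightarrow> sg i * k u \<le> sg i * k v"
  defines "D \<equiv> \<lambda>i t. k (min t (tt (Suc i))) - k (min t (tt i))"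
  defines "A \<equiv> \<lambda>t. \<Sum>i<n. sg i * D i t"
  shows "bdd_above (variation_sums k 0 T)"
    and "t \<in> {0..T} \<Longrightarrow> total_variation k 0 t = A t"
    and "0 \<le> s \<Longrightarrow> s \<le> t \<Longrightarrow> A s \<le> A t"
    and "j < n \<Longrightarrow> tt j \<le> s \<Longrightarrow> s \<le> t \<Longrightarrow> t \<le> tt (Suc j) \<Longrightarrow> A t - A s = sg j * (k t - k s)"
    and "0 \<le> s \<Longrightarrow> (\<And>u. u \<in> {s..t} \<Longrightarrow> k u = k s) \<Longrightarrow> s \<le> t \<Longrightarrow> A t = A s"
    and "A 0 = 0"
proof -
  have mon: "sg i * k u \<le> sg i * k v" if "i < n" "tt i \<le> u" "u \<le> v" "v \<le> tt (Suc i)" for i u v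
    using mon' that by blast
  have tle: "tt i \<le> tt j" if "i \<le> j" for i j
    using tt(1) that by (rule monoD)
  have tt0: "0 \<le> tt i" for i
    using tle[of 0 i] tt by simp
  have Dmono: "sg i * D i u \<le> sg i * D i v" if "0 \<le> u" "u \<le> v" "i < n" for i u v
  proof -
    consider "v \<le> tt i" | "u \<le> tt i" "tt i < v" | "tt i < u" by linarith
    then show ?thesis
    proof cases
      case 1
      then show ?thesis
        using tle[of i "Suc i"] that by (auto simp: D_def min_def)
    next
      case 2
      have "sg i * k (tt i) \<le> sg i * k (min v (tt (Suc i)))"
        using 2 tle[of i "Suc i"] that by (intro mon) auto
      then show ?thesis
        using 2 tle[of i "Suc i"] by (auto simp: D_def min_def algebra_simps)
    next
      case 3
      have "sg i * k (min u (tt (Suc i))) \<le> sg i * k (min v (tt (Suc i)))"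
        using 3 tle[of i "Suc i"] that by (intro mon) auto
      then show ?thesis
        using 3 that by (auto simp: D_def min_def algebra_simps)
    qed
  qed
  have absD: "\<bar>D i v - D i u\<bar> = sg i * D i v - sg i * D i u" if "0 \<le> u" "u \<le> v" "i < n" for i u v
    using Dmono[OF that] sg[OF that(3)] by auto
  have D0: "D i 0 = 0" for i
    using tt0[of i] tt0[of "Suc i"] by (auto simp: D_def min_def)
  then show A0: "A 0 = 0"
    by (simp add: A_def)
  show Amono: "A s \<le> A t" if "0 \<le> s" "s \<le> t" for s t
    unfolding A_def using that by (intro sum_mono Dmono) auto
  have ksum: "k u - k 0 = (\<Sum>i<n. D i u)" if "u \<in> {0..T}" for u
  proof -
    have "(\<Sum>i<n. D i u) = k (min u (tt n)) - k (min u (tt 0))"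
      unfolding D_def by (rule sum_lessThan_telescope)
    then show ?thesis
      using that tt by (simp add: min_absorb1 min_absorb2)
  qed
  \<comment> \<open>\<open>A\<close> dominates every increment of \<open>k\<close>; telescoping over
    an arbitrary partition then shows that \<open>A\<close> bounds all variation sums.\<close>
  have kA: "\<bar>k v - k u\<bar> \<le> A v - A u" if "0 \<le> u" "u \<le> v" "v \<le> T" for u v
  proof -
    have "k v - k u = (\<Sum>i<n. D i v - D i u)"
      using ksum[of u] ksum[of v] that by (simp add: sum_subtractf)
    then have "\<bar>k v - k u\<bar> \<le> (\<Sum>i<n. \<bar>D i v - D i u\<bar>)"
      by (simp add: sum_abs)
    also have "\<dots> = (\<Sum>i<n. sg i * D i v - sg i * D i u)"
      using that by (intro sum.cong absD) auto
    finally show ?thesis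
      by (simp add: A_def sum_subtractf)
  qed
  have le: "v \<le> A t" if v: "v \<in> variation_sums k 0 t" and t: "t \<in> {0..T}" for v t
  proof -
    obtain N :: nat and u :: "nat \<Rightarrow> real" where u: "mono u" "range u \<subseteq> {0..t}"
      and vv: "v = (\<Sum>j<N. \<bar>k (u (Suc j)) - k (u j)\<bar>)"
      using v by (auto simp: variation_sums_def)
    have r: "u j \<in> {0..t}" for j
      using u(2) by blast
    have "v \<le> (\<Sum>j<N. A (u (Suc j)) - A (u j))"
      unfolding vv using r t monoD[OF u(1)] by (intro sum_mono kA) (auto intro: order_trans)
    also have "\<dots> = A (u N) - A (u 0)"
      by (rule sum_lessThan_telescope)
    also have "\<dots> \<le> A t"
      using Amono[of 0 "u 0"] Amono[of "u N" t] r[of 0] r[of N] A0 by auto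
    finally show ?thesis .
  qed
  have "0 \<le> T"
    using tle[of 0 n] tt by simp
  then show "bdd_above (variation_sums k 0 T)"
    using le[of _ T] by (intro bdd_aboveI[of _ "A T"]) auto
  \<comment> \<open>The bound is attained by the partition into the window ends \<open>tt j\<close>,
    stopped at \<open>t\<close>, since on each window the increment with the sign \<open>sg\<close>
    is its absolute value.\<close>
  have mem: "A t \<in> variation_sums k 0 t" if t: "t \<in> {0..T}" for t
  proof -
    have "A t = (\<Sum>i<n. \<bar>D i t\<bar>)"
      unfolding A_def using absD[of 0 t] D0 t by (intro sum.cong) auto
    also have "\<dots> = (\<Sum>j<n. \<bar>k (min t (tt (Suc j))) - k (min t (tt j))\<bar>)"
      by (simp add: D_def)
    finally have *: "A t = (\<Sum>j<n. \<bar>k (min t (tt (Suc j))) - k (min t (tt j))\<bar>)" .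
    have "mono (\<lambda>j. min t (tt j))" "range (\<lambda>j. min t (tt j)) \<subseteq> {0..t}"
      using tle tt0 t by (auto simp: mono_def min_le_iff_disj)
    with * show ?thesis
      unfolding variation_sums_def
      by (intro CollectI exI[of _ n] exI[of _ "\<lambda>j. min t (tt j)"]) auto
  qed
  show "total_variation k 0 t = A t" if "t \<in> {0..T}"
    unfolding total_variation_def using mem[OF that] le[OF _ that] by (intro cSup_eq_maximum) auto
  show "A t - A s = sg j * (k t - k s)" if st: "j < n" "tt j \<le> s" "s \<le> t" "t \<le> tt (Suc j)"
  proof -
    have eq0: "D i t = D i s" if "i < n" "i \<noteq> j" for i
    proof -
      have "tt (Suc i) \<le> tt j \<or> tt (Suc j) \<le> tt i"
        using that tle[of "Suc i" j] tle[of "Suc j" i] by (cases "i < j") auto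
      then show ?thesis
      proof
        assume "tt (Suc i) \<le> tt j"
        then show ?thesis
          using st tle[of i "Suc i"] by (simp add: D_def min_absorb2)
      next
        assume "tt (Suc j) \<le> tt i"
        then show ?thesis
          using st tle[of i "Suc i"] by (simp add: D_def min_absorb1)
      qed
    qed
    have "A t - A s = (\<Sum>i<n. sg i * (D i t - D i s))"
      by (simp add: A_def sum_subtractf algebra_simps)
    also have "\<dots> = (\<Sum>i<n. if i = j then sg j * (D j t - D j s) else 0)"
      using eq0 by (intro sum.cong) auto
    also have "\<dots> = sg j * (D j t - D j s)"
      using st by simp
    also have "D j t - D j s = k t - k s"
      using st by (auto simp: D_def min_def)
    finally show ?thesis .
  qed
  show "A t = A s" if st: "0 \<le> s" "\<And>u. u \<in> {s..t} \<Longrightarrow> k u = k s" "s \<le> t"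
  proof -
    have "k (min t q) - k (min s q) = 0" for q
      using st(2)[of "min t q"] st(2)[of s] st(3) by (cases "q \<le> s") (auto simp: min_def)
    then have "D i t = D i s" for i
      by (simp add: D_def)
    then show ?thesis
      by (simp add: A_def)
  qed
qed

text \<open>On a window in which the path moves by less than one, only one barrier is within reach,
  so \<open>k\<close> is monotone there and its total variation is the explicit sum
  \<open>A\<close>. The variation measure does not charge the times at which the path is strictly
  inside, so the two contact sets carry all of it.\<close>

lemma skorokhod_imp_contact_measure:
  assumes T: "0 < T" and y: "continuous_on {0..T} y" and sk: "skorokhod T y k"
  defines "x \<equiv> \<lambda>t. y t - k t" and "m \<equiv> variation_measure T k"
  shows "bdd_above (variation_sums k 0 T)"
    and "t \<in> {0..T} \<Longrightarrow> total_variation k 0 t = measure m (contact x 1 t) + measure m (contact x 0 t)"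
    and "t \<in> {0..T} \<Longrightarrow> k t = measure m (contact x 1 t) - measure m (contact x 0 t)"
proof -
  have so: "skorokhod_on 0 T y k" and k0: "k 0 = 0"
    using sk by (auto simp: skorokhod_def)
  note K' = skorokhod_onD[OF so]
  have K: "continuous_on {0..T} k" "\<And>t. t \<in> {0..T} \<Longrightarrow> x t \<in> {0..1}"
    "\<And>s t. 0 \<le> s \<Longrightarrow> s \<le> t \<Longrightarrow> t \<le> T \<Longrightarrow> (\<And>u. u \<in> {s<..t} \<Longrightarrow> 0 < x u) \<Longrightarrow> k s \<le> k t"
    "\<And>s t. 0 \<le> s \<Longrightarrow> s \<le> t \<Longrightarrow> t \<le> T \<Longrightarrow> (\<And>u. u \<in> {s<..t} \<Longrightarrow> x u < 1) \<Longrightarrow> k t \<le> k s"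
    unfolding x_def by (fact K')+
  have xc: "continuous_on {0..T} x"
    unfolding x_def using y K(1) by (intro continuous_intros)
  obtain n h where h: "0 < h" "real n * h = T"
    and osc: "\<And>s t. s \<in> {0..T} \<Longrightarrow> t \<in> {0..T} \<Longrightarrow> \<bar>s - t\<bar> \<le> h \<Longrightarrow> \<bar>x s - x t\<bar> < 1"
    using uniform_grid[OF T xc zero_less_one] by blast
  define tt where "tt i = real i * h" for i
  have tt: "mono tt" "tt 0 = 0" "tt n = T"
    using h by (auto simp: tt_def mono_def)
  have tle: "tt i \<le> tt j" if "i \<le> j" for i j
    using tt(1) that by (rule monoD)
  have sub: "u \<in> {0..T}" if "i < n" "u \<in> {tt i..tt (Suc i)}" for i u
    using that tle[of 0 i] tle[of "Suc i" n] tt by auto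
  \<comment> \<open>The sign is 1 if the window avoids the barrier 0. Otherwise the path touches 0
    somewhere in the window, and as it moves by less than one it avoids the barrier 1.\<close>
  define sg where "sg i = (if \<forall>u\<in>{tt i..tt (Suc i)}. 0 < x u then 1 else -1 :: real)" for i
  have sg: "sg i \<in> {-1, 1}" for i
    by (simp add: sg_def)
  have pos: "0 < x u" if "sg i = 1" "u \<in> {tt i..tt (Suc i)}" for i u
    using that by (auto simp: sg_def split: if_splits)
  have neg: "x u < 1" if i: "i < n" "sg i = -1" and u: "u \<in> {tt i..tt (Suc i)}" for i u
  proof -
    obtain v where v: "v \<in> {tt i..tt (Suc i)}" "x v \<le> 0"
      using i by (auto simp: sg_def not_less split: if_splits)
    have "\<bar>x u - x v\<bar> < 1"
      using sub[OF i(1) u] sub[OF i(1) v(1)] u v by (intro osc) (auto simp: tt_def algebra_simps abs_le_iff)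
    then show ?thesis
      using v by auto
  qed
  have mon: "sg i * k u \<le> sg i * k v" if "i < n" "tt i \<le> u" "u \<le> v" "v \<le> tt (Suc i)" for i u v
  proof (cases "sg i = 1")
    case True
    have "k u \<le> k v"
      using that sub[of i u] sub[of i v] pos[OF True] by (intro K(3)) auto
    then show ?thesis
      using True by simp
  next
    case False
    then have m1: "sg i = -1"
      using sg[of i] by auto
    have "k v \<le> k u"
      using that sub[of i u] sub[of i v] neg[OF that(1) m1] by (intro K(4)) auto
    then show ?thesis
      using m1 by simp
  qed
  define A where "A t = (\<Sum>i<n. sg i * (k (min t (tt (Suc i))) - k (min t (tt i))))" for t
  have mon': "\<forall>i<n. \<forall>u v. tt i \<le> u \<and> u \<le> v \<and> v \<le> tt (Suc i) \<longrightarrow> sg i * k u \<le> sg i * k v"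
    using mon by blast
  note TV = total_variation_piecewise_monotone[of tt n T sg k, OF tt sg mon', folded A_def]
  show "bdd_above (variation_sums k 0 T)"
    by (rule TV(1))
  define G where "G t = total_variation k 0 (max 0 (min T t))" for t
  have GA: "G t = A (max 0 (min T t))" for t
    unfolding G_def using T by (intro TV(2)) auto
  have m: "m = interval_measure G"
    by (simp add: m_def variation_measure_def G_def[abs_def])
  have Gmono: "G s \<le> G t" if "s \<le> t" for s t
    unfolding GA using that by (intro TV(3)) auto
  have kmin: "continuous_on {0..T} (\<lambda>t. k (min t (tt i)))" if "i \<le> n" for i
    using T tle[of 0 i] tle[OF that] tt
    by (intro continuous_on_compose2[OF K(1)] continuous_intros) auto
  have Ac: "continuous_on {0..T} A"
    unfolding A_def by (intro continuous_intros kmin) auto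
  \<comment> \<open>Continuity excludes atoms, so closed intervals have mass
    \<open>G b - G a\<close> and the time 0 carries no mass.\<close>
  have Gc: "continuous_on UNIV G"
    unfolding GA using T by (intro continuous_on_compose2[OF Ac] continuous_intros) auto
  have Gm: "emeasure m {a..b} = G b - G a" if "a \<le> b" for a b
    unfolding m using that Gmono Gc by (rule emeasure_interval_measure_Icc)
  have setsm: "sets m = sets borel"
    by (simp add: m)
  \<comment> \<open>A time at which the path is strictly inside lies between rationals
    \<open>p\<close> and \<open>q\<close> such that no barrier is touched on \<open>[p,q]\<close>,
    up to clamping to \<open>[0,T]\<close>. There \<open>k\<close> is constant, hence so is its
    total variation, and the interval is null. Countably many such intervals cover all of these
    times.\<close>
  define N where "N = (\<Union>(p, q)\<in>{(p, q). p \<in> \<rat> \<and> q \<in> \<rat> \<and> p \<le> q \<and> G p = G q}. {p..q})"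
  have "N \<in> null_sets m"
    unfolding N_def
  proof (rule null_sets_UN')
    show "countable {(p, q). p \<in> \<rat> \<and> q \<in> \<rat> \<and> p \<le> q \<and> G p = G (q::real)}"
      by (rule countable_subset[of _ "\<rat> \<times> \<rat>"]) (auto intro!: countable_SIGMA countable_rat)
    show "(case pq of (p, q) \<Rightarrow> {p..q}) \<in> null_sets m"
      if "pq \<in> {(p, q). p \<in> \<rat> \<and> q \<in> \<rat> \<and> p \<le> q \<and> G p = G q}" for pq
      using that Gm by (auto simp: null_sets_def setsm)
  qed
  have inN: "s \<in> N" if s: "s \<in> {0..T}" "x s \<noteq> 0" "x s \<noteq> 1" for s
  proof -
    have xs: "0 < x s" "x s < 1"
      using K(2)[OF s(1)] s by auto
    then have "0 < min (x s) (1 - x s)"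
      by simp
    then obtain \<delta> where \<delta>: "0 < \<delta>" "\<And>u. u \<in> {0..T} \<Longrightarrow> dist u s < \<delta> \<Longrightarrow> dist (x u) (x s) < min (x s) (1 - x s)"
      using xc s(1) unfolding continuous_on_iff by meson
    obtain p where p: "p \<in> \<rat>" "s - \<delta> < p" "p < s"
      using Rats_dense_in_real[of "s - \<delta>" s] \<delta> by auto
    obtain q where q: "q \<in> \<rat>" "s < q" "q < s + \<delta>"
      using Rats_dense_in_real[of s "s + \<delta>"] \<delta> by auto
    \<comment> \<open>Clamping covers the case that \<open>s\<close> is an end of
      \<open>[0,T]\<close>; \<open>G\<close> is constant outside \<open>[0,T]\<close>, so
      \<open>p\<close> and \<open>q\<close> may be replaced by the clamped values.\<close>
    define p' where "p' = max 0 (min T p)"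
    define q' where "q' = max 0 (min T q)"
    have pq': "0 \<le> p'" "p' \<le> q'" "q' \<le> T"
      using p q T by (auto simp: p'_def q'_def)
    have near: "0 < x u \<and> x u < 1" if "u \<in> {p'..q'}" for u
    proof -
      have "dist u s < \<delta>"
        using that p q s \<delta>(1) by (auto simp: p'_def q'_def dist_real_def abs_if max_def min_def split: if_splits)
      then have "dist (x u) (x s) < min (x s) (1 - x s)"
        using \<delta>(2)[of u] that pq' by auto
      then show ?thesis
        by (auto simp: dist_real_def abs_if split: if_splits)
    qed
    have const: "k u = k p'" if u: "u \<in> {p'..q'}" for u
    proof (rule antisym)
      show "k p' \<le> k u"
        using u pq' near by (intro K(3)) auto
      show "k u \<le> k p'"
        using u pq' near by (intro K(4)) auto
    qed
    have "A q' = A p'"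
      by (rule TV(5)[OF pq'(1) const pq'(2)])
    then have "G p = G q"
      by (simp add: GA p'_def q'_def)
    then show ?thesis
      unfolding N_def using p q by (intro UN_I[of "(p, q)"]) auto
  qed
  have A0: "A 0 = 0"
    by (rule TV(6))
  have sets: "contact x c t \<in> sets m" if "t \<in> {0..T}" for c t
    using contact_borel[OF xc, of t c] that by (simp add: setsm)
  have fin: "contact x c t \<in> fmeasurable m" if "t \<in> {0..T}" for c t
    using contact_finite[of t T k x c] that sets by (simp add: m_def fmeasurable_def)
  have sum: "measure m (contact x 1 t) + measure m (contact x 0 t) = A t" if t: "t \<in> {0..T}" for t
  proof -
    have "measure m (contact x 1 t) + measure m (contact x 0 t) = measure m (contact x 1 t \<union> contact x 0 t)"
    proof (rule measure_Union[symmetric])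
      show "contact x 1 t \<inter> contact x 0 t = {}"
        by (auto simp: contact_def)
    qed (use fin[OF t, of 1] fin[OF t, of 0] in \<open>auto simp: fmeasurable_def\<close>)
    also have "\<dots> = measure m {0..t}"
    proof (intro measure_eq_AE)
      show "AE s in m. (s \<in> contact x 1 t \<union> contact x 0 t) = (s \<in> {0..t})"
      proof (rule AE_I'[OF \<open>N \<in> null_sets m\<close>], rule subsetI)
        fix s assume "s \<in> {s \<in> space m. (s \<in> contact x 1 t \<union> contact x 0 t) \<noteq> (s \<in> {0..t})}"
        then have "s \<in> {0..T}" "x s \<noteq> 0" "x s \<noteq> 1"
          using t by (auto simp: contact_def)
        then show "s \<in> N"
          by (rule inN)
      qed
    qed (use sets[OF t] setsm in auto)
    also have "\<dots> = G t - G 0"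
      using Gm[of 0 t] t Gmono[of 0 t] by (simp add: measure_def)
    also have "\<dots> = A t"
      using t T A0 by (simp add: GA)
    finally show ?thesis .
  qed
  then show "total_variation k 0 t = measure m (contact x 1 t) + measure m (contact x 0 t)" if "t \<in> {0..T}"
    using TV(2)[OF that] that by simp
  \<comment> \<open>\<open>H\<close> is the defect of the claimed formula for \<open>k\<close>. On
    each window one contact set does not change, so the mass of the other one grows as
    \<open>A\<close> does, that is by \<open>sg i\<close> times the increment of \<open>k\<close>;
    with either sign \<open>H\<close> stays constant.\<close>
  define H where "H t = measure m (contact x 1 t) - measure m (contact x 0 t) - k t" for t
  have Hstep: "H t = H s" if st: "i < n" "tt i \<le> s" "s \<le> t" "t \<le> tt (Suc i)" for i s t
  proof -
    have T': "s \<in> {0..T}" "t \<in> {0..T}"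
      using sub[of i s] sub[of i t] st by auto
    have A: "A t - A s = sg i * (k t - k s)"
      using st by (rule TV(4))
    have same: "contact x c t = contact x c s" if c: "\<And>u. u \<in> {tt i..tt (Suc i)} \<Longrightarrow> x u \<noteq> c" for c
    proof -
      have "u \<le> s" if "u \<le> t" "x u = c" for u
        using c[of u] that st by (cases "u \<le> s") auto
      then show ?thesis
        using st by (auto simp: contact_def)
    qed
    show ?thesis
    proof (cases "sg i = 1")
      case True
      have "contact x 0 t = contact x 0 s"
        by (rule same) (use pos[OF True] in force)
      then show ?thesis
        using A True sum[OF T'(1)] sum[OF T'(2)] by (simp add: H_def)
    next
      case False
      then have m1: "sg i = -1"
        using sg[of i] by auto
      have "contact x 1 t = contact x 1 s"
        by (rule same) (use neg[OF st(1) m1] in force)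
      then show ?thesis
        using A m1 sum[OF T'(1)] sum[OF T'(2)] by (simp add: H_def)
    qed
  qed
  have "measure m (contact x c 0) = 0" for c
  proof -
    have "contact x c 0 \<subseteq> {0..0}"
      by (auto simp: contact_def)
    moreover have "emeasure m {0..0} = 0"
      using Gm[of 0 0] by simp
    ultimately have "emeasure m (contact x c 0) = 0"
      by (metis emeasure_mono le_zero_eq sets_interval_measure m atLeastAtMost_borel)
    then show ?thesis
      by (simp add: measure_def)
  qed
  then have H0: "H 0 = 0"
    using k0 by (simp add: H_def)
  have "j \<le> n \<Longrightarrow> \<forall>t\<in>{0..tt j}. H t = 0" for j
  proof (induction j)
    case 0
    then show ?case
      using H0 tt by auto
  next
    case (Suc j)
    show ?case
    proof
      fix t assume t: "t \<in> {0..tt (Suc j)}"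
      show "H t = 0"
      proof (cases "t \<le> tt j")
        case True
        then show ?thesis using Suc t by auto
      next
        case False
        then have "H t = H (tt j)"
          using Suc.prems t by (intro Hstep) auto
        then show ?thesis
          using Suc tle[of 0 j] tt by auto
      qed
    qed
  qed
  from this[of n] show "k t = measure m (contact x 1 t) - measure m (contact x 0 t)" if "t \<in> {0..T}"
    using that tt by (auto simp: H_def)
qed

lemma skorokhod_imp_reflected_equation:
  assumes T: "0 < T" and b: "set_integrable lborel {0..T} b"
    and y: "continuous_on {0..T} y" and yt: "\<And>t. t \<in> {0..T} \<Longrightarrow> y t = a + (LINT s:{0..t}|lborel. b s) + z t"
    and y0: "y 0 = a"
    and sk: "skorokhod T y k" and x: "\<And>t. t \<in> {0..T} \<Longrightarrow> x t = y t - k t"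
  shows "reflected_equation T a b z x k"
proof -
  have kc: "continuous_on {0..T} k" and k0: "k 0 = 0"
    using sk by (auto simp: skorokhod_def skorokhod_on_def)
  have "continuous_on {0..T} (\<lambda>t. y t - k t)"
    using y kc by (intro continuous_intros)
  then have xc: "continuous_on {0..T} x"
    using x by (subst continuous_on_cong[OF refl, of _ x "\<lambda>t. y t - k t"]) auto
  have same: "contact (\<lambda>t. y t - k t) c t = contact x c t" if "t \<in> {0..T}" for c t
    using x that by (auto simp: contact_def)
  note C = skorokhod_imp_contact_measure[OF T y sk]
  show ?thesis
    unfolding reflected_equation_def
    using C(1) C(2,3) same reflection_integrals[OF xc _ refl, of _ k] x yt b k0 T y0
    by auto
qed

section \<open>Path spaces and their Borel sets\<close>

definition paths :: "real \<Rightarrow> real set \<Rightarrow> (real \<Rightarrow> real) set" where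
  "paths T S = {f \<in> extensional {0..T}. f \<in> {0..T} \<rightarrow> S \<and> continuous_on {0..T} f}"

lemma pathsD:
  assumes "f \<in> paths T S"
  shows "f \<in> extensional {0..T}" "\<And>t. t \<in> {0..T} \<Longrightarrow> f t \<in> S" "continuous_on {0..T} f"
    "f \<in> {0..T} \<rightarrow> S"
  using assms by (auto simp: paths_def)

lemma restrict_in_paths:
  assumes "continuous_on {0..T} f" "\<And>t. t \<in> {0..T} \<Longrightarrow> f t \<in> S"
  shows "restrict f {0..T} \<in> paths T S"
proof -
  have "continuous_on {0..T} (restrict f {0..T}) = continuous_on {0..T} f"
    by (intro continuous_on_cong) auto
  then show ?thesis
    using assms by (auto simp: paths_def)
qed

lemma paths_eqI:
  assumes "f \<in> paths T S" "g \<in> paths T S'" "\<And>t. t \<in> {0..T} \<Longrightarrow> f t = g t"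
  shows "f = g"
  using assms by (auto simp: paths_def intro!: extensionalityI)

text \<open>The boundedness built into \<open>cfunspace\<close> is automatic on a compact interval.
  A ball witnessing it in the submetric must have its centre in \<open>S\<close>, hence the choice
  of \<open>f 0\<close>; for negative \<open>T\<close> the image is empty.\<close>

lemma mspace_path_metric:
  "mspace (cfunspace (top_of_set {0..T}) (submetric euclidean_metric S)) = paths T S"
proof -
  have "Metric_space.mbounded S dist (f ` {0..T})"
    if f: "f \<in> {0..T} \<rightarrow> S" "continuous_on {0..T} f" for f :: "real \<Rightarrow> real"
  proof -
    interpret S: Metric_space S dist
      by (intro Metric_space.subspace[OF Met_TC.Metric_space_axioms]) auto
    have "bounded (f ` {0..T})"
      using f(2) by (intro compact_imp_bounded compact_continuous_image) auto
    then obtain B where B: "\<forall>t\<in>{0..T}. \<bar>f t\<bar> \<le> B"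
      by (auto simp: bounded_iff)
    show ?thesis
    proof (cases "{0..T} = {}")
      case False
      then have 0: "0 \<in> {0..T}"
        by simp
      have "f t \<in> S.mcball (f 0) (2 * B)" if t: "t \<in> {0..T}" for t
      proof -
        have "\<bar>f 0\<bar> \<le> B" "\<bar>f t\<bar> \<le> B" "f 0 \<in> S" "f t \<in> S"
          using B f(1) t 0 by blast+
        then show ?thesis
          by (simp add: S.in_mcball dist_real_def)
      qed
      then have "f ` {0..T} \<subseteq> S.mcball (f 0) (2 * B)"
        by blast
      then show ?thesis
        unfolding S.mbounded_def by blast
    qed (simp add: S.mbounded_def)
  qed
  then show ?thesis
    by (auto simp: paths_def mtopology_of_submetric continuous_map_in_subtopology Pi_iff)
qed

lemma mdist_path_le:
  assumes "0 \<le> T" "f \<in> paths T S" "g \<in> paths T S"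
  shows "mdist (cfunspace (top_of_set {0..T}) (submetric euclidean_metric S)) f g \<le> e \<longleftrightarrow>
    (\<forall>t\<in>{0..T}. \<bar>f t - g t\<bar> \<le> e)"
  using assms mspace_path_metric[of T S]
  by (subst cfunspace_mdist_le) (auto simp: dist_real_def)

lemma topspace_path_space [simp]: "topspace (path_space T S) = paths T S"
  unfolding path_space_def topspace_mtopology_of by (rule mspace_path_metric)

text \<open>Described by closed balls, because \<open>mdist f g \<le> e\<close> unfolds to a
  pointwise bound while the strict inequality does not.\<close>

lemma openin_path_space:
  assumes T: "0 \<le> T"
  shows "openin (path_space T S) U \<longleftrightarrow> U \<subseteq> paths T S \<and>
    (\<forall>f\<in>U. \<exists>e>0. \<forall>g\<in>paths T S. (\<forall>t\<in>{0..T}. \<bar>g t - f t\<bar> \<le> e) \<longrightarrow> g \<in> U)"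
proof -
  define m where "m = cfunspace (top_of_set {0..T}) (submetric euclidean_metric S)"
  interpret m: Metric_space "paths T S" "mdist m"
    using Metric_space_mspace_mdist[of m] by (simp add: m_def mspace_path_metric del: mspace_cfunspace)
  have top: "path_space T S = m.mtopology"
    by (simp add: path_space_def mtopology_of_def m_def mspace_path_metric del: mspace_cfunspace)
  have cball: "m.mcball f e = {g \<in> paths T S. \<forall>t\<in>{0..T}. \<bar>g t - f t\<bar> \<le> e}" if "f \<in> paths T S" for f e
    using that mdist_path_le[OF T that, of _ e]
    by (auto simp: m.mcball_def m_def[symmetric] abs_minus_commute)
  have "(\<exists>r>0. m.mcball f r \<subseteq> U) \<longleftrightarrow>
      (\<exists>e>0. \<forall>g\<in>paths T S. (\<forall>t\<in>{0..T}. \<bar>g t - f t\<bar> \<le> e) \<longrightarrow> g \<in> U)" if "f \<in> paths T S" for f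
    unfolding cball[OF that] by blast
  then show ?thesis
    unfolding top m.openin_mtopology_mcball by blast
qed

text \<open>A distance that also makes sense for functions outside the path space: the approximating
  polynomials used as centres are not extensional and may leave \<open>S\<close>.\<close>

definition sup_dist :: "real \<Rightarrow> (real \<Rightarrow> real) \<Rightarrow> (real \<Rightarrow> real) \<Rightarrow> real" where
  "sup_dist T f g = Sup ((\<lambda>t. \<bar>f t - g t\<bar>) ` {0..T})"

lemma
  assumes T: "0 \<le> T" and fg: "continuous_on {0..T} f" "continuous_on {0..T} g"
  shows sup_dist_upper: "t \<in> {0..T} \<Longrightarrow> \<bar>f t - g t\<bar> \<le> sup_dist T f g"
    and sup_dist_least: "(\<And>t. t \<in> {0..T} \<Longrightarrow> \<bar>f t - g t\<bar> \<le> e) \<Longrightarrow> sup_dist T f g \<le> e"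
    and sup_dist_nonneg: "0 \<le> sup_dist T f g"
proof -
  have "bdd_above ((\<lambda>t. \<bar>f t - g t\<bar>) ` {0..T})"
    using fg by (intro bounded_imp_bdd_above compact_imp_bounded compact_continuous_image continuous_intros) auto
  then show *: "t \<in> {0..T} \<Longrightarrow> \<bar>f t - g t\<bar> \<le> sup_dist T f g" for t
    unfolding sup_dist_def by (rule cSUP_upper[rotated])
  show "(\<And>t. t \<in> {0..T} \<Longrightarrow> \<bar>f t - g t\<bar> \<le> e) \<Longrightarrow> sup_dist T f g \<le> e"
    unfolding sup_dist_def using T by (intro cSUP_least) auto
  show "0 \<le> sup_dist T f g"
    using *[of 0] T by auto
qed

lemma sup_dist_Lipschitz:
  assumes T: "0 \<le> T" and "continuous_on {0..T} f" "continuous_on {0..T} g" "continuous_on {0..T} c"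
    and le: "\<And>t. t \<in> {0..T} \<Longrightarrow> \<bar>f t - g t\<bar> \<le> e"
  shows "\<bar>sup_dist T f c - sup_dist T g c\<bar> \<le> e"
proof -
  have *: "sup_dist T f c \<le> sup_dist T g c + e"
    if "continuous_on {0..T} f" "continuous_on {0..T} g" "\<And>t. t \<in> {0..T} \<Longrightarrow> \<bar>f t - g t\<bar> \<le> e" for f g
  proof (rule sup_dist_least[OF T that(1) assms(4)])
    show "\<bar>f t - c t\<bar> \<le> sup_dist T g c + e" if t: "t \<in> {0..T}" for t
      using sup_dist_upper[OF T \<open>continuous_on {0..T} g\<close> assms(4) t]
        \<open>\<And>t. t \<in> {0..T} \<Longrightarrow> \<bar>f t - g t\<bar> \<le> e\<close>[OF t] by linarith
  qed
  have "sup_dist T g c \<le> sup_dist T f c + e"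
    using assms le by (intro *) (auto simp: abs_minus_commute)
  then show ?thesis
    using *[of f g] assms le by auto
qed

lemma openin_path_ball:
  assumes T: "0 \<le> T" and c: "continuous_on {0..T} c"
  shows "openin (path_space T S) {f \<in> paths T S. sup_dist T f c < q}"
  unfolding openin_path_space[OF T]
proof (intro conjI ballI)
  fix f assume f: "f \<in> {f \<in> paths T S. sup_dist T f c < q}"
  show "\<exists>e>0. \<forall>g\<in>paths T S. (\<forall>t\<in>{0..T}. \<bar>g t - f t\<bar> \<le> e) \<longrightarrow> g \<in> {f \<in> paths T S. sup_dist T f c < q}"
  proof (intro exI[of _ "(q - sup_dist T f c) / 2"] conjI ballI impI)
    show "0 < (q - sup_dist T f c) / 2"
      using f by simp
    fix g assume g: "g \<in> paths T S" "\<forall>t\<in>{0..T}. \<bar>g t - f t\<bar> \<le> (q - sup_dist T f c) / 2"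
    have "\<bar>sup_dist T g c - sup_dist T f c\<bar> \<le> (q - sup_dist T f c) / 2"
      using f g c pathsD(3) by (intro sup_dist_Lipschitz[OF T]) auto
    then have "sup_dist T g c - sup_dist T f c \<le> (q - sup_dist T f c) / 2"
      by linarith
    then have "sup_dist T g c < q"
      using f by (simp add: field_simps)
    then show "g \<in> {f \<in> paths T S. sup_dist T f c < q}"
      using g by simp
  qed
qed auto

definition bernstein_path :: "real \<Rightarrow> rat list \<Rightarrow> real \<Rightarrow> real" where
  "bernstein_path T cs t = (\<Sum>k<length cs. of_rat (cs ! k) * Bernstein (length cs - 1) k (t / T))"

lemma continuous_bernstein_path: "continuous_on A (bernstein_path T cs)"
  unfolding bernstein_path_def Bernstein_def divide_inverse by (intro continuous_intros)

text \<open>Half of the error is the Bernstein approximation itself, the other half the rounding of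
  its coefficients to rationals: Bernstein polynomials are nonnegative and sum to one, so the
  rounding errors do not accumulate.\<close>

lemma bernstein_path_dense:
  assumes T: "0 < T" and f: "continuous_on {0..T} f" and e: "0 < e"
  shows "\<exists>cs. \<forall>t\<in>{0..T}. \<bar>f t - bernstein_path T cs t\<bar> \<le> e"
proof -
  define g where "g x = f (T * x)" for x
  have "continuous_on {0..1} g"
    unfolding g_def using T by (intro continuous_on_compose2[OF f] continuous_intros) (auto simp: mult_left_le)
  then obtain N where N: "\<And>n x. N \<le> n \<Longrightarrow> x \<in> {0..1} \<Longrightarrow> \<bar>g x - (\<Sum>k\<le>n. g (k/n) * Bernstein n k x)\<bar> < e/2"
    using Bernstein_Weierstrass[of g "e/2"] e by auto
  have "\<exists>q. \<bar>g (k/N) - of_rat q\<bar> \<le> e/2" for k :: nat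
  proof -
    obtain p where "p \<in> \<rat>" "g (k/N) < p" "p < g (k/N) + e/2"
      using Rats_dense_in_real[of "g (k/N)" "g (k/N) + e/2"] e by auto
    moreover from this obtain r where "p = of_rat r"
      by (auto elim: Rats_cases)
    ultimately show ?thesis
      by (intro exI[of _ r]) auto
  qed
  then obtain q where q: "\<And>k::nat. \<bar>g (k/N) - of_rat (q k)\<bar> \<le> e/2"
    by metis
  show ?thesis
  proof (intro exI[of _ "map q [0..<Suc N]"] ballI)
    fix t assume t: "t \<in> {0..T}"
    define x where "x = t / T"
    have x: "x \<in> {0..1}" "T * x = t"
      using t T by (auto simp: x_def)
    have "bernstein_path T (map q [0..<Suc N]) t = (\<Sum>k\<le>N. of_rat (q k) * Bernstein N k x)"
      unfolding bernstein_path_def x_def[symmetric] by (intro sum.cong) (auto simp del: upt_Suc)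
    moreover have "\<bar>(\<Sum>k\<le>N. g (k/N) * Bernstein N k x) - (\<Sum>k\<le>N. of_rat (q k) * Bernstein N k x)\<bar> \<le> e/2"
    proof -
      have "\<bar>(\<Sum>k\<le>N. g (k/N) * Bernstein N k x) - (\<Sum>k\<le>N. of_rat (q k) * Bernstein N k x)\<bar>
        = \<bar>\<Sum>k\<le>N. (g (k/N) - of_rat (q k)) * Bernstein N k x\<bar>"
        by (simp add: sum_subtractf left_diff_distrib)
      also have "\<dots> \<le> (\<Sum>k\<le>N. \<bar>(g (k/N) - of_rat (q k)) * Bernstein N k x\<bar>)"
        by (rule sum_abs)
      also have "\<dots> \<le> (\<Sum>k\<le>N. e/2 * Bernstein N k x)"
      proof (rule sum_mono)
        fix k
        have "0 \<le> Bernstein N k x"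
          using x by (intro Bernstein_nonneg) auto
        then show "\<bar>(g (k/N) - of_rat (q k)) * Bernstein N k x\<bar> \<le> e/2 * Bernstein N k x"
          using mult_right_mono[OF q[of k]] by (simp add: abs_mult)
      qed
      also have "\<dots> = e/2 * (\<Sum>k\<le>N. Bernstein N k x)"
        by (rule sum_distrib_left[symmetric])
      also have "\<dots> = e/2"
        by (simp only: sum_Bernstein mult_1_right)
      finally show ?thesis .
    qed
    moreover have "\<bar>f t - (\<Sum>k\<le>N. g (k/N) * Bernstein N k x)\<bar> < e/2"
      using N[OF order_refl x(1)] x(2) by (simp add: g_def)
    ultimately show "\<bar>f t - bernstein_path T (map q [0..<Suc N]) t\<bar> \<le> e"
      by linarith
  qed
qed

definition path_balls :: "real \<Rightarrow> real set \<Rightarrow> (real \<Rightarrow> real) set set" where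
  "path_balls T S = (\<lambda>(cs, q). {f \<in> paths T S. sup_dist T f (bernstein_path T cs) < q}) ` (UNIV \<times> \<rat>)"

lemma path_balls_base:
  assumes T: "0 < T" and U: "openin (path_space T S) U" "f \<in> U"
  shows "\<exists>V\<in>path_balls T S. f \<in> V \<and> V \<subseteq> U"
proof -
  obtain e where e: "0 < e" "\<And>g. g \<in> paths T S \<Longrightarrow> (\<And>t. t \<in> {0..T} \<Longrightarrow> \<bar>g t - f t\<bar> \<le> e) \<Longrightarrow> g \<in> U"
    and f: "f \<in> paths T S"
    using U T unfolding openin_path_space[OF less_imp_le[OF T]] by (metis subsetD)
  have T0: "0 \<le> T" using T by simp
  \<comment> \<open>The function \<open>f\<close> is within \<open>e/3\<close> of the centre, hence
    in the ball of radius \<open>q\<close>; any member of this ball is within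
    \<open>q + e/3 < e\<close> of \<open>f\<close>.\<close>
  obtain q where q: "q \<in> \<rat>" "e/3 < q" "q < e/2"
    using Rats_dense_in_real[of "e/3" "e/2"] e by auto
  have "0 < e/3"
    using e by simp
  then obtain cs where cs: "\<And>t. t \<in> {0..T} \<Longrightarrow> \<bar>f t - bernstein_path T cs t\<bar> \<le> e/3"
    using bernstein_path_dense[OF T pathsD(3)[OF f], of "e/3"] by blast
  have "sup_dist T f (bernstein_path T cs) \<le> e/3"
    using cs by (intro sup_dist_least[OF T0 pathsD(3)[OF f] continuous_bernstein_path])
  moreover have "g \<in> U" if g: "g \<in> paths T S" "sup_dist T g (bernstein_path T cs) < q" for g
  proof (rule e(2)[OF g(1)])
    show "\<bar>g t - f t\<bar> \<le> e" if t: "t \<in> {0..T}" for t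
      using sup_dist_upper[OF T0 pathsD(3)[OF g(1)] continuous_bernstein_path[of _ T cs] t] g(2) q cs[OF t]
      by linarith
  qed
  ultimately show ?thesis
    using f q unfolding path_balls_def
    by (intro bexI[of _ "{f \<in> paths T S. sup_dist T f (bernstein_path T cs) < q}"]) auto
qed

lemma countable_path_balls: "countable (path_balls T S)"
  unfolding path_balls_def by (intro countable_image countable_SIGMA countable_rat) auto

lemma second_countable_path_space:
  assumes "0 < T"
  shows "second_countable (path_space T S)"
  unfolding second_countable_def
proof (intro exI[of _ "path_balls T S"] conjI ballI allI impI countable_path_balls)
  show "openin (path_space T S) V" if "V \<in> path_balls T S" for V
    using that assms by (auto simp: path_balls_def intro!: openin_path_ball continuous_bernstein_path)
qed (use path_balls_base[OF assms] in blast)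

section \<open>Borel measurability and countable bases\<close>

lemma borel_of_measurableI:
  assumes "f \<in> space M \<rightarrow> topspace X" "\<And>U. openin X U \<Longrightarrow> f -` U \<inter> space M \<in> sets M"
  shows "f \<in> M \<rightarrow>\<^sub>M borel_of X"
  unfolding borel_of_def using assms by (intro measurable_measure_of) (auto dest: openin_subset)

lemma borel_of_open: "openin X U \<Longrightarrow> U \<in> sets (borel_of X)"
  unfolding sets_borel_of by auto

lemma continuous_map_measurable:
  assumes "continuous_map X Y f"
  shows "f \<in> borel_of X \<rightarrow>\<^sub>M borel_of Y"
proof (rule borel_of_measurableI)
  fix U assume "openin Y U"
  then have "openin X {x \<in> topspace X. f x \<in> U}"
    using assms by (auto simp: continuous_map_def)
  moreover have "{x \<in> topspace X. f x \<in> U} = f -` U \<inter> space (borel_of X)"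
    by auto
  ultimately show "f -` U \<inter> space (borel_of X) \<in> sets (borel_of X)"
    using borel_of_open by metis
qed (use assms in \<open>auto simp: continuous_map_def\<close>)

lemma measurable_borel_of_base:
  assumes B: "countable B" "\<And>V. V \<in> B \<Longrightarrow> openin X V"
    and base: "\<And>U x. openin X U \<Longrightarrow> x \<in> U \<Longrightarrow> \<exists>V\<in>B. x \<in> V \<and> V \<subseteq> U"
    and f: "f \<in> space M \<rightarrow> topspace X" "\<And>V. V \<in> B \<Longrightarrow> f -` V \<inter> space M \<in> sets M"
  shows "f \<in> M \<rightarrow>\<^sub>M borel_of X"
proof (rule borel_of_measurableI[OF f(1)])
  fix U assume U: "openin X U"
  have "f -` U \<inter> space M = (\<Union>V\<in>{V\<in>B. V \<subseteq> U}. f -` V \<inter> space M)"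
    using base[OF U] by blast
  also have "\<dots> \<in> sets M"
    using B(1) f(2) by (intro sets.countable_UN'') auto
  finally show "f -` U \<inter> space M \<in> sets M" .
qed

lemma borel_of_euclidean: "borel_of (euclidean :: 'a :: topological_space topology) = borel"
  by (simp add: borel_of_def borel_def)

lemma measurable_borel_of_prod:
  assumes X: "second_countable X" and Y: "second_countable Y"
    and f: "f \<in> M \<rightarrow>\<^sub>M borel_of X" and g: "g \<in> M \<rightarrow>\<^sub>M borel_of Y"
  shows "(\<lambda>w. (f w, g w)) \<in> M \<rightarrow>\<^sub>M borel_of (prod_topology X Y)"
proof -
  obtain A where A: "countable A" "\<And>V. V \<in> A \<Longrightarrow> openin X V"
    "\<And>U x. openin X U \<Longrightarrow> x \<in> U \<Longrightarrow> \<exists>V\<in>A. x \<in> V \<and> V \<subseteq> U"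
    using X unfolding second_countable_def by metis
  obtain B where B: "countable B" "\<And>V. V \<in> B \<Longrightarrow> openin Y V"
    "\<And>U x. openin Y U \<Longrightarrow> x \<in> U \<Longrightarrow> \<exists>V\<in>B. x \<in> V \<and> V \<subseteq> U"
    using Y unfolding second_countable_def by metis
  show ?thesis
  proof (rule measurable_borel_of_base)
    show "countable ((\<lambda>(a, b). a \<times> b) ` (A \<times> B))"
      using A B by (intro countable_image countable_SIGMA)
    show "openin (prod_topology X Y) V" if "V \<in> (\<lambda>(a, b). a \<times> b) ` (A \<times> B)" for V
      using that A B by (auto simp: openin_prod_Times_iff)
    show "\<exists>V\<in>(\<lambda>(a, b). a \<times> b) ` (A \<times> B). x \<in> V \<and> V \<subseteq> U"
      if U: "openin (prod_topology X Y) U" "x \<in> U" for U x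
    proof -
      obtain a b where ab: "openin X a" "openin Y b" "fst x \<in> a" "snd x \<in> b" "a \<times> b \<subseteq> U"
        using U unfolding openin_prod_topology_alt by (metis prod.collapse)
      obtain a' b' where "a' \<in> A" "fst x \<in> a'" "a' \<subseteq> a" "b' \<in> B" "snd x \<in> b'" "b' \<subseteq> b"
        using A(3)[OF ab(1,3)] B(3)[OF ab(2,4)] by auto
      then show ?thesis
        using ab(5) by (intro bexI[of _ "a' \<times> b'"]) (auto simp: mem_Times_iff)
    qed
    show "(\<lambda>w. (f w, g w)) \<in> space M \<rightarrow> topspace (prod_topology X Y)"
      using measurable_space[OF f] measurable_space[OF g] by auto
    show "(\<lambda>w. (f w, g w)) -` V \<inter> space M \<in> sets M" if "V \<in> (\<lambda>(a, b). a \<times> b) ` (A \<times> B)" for V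
    proof -
      obtain a b where ab: "a \<in> A" "b \<in> B" "V = a \<times> b"
        using \<open>V \<in> (\<lambda>(a, b). a \<times> b) ` (A \<times> B)\<close> by auto
      have "(f -` a \<inter> space M) \<inter> (g -` b \<inter> space M) \<in> sets M"
        using measurable_sets[OF f borel_of_open[OF A(2)[OF ab(1)]]]
          measurable_sets[OF g borel_of_open[OF B(2)[OF ab(2)]]] by (rule sets.Int)
      moreover have "(\<lambda>w. (f w, g w)) -` V \<inter> space M = (f -` a \<inter> space M) \<inter> (g -` b \<inter> space M)"
        using ab by auto
      ultimately show ?thesis
        by simp
    qed
  qed
qed

text \<open>Countable bases make every open subset of the product a countable union of open
  rectangles; in general its Borel sets can be strictly more. The input laws are product measures,
  whereas weak convergence refers to the Borel sets of the product topology.\<close>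

lemma sets_borel_of_prod:
  assumes X: "second_countable X" and Y: "second_countable Y"
  shows "sets (borel_of (prod_topology X Y)) = sets (borel_of X \<Otimes>\<^sub>M borel_of Y)"
proof (rule antisym)
  have "(\<lambda>w. (fst w, snd w)) \<in> borel_of X \<Otimes>\<^sub>M borel_of Y \<rightarrow>\<^sub>M borel_of (prod_topology X Y)"
    using X Y by (intro measurable_borel_of_prod) auto
  then have *: "(\<lambda>w. w) \<in> borel_of X \<Otimes>\<^sub>M borel_of Y \<rightarrow>\<^sub>M borel_of (prod_topology X Y)"
    by simp
  show "sets (borel_of (prod_topology X Y)) \<subseteq> sets (borel_of X \<Otimes>\<^sub>M borel_of Y)"
  proof
    fix A assume A: "A \<in> sets (borel_of (prod_topology X Y))"
    then have "A \<subseteq> topspace X \<times> topspace Y"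
      using sets.sets_into_space by fastforce
    then show "A \<in> sets (borel_of X \<Otimes>\<^sub>M borel_of Y)"
      using measurable_sets[OF * A] by (simp add: space_pair_measure Int_absorb2)
  qed
  have "(\<lambda>w. (fst w, snd w)) \<in> borel_of (prod_topology X Y) \<rightarrow>\<^sub>M borel_of X \<Otimes>\<^sub>M borel_of Y"
    by (intro measurable_Pair continuous_map_measurable continuous_map_fst continuous_map_snd)
  then have *: "(\<lambda>w. w) \<in> borel_of (prod_topology X Y) \<rightarrow>\<^sub>M borel_of X \<Otimes>\<^sub>M borel_of Y"
    by simp
  show "sets (borel_of X \<Otimes>\<^sub>M borel_of Y) \<subseteq> sets (borel_of (prod_topology X Y))"
  proof
    fix A assume A: "A \<in> sets (borel_of X \<Otimes>\<^sub>M borel_of Y)"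
    then have "A \<subseteq> topspace X \<times> topspace Y"
      using sets.sets_into_space by (fastforce simp: space_pair_measure)
    then show "A \<in> sets (borel_of (prod_topology X Y))"
      using measurable_sets[OF * A] by (simp add: Int_absorb2)
  qed
qed

lemma continuous_map_into_path_space:
  assumes T: "0 \<le> T" and F: "\<And>p. p \<in> topspace X \<Longrightarrow> F p \<in> paths T S"
    and nbhd: "\<And>p e. p \<in> topspace X \<Longrightarrow> 0 < e \<Longrightarrow>
      \<exists>U. openin X U \<and> p \<in> U \<and> (\<forall>q\<in>U. \<forall>t\<in>{0..T}. \<bar>F q t - F p t\<bar> \<le> e)"
  shows "continuous_map X (path_space T S) F"
  unfolding continuous_map_def
proof (intro conjI allI impI)
  show "F \<in> topspace X \<rightarrow> topspace (path_space T S)"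
    using F by auto
  fix V assume V: "openin (path_space T S) V"
  show "openin X {p \<in> topspace X. F p \<in> V}"
  proof (subst openin_subopen, intro ballI)
    fix p assume p: "p \<in> {p \<in> topspace X. F p \<in> V}"
    then obtain e where e: "0 < e" "\<And>g. g \<in> paths T S \<Longrightarrow> (\<And>t. t \<in> {0..T} \<Longrightarrow> \<bar>g t - F p t\<bar> \<le> e) \<Longrightarrow> g \<in> V"
      using V unfolding openin_path_space[OF T] by (metis (lifting) mem_Collect_eq)
    obtain U where "openin X U" "p \<in> U" "\<And>q t. q \<in> U \<Longrightarrow> t \<in> {0..T} \<Longrightarrow> \<bar>F q t - F p t\<bar> \<le> e"
      using nbhd[of p e] p e by auto
    then show "\<exists>U. openin X U \<and> p \<in> U \<and> U \<subseteq> {p \<in> topspace X. F p \<in> V}"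
      using F e openin_subset[of X U] by (intro exI[of _ U]) auto
  qed
qed

lemma continuous_map_path_real:
  assumes T: "0 \<le> T" and F: "\<And>f e. f \<in> paths T S \<Longrightarrow> 0 < e \<Longrightarrow>
      \<exists>d>0. \<forall>g\<in>paths T S. (\<forall>t\<in>{0..T}. \<bar>g t - f t\<bar> \<le> d) \<longrightarrow> \<bar>F g - F f\<bar> \<le> e"
  shows "continuous_map (path_space T S) euclideanreal F"
  unfolding continuous_map_def
proof (intro conjI allI impI)
  fix V assume V: "openin euclideanreal V"
  show "openin (path_space T S) {f \<in> topspace (path_space T S). F f \<in> V}"
    unfolding openin_path_space[OF T]
  proof (intro conjI ballI)
    fix f assume f: "f \<in> {f \<in> topspace (path_space T S). F f \<in> V}"
    have "open V" "F f \<in> V"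
      using V f by auto
    then obtain e where e: "0 < e" "cball (F f) e \<subseteq> V"
      unfolding open_contains_cball by blast
    obtain d where d: "0 < d" "\<forall>g\<in>paths T S. (\<forall>t\<in>{0..T}. \<bar>g t - f t\<bar> \<le> d) \<longrightarrow> \<bar>F g - F f\<bar> \<le> e"
      using F[of f e] f e(1) by auto
    have "F g \<in> V" if "g \<in> paths T S" "\<forall>t\<in>{0..T}. \<bar>g t - f t\<bar> \<le> d" for g
      using d(2) that e(2) by (auto simp: subset_iff dist_real_def abs_minus_commute)
    then show "\<exists>e>0. \<forall>g\<in>paths T S. (\<forall>t\<in>{0..T}. \<bar>g t - f t\<bar> \<le> e) \<longrightarrow> g \<in> {f \<in> topspace (path_space T S). F f \<in> V}"
      using d(1) by auto
  qed auto
qed auto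

lemma continuous_map_path_eval:
  assumes "0 \<le> T" "t \<in> {0..T}"
  shows "continuous_map (path_space T S) euclideanreal (\<lambda>f. f t)"
  using assms by (intro continuous_map_path_real) auto

lemma measurable_path_eval:
  assumes "0 \<le> T" "t \<in> {0..T}" "X \<in> M \<rightarrow>\<^sub>M borel_of (path_space T S)"
  shows "(\<lambda>w. X w t) \<in> borel_measurable M"
  using measurable_compose[OF assms(3) continuous_map_measurable[OF continuous_map_path_eval[OF assms(1,2)]]]
  by (simp add: borel_of_euclidean)

lemma continuous_le_rational:
  fixes g :: "real \<Rightarrow> real"
  assumes T: "0 < T" and g: "continuous_on {0..T} g" and le: "\<And>t. t \<in> \<rat> \<inter> {0..T} \<Longrightarrow> g t \<le> q" and s: "s \<in> {0..T}"
  shows "g s \<le> q"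
proof (rule ccontr)
  assume "\<not> g s \<le> q"
  then obtain d where d: "0 < d" "\<And>u. u \<in> {0..T} \<Longrightarrow> dist u s < d \<Longrightarrow> dist (g u) (g s) < g s - q"
    using g s unfolding continuous_on_iff by (metis diff_gt_0_iff_gt not_le)
  have "max 0 (s - d) < min T (s + d)"
    using s T d(1) by auto
  then obtain r where r: "r \<in> \<rat>" "max 0 (s - d) < r" "r < min T (s + d)"
    using Rats_dense_in_real by blast
  then have "dist (g r) (g s) < g s - q"
    by (intro d(2)) (auto simp: dist_real_def)
  then show False
    using le[of r] r by (auto simp: dist_real_def)
qed

text \<open>Evaluations generate the Borel sets: by continuity, membership in a ball of the
  countable base is decided by the values at rational times.\<close>

lemma measurable_into_path_space:
  assumes T: "0 < T" and X: "\<And>w. w \<in> space M \<Longrightarrow> X w \<in> paths T S"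
    and ev: "\<And>t. t \<in> {0..T} \<Longrightarrow> (\<lambda>w. X w t) \<in> borel_measurable M"
  shows "X \<in> M \<rightarrow>\<^sub>M borel_of (path_space T S)"
proof (rule measurable_borel_of_base[of "path_balls T S"])
  show "countable (path_balls T S)"
    by (rule countable_path_balls)
  show "openin (path_space T S) V" if "V \<in> path_balls T S" for V
    using that T by (auto simp: path_balls_def intro!: openin_path_ball continuous_bernstein_path)
  show "\<exists>V\<in>path_balls T S. x \<in> V \<and> V \<subseteq> U" if "openin (path_space T S) U" "x \<in> U" for U x
    using path_balls_base[OF T that] .
  show "X \<in> space M \<rightarrow> topspace (path_space T S)"
    using X by auto
  fix V assume "V \<in> path_balls T S"
  then obtain cs q where V: "V = {f \<in> paths T S. sup_dist T f (bernstein_path T cs) < q}"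
    by (auto simp: path_balls_def)
  let ?c = "bernstein_path T cs"
  have T0: "0 \<le> T" using T by simp
  \<comment> \<open>Pointwise strict inequality at rational times would not bound the supremum
    strictly; a rational margin \<open>p < q\<close> does.\<close>
  have *: "sup_dist T f ?c < q \<longleftrightarrow> (\<exists>p\<in>\<rat> \<inter> {..<q}. \<forall>t\<in>\<rat> \<inter> {0..T}. \<bar>f t - ?c t\<bar> \<le> p)" if f: "f \<in> paths T S" for f
  proof
    assume "sup_dist T f ?c < q"
    then obtain p where "p \<in> \<rat>" "sup_dist T f ?c < p" "p < q"
      using Rats_dense_in_real by blast
    then show "\<exists>p\<in>\<rat> \<inter> {..<q}. \<forall>t\<in>\<rat> \<inter> {0..T}. \<bar>f t - ?c t\<bar> \<le> p"
      using order_trans[OF sup_dist_upper[OF T0 pathsD(3)[OF f] continuous_bernstein_path[of _ T cs]]]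
      by (intro bexI[of _ p]) auto
  next
    assume "\<exists>p\<in>\<rat> \<inter> {..<q}. \<forall>t\<in>\<rat> \<inter> {0..T}. \<bar>f t - ?c t\<bar> \<le> p"
    then obtain p where p: "p < q" "\<And>t. t \<in> \<rat> \<inter> {0..T} \<Longrightarrow> \<bar>f t - ?c t\<bar> \<le> p"
      by auto
    have "\<bar>f t - ?c t\<bar> \<le> p" if "t \<in> {0..T}" for t
    proof (rule continuous_le_rational[OF T _ p(2) that])
      show "continuous_on {0..T} (\<lambda>t. \<bar>f t - ?c t\<bar>)"
        by (intro continuous_intros pathsD(3)[OF f] continuous_bernstein_path)
    qed
    then have "sup_dist T f ?c \<le> p"
      by (rule sup_dist_least[OF T0 pathsD(3)[OF f] continuous_bernstein_path])
    then show "sup_dist T f ?c < q"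
      using p(1) by simp
  qed
  have "X -` V \<inter> space M =
      {w \<in> space M. \<exists>p\<in>\<rat> \<inter> {..<q}. \<forall>t\<in>\<rat> \<inter> {0..T}. \<bar>X w t - ?c t\<bar> \<le> p}"
    using X * by (auto simp: V)
  also have "\<dots> \<in> sets M"
    using ev by (intro sets.sets_Collect_countable_Ex' sets.sets_Collect_countable_All' countable_Int1 countable_rat) auto
  finally show "X -` V \<inter> space M \<in> sets M" .
qed

section \<open>Test functions for weak convergence\<close>

text \<open>Finite maxima of rational multiples of the members of a bump family approximate every
  nonnegative continuous function from below, so they determine weak convergence.\<close>

definition bump_family :: "'a topology \<Rightarrow> ('a \<Rightarrow> real) set \<Rightarrow> bool" where
  "bump_family X \<Phi> \<longleftrightarrow> countable \<Phi> \<and>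
    (\<forall>\<phi>\<in>\<Phi>. continuous_map X euclideanreal \<phi> \<and> (\<forall>x\<in>topspace X. \<phi> x \<in> {0..1})) \<and>
    (\<forall>U x e. openin X U \<and> x \<in> U \<and> 0 < e \<longrightarrow>
      (\<exists>\<phi>\<in>\<Phi>. 1 - e < \<phi> x \<and> (\<forall>y\<in>topspace X - U. \<phi> y = 0)))"

lemma bump_familyD:
  assumes "bump_family X \<Phi>"
  shows "countable \<Phi>" "\<And>\<phi>. \<phi> \<in> \<Phi> \<Longrightarrow> continuous_map X euclideanreal \<phi>"
    "\<And>\<phi> x. \<phi> \<in> \<Phi> \<Longrightarrow> x \<in> topspace X \<Longrightarrow> \<phi> x \<in> {0..1}"
    "\<And>U x e. openin X U \<Longrightarrow> x \<in> U \<Longrightarrow> 0 < e \<Longrightarrow>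
      \<exists>\<phi>\<in>\<Phi>. 1 - e < \<phi> x \<and> (\<forall>y\<in>topspace X - U. \<phi> y = 0)"
  using assms unfolding bump_family_def by blast+

fun test_fun :: "(real \<times> ('a \<Rightarrow> real)) list \<Rightarrow> 'a \<Rightarrow> real" where
  "test_fun [] x = 0"
| "test_fun ((c, \<phi>) # hs) x = max (c * \<phi> x) (test_fun hs x)"

text \<open>Rational coefficients keep the family countable, so that almost sure convergence for
  each member is almost surely convergence for all members at once.\<close>

definition test_funs :: "('a \<Rightarrow> real) set \<Rightarrow> ('a \<Rightarrow> real) set" where
  "test_funs \<Phi> = test_fun ` lists ((\<rat> \<inter> {0..}) \<times> \<Phi>)"

lemma countable_test_funs: "countable \<Phi> \<Longrightarrow> countable (test_funs \<Phi>)"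
  unfolding test_funs_def
  by (intro countable_image countable_lists countable_SIGMA countable_Int1 countable_rat)

lemma continuous_map_test_fun:
  assumes "hs \<in> lists ((\<rat> \<inter> {0..}) \<times> \<Phi>)" "\<And>\<phi>. \<phi> \<in> \<Phi> \<Longrightarrow> continuous_map X euclideanreal \<phi>"
  shows "continuous_map X euclideanreal (test_fun hs)"
  using assms
proof (induction hs)
  case (Cons h hs)
  obtain c \<phi> where h: "h = (c, \<phi>)" by (cases h)
  have "continuous_map X euclideanreal (\<lambda>x. max (c * \<phi> x) (test_fun hs x))"
    using Cons h by (intro continuous_map_real_max continuous_map_real_mult_left) auto
  then show ?case
    by (simp add: h)
qed (simp add: test_fun.simps(1)[abs_def])

lemma test_fun_ge:
  assumes "(c, \<phi>) \<in> set hs"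
  shows "c * \<phi> x \<le> test_fun hs x"
  using assms by (induction hs x rule: test_fun.induct) (auto simp: le_max_iff_disj)

lemma test_fun_nonneg: "0 \<le> test_fun hs x"
  by (induction hs x rule: test_fun.induct) (auto simp: le_max_iff_disj)

lemma test_fun_le:
  assumes "0 \<le> B" "\<And>c \<phi>. (c, \<phi>) \<in> set hs \<Longrightarrow> c * \<phi> x \<le> B"
  shows "test_fun hs x \<le> B"
  using assms by (induction hs x rule: test_fun.induct) auto

lemma test_fun_bounded:
  assumes "hs \<in> lists ((\<rat> \<inter> {0..}) \<times> \<Phi>)" "\<And>\<phi>. \<phi> \<in> \<Phi> \<Longrightarrow> \<phi> x \<in> {0..1}"
  shows "test_fun hs x \<le> sum_list (map fst hs)"
  using assms
proof (induction hs)
  case (Cons h hs)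
  obtain c \<phi> where h: "h = (c, \<phi>)" by (cases h)
  have "c * \<phi> x \<le> c * 1"
    using Cons h by (intro mult_left_mono) auto
  moreover have "0 \<le> test_fun hs x"
    by (rule test_fun_nonneg)
  ultimately show ?case
    using Cons h by auto
qed simp

lemma integrable_bounded_continuous:
  fixes f :: "'a \<Rightarrow> real"
  assumes "prob_space \<mu>" "sets \<mu> = sets (borel_of X)" "continuous_map X euclideanreal f"
    "\<And>x. x \<in> topspace X \<Longrightarrow> \<bar>f x\<bar> \<le> B"
  shows "integrable \<mu> f"
proof -
  interpret prob_space \<mu> by fact
  have sp: "space \<mu> = topspace X"
    using sets_eq_imp_space_eq[OF assms(2)] by simp
  have "f \<in> borel_measurable \<mu>"
    using continuous_map_measurable[OF assms(3)] measurable_cong_sets[OF assms(2) refl]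
    by (auto simp: borel_of_euclidean)
  then show ?thesis
    using assms(4) sp by (intro integrable_const_bound[of _ B]) auto
qed

text \<open>Take a test function \<open>g n\<close> below \<open>f\<close> whose integral against
  \<open>\<nu>\<close> is almost that of \<open>f\<close>. Its integrals against
  \<open>\<mu> N\<close> converge and are below those of \<open>f\<close>, so the limit inferior of
  the latter is large enough.\<close>

lemma weak_conv_lower:
  fixes \<mu> :: "nat \<Rightarrow> 'a measure"
  assumes \<Phi>: "bump_family X \<Phi>"
    and \<mu>: "\<And>N. 1 \<le> N \<Longrightarrow> prob_space (\<mu> N)" "\<And>N. 1 \<le> N \<Longrightarrow> sets (\<mu> N) = sets (borel_of X)"
    and \<nu>: "prob_space \<nu>" "sets \<nu> = sets (borel_of X)"
    and conv: "\<And>h. h \<in> test_funs \<Phi> \<Longrightarrow> (\<lambda>N. \<integral>x. h x \<partial>\<mu> N) \<longlonglongrightarrow> (\<integral>x. h x \<partial>\<nu>)"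
    and f: "continuous_map X euclideanreal f" "\<And>x. x \<in> topspace X \<Longrightarrow> f x \<in> {0..B}"
    and e: "0 < e"
  shows "\<forall>\<^sub>F N in sequentially. (\<integral>x. f x \<partial>\<nu>) - e < (\<integral>x. f x \<partial>\<mu> N)"
proof -
  interpret \<nu>: prob_space \<nu> by fact
  note bump = bump_familyD[OF \<Phi>]
  have sp: "space \<nu> = topspace X"
    using sets_eq_imp_space_eq[OF \<nu>(2)] by simp
  obtain x0 where x0: "x0 \<in> topspace X"
    using \<nu>.not_empty unfolding sp by blast
  define H where "H = {(c, \<phi>). c \<in> \<rat> \<inter> {0..} \<and> \<phi> \<in> \<Phi> \<and> (\<forall>x\<in>topspace X. c * \<phi> x \<le> f x)}"
  obtain \<phi>0 where "\<phi>0 \<in> \<Phi>"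
    using bump(4)[of "topspace X" x0 1] x0 by auto
  then have "(0, \<phi>0) \<in> H"
    using f(2) by (auto simp: H_def)
  then have H0: "H \<noteq> {}" by auto
  have Hc: "countable H"
    by (rule countable_subset[of _ "(\<rat> \<inter> {0..}) \<times> \<Phi>"])
       (auto simp: H_def intro!: countable_SIGMA countable_Int1 countable_rat bump(1))
  \<comment> \<open>\<open>g n\<close> is the maximum of the first \<open>n\<close> minorants of
    \<open>f\<close> in an enumeration of \<open>H\<close>; enumeration with repetitions is harmless
    if \<open>H\<close> is finite.\<close>
  define hs where "hs n = map (from_nat_into H) [0..<n]" for n
  define g where "g n = test_fun (hs n)" for n
  have fH: "from_nat_into H n \<in> H" for n
    by (rule from_nat_into[OF H0])
  have hsH: "set (hs n) \<subseteq> H" for n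
    using fH by (auto simp: hs_def)
  have hsl: "hs n \<in> lists ((\<rat> \<inter> {0..}) \<times> \<Phi>)" for n
    using hsH[of n] by (auto simp: H_def in_lists_conv_set)
  have gt: "g n \<in> test_funs \<Phi>" for n
    using hsl by (auto simp: g_def test_funs_def)
  have gc: "continuous_map X euclideanreal (g n)" for n
    unfolding g_def by (rule continuous_map_test_fun[OF hsl bump(2)])
  have g0: "0 \<le> g n x" for n x
    by (simp add: g_def test_fun_nonneg)
  have gf: "g n x \<le> f x" if "x \<in> topspace X" for n x
    unfolding g_def using hsH[of n] that f(2)[OF that] by (intro test_fun_le) (auto simp: H_def)
  have gB: "\<bar>g n x\<bar> \<le> B" if "x \<in> topspace X" for n x
    using gf[OF that, of n] g0[of n x] f(2)[OF that] by auto
  have fB: "\<bar>f x\<bar> \<le> B" if "x \<in> topspace X" for x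
    using f(2)[OF that] by auto
  have lim: "(\<lambda>n. g n x) \<longlonglongrightarrow> f x" if x: "x \<in> topspace X" for x
  proof (rule LIMSEQ_I)
    fix r :: real assume "0 < r"
    define d where "d = r/2"
    have d: "0 < d" using \<open>0 < r\<close> by (simp add: d_def)
    have "\<exists>n0. \<forall>n\<ge>n0. f x - 2 * d < g n x"
    proof (cases "f x < d")
      case True
      then have "f x - 2 * d < g n x" for n
        using g0[of n x] d by auto
      then show ?thesis by auto
    next
      case False
      \<comment> \<open>A bump at height \<open>c\<close>, supported where \<open>f\<close> exceeds
        \<open>c\<close>, is a minorant. At \<open>x\<close> it loses at most \<open>d\<close> from
        the choice of \<open>c\<close> and at most \<open>d\<close> from the tolerance
        \<open>d / (c + 1)\<close>, whose denominator remains positive for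
        \<open>c = 0\<close>.\<close>
      obtain c where c: "c \<in> \<rat>" "f x - d < c" "c < f x"
        using Rats_dense_in_real[of "f x - d" "f x"] d by auto
      have c0: "0 \<le> c"
        using c False by auto
      define U where "U = {y \<in> topspace X. f y \<in> {c<..}}"
      have "openin X U"
        unfolding U_def by (rule openin_continuous_map_preimage[OF f(1)]) (simp add: open_openin[symmetric])
      moreover have "x \<in> U"
        using c x by (simp add: U_def)
      moreover have "0 < d / (c + 1)"
        using c0 d by simp
      ultimately obtain \<phi> where \<phi>: "\<phi> \<in> \<Phi>" "1 - d / (c + 1) < \<phi> x" "\<And>y. y \<in> topspace X - U \<Longrightarrow> \<phi> y = 0"
        using bump(4)[of U x "d / (c + 1)"] by auto
      have "c * \<phi> y \<le> f y" if y: "y \<in> topspace X" for y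
      proof (cases "y \<in> U")
        case True
        have "c * \<phi> y \<le> c * 1"
          using bump(3)[OF \<phi>(1) y] c0 by (intro mult_left_mono) auto
        then show ?thesis
          using True by (simp add: U_def)
      next
        case False
        then show ?thesis
          using \<phi>(3)[of y] y f(2)[OF y] by auto
      qed
      then have "(c, \<phi>) \<in> H"
        using c c0 \<phi>(1) by (auto simp: H_def)
      then obtain m where m: "from_nat_into H m = (c, \<phi>)"
        using from_nat_into_surj[OF Hc] by blast
      have cd: "c - d \<le> c * \<phi> x"
      proof -
        have "c * (1 - d / (c + 1)) \<le> c * \<phi> x"
          using \<phi>(2) c0 by (intro mult_left_mono) auto
        moreover have "c * (d / (c + 1)) \<le> d"
          using c0 d by (simp add: field_simps)
        ultimately show ?thesis
          by (simp add: right_diff_distrib)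
      qed
      have "f x - 2 * d < g n x" if "Suc m \<le> n" for n
      proof -
        have "from_nat_into H m \<in> set (hs n)"
          using that by (auto simp: hs_def)
        then have "c * \<phi> x \<le> g n x"
          unfolding m g_def by (rule test_fun_ge)
        then show ?thesis
          using cd c by auto
      qed
      then show ?thesis by auto
    qed
    then obtain n0 where n0: "\<And>n. n0 \<le> n \<Longrightarrow> f x - 2 * d < g n x"
      by auto
    show "\<exists>n0. \<forall>n\<ge>n0. norm (g n x - f x) < r"
    proof (intro exI[of _ n0] allI impI)
      fix n assume "n0 \<le> n"
      then show "norm (g n x - f x) < r"
        using n0[of n] gf[OF x, of n] by (auto simp: d_def)
    qed
  qed
  have meas: "h \<in> borel_measurable \<nu>" if "continuous_map X euclideanreal h" for h
    using continuous_map_measurable[OF that] measurable_cong_sets[OF \<nu>(2) refl]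
    by (auto simp: borel_of_euclidean)
  have "(\<lambda>n. \<integral>x. g n x \<partial>\<nu>) \<longlonglongrightarrow> (\<integral>x. f x \<partial>\<nu>)"
    using lim gB sp by (intro integral_dominated_convergence[where w = "\<lambda>_. B"] meas gc f(1)) auto
  then obtain n where n: "(\<integral>x. f x \<partial>\<nu>) - e < (\<integral>x. g n x \<partial>\<nu>)"
    using e by (metis (no_types, lifting) diff_less_eq less_add_same_cancel1 order_tendstoD(1) eventually_happens' sequentially_bot)
  have "\<forall>\<^sub>F N in sequentially. (\<integral>x. f x \<partial>\<nu>) - e < (\<integral>x. g n x \<partial>\<mu> N)"
    using conv[OF gt[of n]] n by (rule order_tendstoD(1))
  then show ?thesis
    using eventually_ge_at_top[of 1]
  proof eventually_elim
    case (elim N)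
    have "(\<integral>x. g n x \<partial>\<mu> N) \<le> (\<integral>x. f x \<partial>\<mu> N)"
      using sets_eq_imp_space_eq[OF \<mu>(2)[OF elim(2)]] gf
      by (intro integral_mono integrable_bounded_continuous[OF \<mu>[OF elim(2)], where B = B] gc f(1) gB fB) auto
    then show ?case
      using elim(1) by simp
  qed
qed

text \<open>The lower bound for \<open>f + B\<close> and for \<open>B - f\<close>, both with values
  in \<open>[0, 2B]\<close>, gives the two sides of the convergence. The index 0 is left out since
  an empirical measure of no points is not a probability measure.\<close>

lemma weak_conv_onI_bump:
  fixes \<mu> :: "nat \<Rightarrow> 'a measure"
  assumes \<Phi>: "bump_family X \<Phi>"
    and \<mu>: "\<And>N. 1 \<le> N \<Longrightarrow> prob_space (\<mu> N)" "\<And>N. 1 \<le> N \<Longrightarrow> sets (\<mu> N) = sets (borel_of X)"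
    and \<nu>: "prob_space \<nu>" "sets \<nu> = sets (borel_of X)"
    and conv: "\<And>h. h \<in> test_funs \<Phi> \<Longrightarrow> (\<lambda>N. \<integral>x. h x \<partial>\<mu> N) \<longlonglongrightarrow> (\<integral>x. h x \<partial>\<nu>)"
  shows "weak_conv_on X \<mu> \<nu>"
  unfolding weak_conv_on_def
proof (intro allI impI, elim conjE)
  fix f assume f: "continuous_map X euclideanreal f" and "bounded (f ` topspace X)"
  then obtain B where B: "\<And>x. x \<in> topspace X \<Longrightarrow> \<bar>f x\<bar> \<le> B"
    unfolding bounded_iff by auto
  interpret \<nu>: prob_space \<nu> by fact
  have int\<nu>: "integrable \<nu> f"
    using \<nu> f B by (rule integrable_bounded_continuous)
  have int: "integrable (\<mu> N) f" if "1 \<le> N" for N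
    using \<mu>[OF that] f B by (rule integrable_bounded_continuous)
  note low = weak_conv_lower[OF \<Phi> \<mu> \<nu> conv, where B = "2 * B"]
  show "(\<lambda>N. \<integral>x. f x \<partial>\<mu> N) \<longlonglongrightarrow> (\<integral>x. f x \<partial>\<nu>)"
  proof (rule LIMSEQ_I)
    fix e :: real assume e: "0 < e"
    have "\<forall>\<^sub>F N in sequentially. (\<integral>x. f x + B \<partial>\<nu>) - e < (\<integral>x. f x + B \<partial>\<mu> N)"
      using B by (intro low continuous_map_add f e) (auto simp: abs_le_iff dest!: B)
    moreover have "\<forall>\<^sub>F N in sequentially. (\<integral>x. B - f x \<partial>\<nu>) - e < (\<integral>x. B - f x \<partial>\<mu> N)"
      using B by (intro low continuous_map_diff f e) (auto simp: abs_le_iff dest!: B)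
    ultimately have "\<forall>\<^sub>F N in sequentially. norm ((\<integral>x. f x \<partial>\<mu> N) - (\<integral>x. f x \<partial>\<nu>)) < e"
      using eventually_ge_at_top[of 1]
    proof eventually_elim
      case (elim N)
      interpret N: prob_space "\<mu> N"
        using \<mu>(1)[OF elim(3)] .
      show ?case
        using elim(1,2) int\<nu> int[OF elim(3)] by (simp add: N.prob_space \<nu>.prob_space abs_less_iff)
    qed
    then show "\<exists>n0. \<forall>N\<ge>n0. norm ((\<integral>x. f x \<partial>\<mu> N) - (\<integral>x. f x \<partial>\<nu>)) < e"
      by (simp add: eventually_sequentially)
  qed
qed

text \<open>Tents of slope \<open>q\<close> around rational Bernstein polynomials. Tents are
  Lipschitz for the supremum distance, which later turns a uniform error between paths into an error
  between integrals of test functions.\<close>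

definition path_bumps :: "real \<Rightarrow> ((real \<Rightarrow> real) \<Rightarrow> real) set" where
  "path_bumps T = (\<lambda>(cs, q) f. max 0 (1 - q * sup_dist T f (bernstein_path T cs))) ` (UNIV \<times> (\<rat> \<inter> {0..}))"

lemma path_bump_Lipschitz:
  assumes T: "0 \<le> T" and \<phi>: "\<phi> \<in> path_bumps T"
  shows "\<exists>L\<ge>0. \<forall>f\<in>paths T S. \<forall>g\<in>paths T S. \<forall>d. (\<forall>t\<in>{0..T}. \<bar>f t - g t\<bar> \<le> d) \<longrightarrow> \<bar>\<phi> f - \<phi> g\<bar> \<le> L * d"
proof -
  obtain cs q where q: "0 \<le> q" "\<phi> = (\<lambda>f. max 0 (1 - q * sup_dist T f (bernstein_path T cs)))"
    using \<phi> by (auto simp: path_bumps_def)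
  let ?c = "bernstein_path T cs"
  have "\<bar>\<phi> f - \<phi> g\<bar> \<le> q * d"
    if fg: "f \<in> paths T S" "g \<in> paths T S" "\<forall>t\<in>{0..T}. \<bar>f t - g t\<bar> \<le> d" for f g d
  proof -
    have "\<bar>sup_dist T f ?c - sup_dist T g ?c\<bar> \<le> d"
      using fg by (intro sup_dist_Lipschitz[OF T pathsD(3) pathsD(3) continuous_bernstein_path]) auto
    then have "q * \<bar>sup_dist T f ?c - sup_dist T g ?c\<bar> \<le> q * d"
      using q(1) by (rule mult_left_mono)
    then have "\<bar>q * sup_dist T f ?c - q * sup_dist T g ?c\<bar> \<le> q * d"
      using q(1) by (simp add: right_diff_distrib[symmetric] abs_mult)
    then show ?thesis
      unfolding q(2) by linarith
  qed
  then show ?thesis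
    using q(1) by blast
qed

lemma bump_family_path:
  assumes T: "0 < T"
  shows "bump_family (path_space T S) (path_bumps T)"
  unfolding bump_family_def
proof (intro conjI ballI allI impI)
  have T0: "0 \<le> T" using T by simp
  show "countable (path_bumps T)"
    unfolding path_bumps_def by (intro countable_image countable_SIGMA countable_Int1 countable_rat) auto
  show "continuous_map (path_space T S) euclideanreal \<phi>" if \<phi>: "\<phi> \<in> path_bumps T" for \<phi>
  proof -
    obtain L where L: "0 \<le> L" "\<And>f g d. f \<in> paths T S \<Longrightarrow> g \<in> paths T S \<Longrightarrow>
        (\<forall>t\<in>{0..T}. \<bar>f t - g t\<bar> \<le> d) \<Longrightarrow> \<bar>\<phi> f - \<phi> g\<bar> \<le> L * d"
      using path_bump_Lipschitz[OF T0 \<phi>] by metis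
    show ?thesis
    proof (rule continuous_map_path_real[OF T0])
      fix f e assume f: "f \<in> paths T S" and e: "0 < (e::real)"
      have "L * (e / (L + 1)) \<le> e" "0 < e / (L + 1)"
        using L(1) e by (auto simp: field_simps)
      then show "\<exists>d>0. \<forall>g\<in>paths T S. (\<forall>t\<in>{0..T}. \<bar>g t - f t\<bar> \<le> d) \<longrightarrow> \<bar>\<phi> g - \<phi> f\<bar> \<le> e"
        using L(2)[OF _ f] by (intro exI[of _ "e / (L + 1)"]) force
    qed
  qed
  show "\<phi> f \<in> {0..1}" if "\<phi> \<in> path_bumps T" "f \<in> topspace (path_space T S)" for \<phi> f
    using that sup_dist_nonneg[OF T0 pathsD(3) continuous_bernstein_path] by (auto simp: path_bumps_def)
  fix U f and e :: real assume *: "openin (path_space T S) U \<and> f \<in> U \<and> 0 < e"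
  then obtain r where r: "0 < r" "\<And>g. g \<in> paths T S \<Longrightarrow> (\<And>t. t \<in> {0..T} \<Longrightarrow> \<bar>g t - f t\<bar> \<le> r) \<Longrightarrow> g \<in> U"
    and f: "f \<in> paths T S" and e: "0 < e"
    unfolding openin_path_space[OF T0] by (metis subsetD)
  obtain q where q: "q \<in> \<rat>" "2/r < q"
    using Rats_dense_in_real[of "2/r" "2/r + 1"] by auto
  have q0: "0 < q"
    using q(2) r(1) by (smt (verit) divide_pos_pos)
  \<comment> \<open>The first bound keeps the tent above \<open>1 - e\<close> at \<open>f\<close>.
    The second, with the support radius \<open>1/q < r/2\<close>, keeps the support within distance
    \<open>r\<close> of \<open>f\<close>.\<close>
  define s where "s = min (e/(2*q)) (r/2)"
  have "0 < s"
    using e q0 r(1) by (simp add: s_def)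
  then obtain cs where cs: "\<And>t. t \<in> {0..T} \<Longrightarrow> \<bar>f t - bernstein_path T cs t\<bar> \<le> s"
    using bernstein_path_dense[OF T pathsD(3)[OF f]] by blast
  let ?c = "bernstein_path T cs"
  define \<phi> where "\<phi> g = max 0 (1 - q * sup_dist T g ?c)" for g
  have "\<phi> = (\<lambda>(cs, q) f. max 0 (1 - q * sup_dist T f (bernstein_path T cs))) (cs, q)"
    by (simp add: \<phi>_def fun_eq_iff)
  then have "\<phi> \<in> path_bumps T"
    unfolding path_bumps_def using q(1) q0 by (intro image_eqI[of _ _ "(cs, q)"]) auto
  moreover have "1 - e < \<phi> f"
  proof -
    have "sup_dist T f ?c \<le> e/(2*q)"
      using cs by (intro sup_dist_least[OF T0 pathsD(3)[OF f] continuous_bernstein_path]) (auto simp: s_def)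
    then have "q * sup_dist T f ?c \<le> e/2"
      using q0 by (simp add: field_simps)
    then show ?thesis
      using e unfolding \<phi>_def by linarith
  qed
  moreover have "\<phi> g = 0" if g: "g \<in> topspace (path_space T S) - U" for g
  proof (rule ccontr)
    assume "\<phi> g \<noteq> 0"
    then have "q * sup_dist T g ?c < 1"
      by (auto simp: \<phi>_def split: if_splits)
    then have "sup_dist T g ?c < 1/q"
      using q0 by (simp add: field_simps)
    also have "1/q < r/2"
      using q0 q(2) r(1) by (simp add: field_simps)
    finally have lt: "sup_dist T g ?c < r/2" .
    have gp: "g \<in> paths T S"
      using g by simp
    have "g \<in> U"
    proof (rule r(2)[OF gp])
      fix t assume t: "t \<in> {0..T}"
      have "\<bar>g t - ?c t\<bar> \<le> sup_dist T g ?c"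
        by (rule sup_dist_upper[OF T0 pathsD(3)[OF gp] continuous_bernstein_path t])
      moreover have "\<bar>f t - ?c t\<bar> \<le> r/2"
        using cs[OF t] by (simp add: s_def)
      ultimately show "\<bar>g t - f t\<bar> \<le> r"
        using lt by linarith
    qed
    then show False
      using g by simp
  qed
  ultimately show "\<exists>\<phi>\<in>path_bumps T. 1 - e < \<phi> f \<and> (\<forall>y\<in>topspace (path_space T S) - U. \<phi> y = 0)"
    by blast
qed

definition real_bumps :: "(real \<Rightarrow> real) set" where
  "real_bumps = (\<lambda>(p, q) x. max 0 (1 - q * \<bar>x - p\<bar>)) ` (\<rat> \<times> (\<rat> \<inter> {0..}))"

lemma bump_family_real: "bump_family (top_of_set I) real_bumps"
  unfolding bump_family_def
proof (intro conjI ballI allI impI)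
  show "countable real_bumps"
    unfolding real_bumps_def by (intro countable_image countable_SIGMA countable_Int1 countable_rat)
  show "continuous_map (top_of_set I) euclideanreal \<phi>" if \<phi>: "\<phi> \<in> real_bumps" for \<phi>
  proof -
    obtain p q where "\<phi> = (\<lambda>x. max 0 (1 - q * \<bar>x - p\<bar>))"
      using \<phi> by (auto simp: real_bumps_def)
    then show ?thesis
      by (auto intro!: continuous_intros)
  qed
  show "\<phi> x \<in> {0..1}" if "\<phi> \<in> real_bumps" for \<phi> x
    using that by (auto simp: real_bumps_def)
  fix U x and e :: real assume *: "openin (top_of_set I) U \<and> x \<in> U \<and> 0 < e"
  then obtain r where r: "0 < r" "cball x r \<inter> I \<subseteq> U" and e: "0 < e"
    unfolding openin_contains_cball by auto
  obtain q where q: "q \<in> \<rat>" "2/r < q"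
    using Rats_dense_in_real[of "2/r" "2/r + 1"] by auto
  have q0: "0 < q"
    using q(2) r(1) by (smt (verit) divide_pos_pos)
  define s where "s = min (e/(2*q)) (r/2)"
  have "0 < s"
    using e q0 r(1) by (simp add: s_def)
  then obtain p where p: "p \<in> \<rat>" "x < p" "p < x + s"
    using Rats_dense_in_real[of x "x + s"] by auto
  define \<phi> where "\<phi> y = max 0 (1 - q * \<bar>y - p\<bar>)" for y
  have "\<phi> = (\<lambda>(p, q) x. max 0 (1 - q * \<bar>x - p\<bar>)) (p, q)"
    by (simp add: \<phi>_def fun_eq_iff)
  then have "\<phi> \<in> real_bumps"
    unfolding real_bumps_def using p(1) q(1) q0 by (intro image_eqI[of _ _ "(p, q)"]) auto
  moreover have "1 - e < \<phi> x"
  proof -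
    have "\<bar>x - p\<bar> \<le> e/(2*q)"
      using p by (auto simp: s_def)
    then have "q * \<bar>x - p\<bar> \<le> e/2"
      using q0 by (simp add: field_simps)
    then show ?thesis
      using e unfolding \<phi>_def by linarith
  qed
  moreover have "\<phi> y = 0" if y: "y \<in> topspace (top_of_set I) - U" for y
  proof (rule ccontr)
    assume "\<phi> y \<noteq> 0"
    then have "q * \<bar>y - p\<bar> < 1"
      by (auto simp: \<phi>_def split: if_splits)
    then have "\<bar>y - p\<bar> < 1/q"
      using q0 by (simp add: field_simps)
    also have "1/q < r/2"
      using q0 q(2) r(1) by (simp add: field_simps)
    finally have "\<bar>y - p\<bar> < r/2" .
    moreover have "s \<le> r/2"
      by (simp add: s_def)
    ultimately have "\<bar>x - y\<bar> \<le> r"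
      using p by linarith
    then have "y \<in> cball x r"
      by (simp add: dist_real_def)
    then show False
      using y r(2) by auto
  qed
  ultimately show "\<exists>\<phi>\<in>real_bumps. 1 - e < \<phi> x \<and> (\<forall>y\<in>topspace (top_of_set I) - U. \<phi> y = 0)"
    by blast
qed

text \<open>The minimum vanishes off the rectangle formed by the two supports and is close to 1
  where both factors are.\<close>

definition prod_bumps :: "('a \<Rightarrow> real) set \<Rightarrow> ('b \<Rightarrow> real) set \<Rightarrow> ('a \<times> 'b \<Rightarrow> real) set" where
  "prod_bumps \<Phi> \<Psi> = (\<lambda>(\<phi>, \<psi>) x. min (\<phi> (fst x)) (\<psi> (snd x))) ` (\<Phi> \<times> \<Psi>)"

lemma bump_family_prod:
  assumes \<Phi>: "bump_family X \<Phi>" and \<Psi>: "bump_family Y \<Psi>"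
  shows "bump_family (prod_topology X Y) (prod_bumps \<Phi> \<Psi>)"
  unfolding bump_family_def
proof (intro conjI ballI allI impI)
  note 1 = bump_familyD[OF \<Phi>] and 2 = bump_familyD[OF \<Psi>]
  show "countable (prod_bumps \<Phi> \<Psi>)"
    unfolding prod_bumps_def by (intro countable_image countable_SIGMA 1(1) 2(1))
  show "continuous_map (prod_topology X Y) euclideanreal \<xi>" if *: "\<xi> \<in> prod_bumps \<Phi> \<Psi>" for \<xi>
  proof -
    obtain \<phi> \<psi> where \<xi>: "\<phi> \<in> \<Phi>" "\<psi> \<in> \<Psi>" "\<xi> = (\<lambda>x. min (\<phi> (fst x)) (\<psi> (snd x)))"
      using * by (auto simp: prod_bumps_def)
    have "continuous_map (prod_topology X Y) euclideanreal (\<phi> \<circ> fst)"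
      "continuous_map (prod_topology X Y) euclideanreal (\<psi> \<circ> snd)"
      using 1(2)[OF \<xi>(1)] 2(2)[OF \<xi>(2)]
      by (auto intro: continuous_map_compose continuous_map_fst continuous_map_snd)
    then show ?thesis
      unfolding \<xi>(3) by (intro continuous_map_real_min) (auto simp: o_def)
  qed
  show "\<xi> x \<in> {0..1}" if "\<xi> \<in> prod_bumps \<Phi> \<Psi>" "x \<in> topspace (prod_topology X Y)" for \<xi> x
    using that 1(3)[of _ "fst x"] 2(3)[of _ "snd x"] by (auto simp: prod_bumps_def min_le_iff_disj)
  fix U x and e :: real assume *: "openin (prod_topology X Y) U \<and> x \<in> U \<and> 0 < e"
  then have "\<exists>a b. openin X a \<and> openin Y b \<and> fst x \<in> a \<and> snd x \<in> b \<and> a \<times> b \<subseteq> U"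
    unfolding openin_prod_topology_alt by (metis prod.collapse)
  then obtain a b where ab: "openin X a" "openin Y b" "fst x \<in> a" "snd x \<in> b" "a \<times> b \<subseteq> U"
    by auto
  obtain \<phi> where \<phi>: "\<phi> \<in> \<Phi>" "1 - e < \<phi> (fst x)" "\<forall>y\<in>topspace X - a. \<phi> y = 0"
    using 1(4)[OF ab(1,3)] * by auto
  obtain \<psi> where \<psi>: "\<psi> \<in> \<Psi>" "1 - e < \<psi> (snd x)" "\<forall>y\<in>topspace Y - b. \<psi> y = 0"
    using 2(4)[OF ab(2,4)] * by auto
  define \<xi> where "\<xi> x = min (\<phi> (fst x)) (\<psi> (snd x))" for x
  have "\<xi> = (\<lambda>(\<phi>, \<psi>) x. min (\<phi> (fst x)) (\<psi> (snd x))) (\<phi>, \<psi>)"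
    by (simp add: \<xi>_def fun_eq_iff)
  then have "\<xi> \<in> prod_bumps \<Phi> \<Psi>"
    unfolding prod_bumps_def using \<phi>(1) \<psi>(1) by (intro image_eqI[of _ _ "(\<phi>, \<psi>)"]) auto
  moreover have "1 - e < \<xi> x"
    using \<phi> \<psi> by (simp add: \<xi>_def)
  moreover have "\<xi> y = 0" if y: "y \<in> topspace (prod_topology X Y) - U" for y
  proof -
    have "0 \<le> \<phi> (fst y)" "0 \<le> \<psi> (snd y)"
      using 1(3)[OF \<phi>(1), of "fst y"] 2(3)[OF \<psi>(1), of "snd y"] y by auto
    moreover have "fst y \<notin> a \<or> snd y \<notin> b"
      using y ab(5) by (metis DiffE mem_Times_iff subsetD)
    then have "\<phi> (fst y) = 0 \<or> \<psi> (snd y) = 0"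
      using y \<phi>(3) \<psi>(3) by auto
    ultimately show ?thesis
      by (auto simp: \<xi>_def)
  qed
  ultimately show "\<exists>\<xi>\<in>prod_bumps \<Phi> \<Psi>. 1 - e < \<xi> x \<and> (\<forall>y\<in>topspace (prod_topology X Y) - U. \<xi> y = 0)"
    by blast
qed

text \<open>Minima, maxima and nonnegative multiples preserve Lipschitz bounds; adding the constants
  is crude but sufficient, as only a fixed finite list is involved.\<close>

lemma test_fun_Lipschitz:
  assumes T: "0 \<le> T" and h: "h \<in> test_funs (prod_bumps (path_bumps T) (path_bumps T))"
  shows "\<exists>L\<ge>0. \<forall>x\<in>paths T S \<times> paths T S'. \<forall>y\<in>paths T S \<times> paths T S'. \<forall>d\<ge>0.
    (\<forall>t\<in>{0..T}. \<bar>fst x t - fst y t\<bar> \<le> d \<and> \<bar>snd x t - snd y t\<bar> \<le> d) \<longrightarrow> \<bar>h x - h y\<bar> \<le> L * d"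
proof -
  define lip where "lip h L \<longleftrightarrow> 0 \<le> L \<and> (\<forall>x\<in>paths T S \<times> paths T S'. \<forall>y\<in>paths T S \<times> paths T S'. \<forall>d\<ge>0.
    (\<forall>t\<in>{0..T}. \<bar>fst x t - fst y t\<bar> \<le> d \<and> \<bar>snd x t - snd y t\<bar> \<le> d) \<longrightarrow> \<bar>h x - h y\<bar> \<le> L * d)"
    for h and L :: real
  have prod: "\<exists>L. lip \<xi> L" if \<xi>: "\<xi> \<in> prod_bumps (path_bumps T) (path_bumps T)" for \<xi>
  proof -
    obtain \<phi> \<psi> where \<phi>\<psi>: "\<phi> \<in> path_bumps T" "\<psi> \<in> path_bumps T" "\<xi> = (\<lambda>x. min (\<phi> (fst x)) (\<psi> (snd x)))"
      using \<xi> by (auto simp: prod_bumps_def)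
    obtain L where L: "0 \<le> L" "\<And>f g d. f \<in> paths T S \<Longrightarrow> g \<in> paths T S \<Longrightarrow>
        \<forall>t\<in>{0..T}. \<bar>f t - g t\<bar> \<le> d \<Longrightarrow> \<bar>\<phi> f - \<phi> g\<bar> \<le> L * d"
      using path_bump_Lipschitz[OF T \<phi>\<psi>(1), of S] by blast
    obtain K where K: "0 \<le> K" "\<And>f g d. f \<in> paths T S' \<Longrightarrow> g \<in> paths T S' \<Longrightarrow>
        \<forall>t\<in>{0..T}. \<bar>f t - g t\<bar> \<le> d \<Longrightarrow> \<bar>\<psi> f - \<psi> g\<bar> \<le> K * d"
      using path_bump_Lipschitz[OF T \<phi>\<psi>(2), of S'] by blast
    have "\<bar>\<xi> x - \<xi> y\<bar> \<le> (L + K) * d"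
      if "x \<in> paths T S \<times> paths T S'" "y \<in> paths T S \<times> paths T S'" "0 \<le> d"
        "\<forall>t\<in>{0..T}. \<bar>fst x t - fst y t\<bar> \<le> d \<and> \<bar>snd x t - snd y t\<bar> \<le> d" for x y d
    proof -
      have "\<bar>\<phi> (fst x) - \<phi> (fst y)\<bar> \<le> L * d" "\<bar>\<psi> (snd x) - \<psi> (snd y)\<bar> \<le> K * d"
        using that by (auto intro!: L(2) K(2) simp: mem_Times_iff)
      moreover have "0 \<le> L * d" "0 \<le> K * d"
        using L(1) K(1) that(3) by auto
      ultimately have "\<bar>\<xi> x - \<xi> y\<bar> \<le> L * d + K * d"
        unfolding \<phi>\<psi>(3) by linarith
      then show ?thesis
        by (simp add: distrib_right)
    qed
    then show ?thesis
      unfolding lip_def using L(1) K(1) by (intro exI[of _ "L + K"]) auto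
  qed
  obtain hs where hs: "hs \<in> lists ((\<rat> \<inter> {0..}) \<times> prod_bumps (path_bumps T) (path_bumps T))" "h = test_fun hs"
    using h by (auto simp: test_funs_def)
  from hs(1) have "\<exists>L. lip (test_fun hs) L"
  proof (induction hs)
    case Nil
    show ?case
      by (intro exI[of _ 0]) (simp add: lip_def)
  next
    case (Cons h hs)
    obtain c \<xi> where c: "h = (c, \<xi>)" "0 \<le> c" "\<xi> \<in> prod_bumps (path_bumps T) (path_bumps T)"
      using Cons.hyps(1) by auto
    obtain L where L: "lip (test_fun hs) L"
      using Cons.IH by auto
    obtain K where K: "lip \<xi> K"
      using prod[OF c(3)] by auto
    have "\<bar>test_fun (h # hs) x - test_fun (h # hs) y\<bar> \<le> (L + c * K) * d"
      if "x \<in> paths T S \<times> paths T S'" "y \<in> paths T S \<times> paths T S'" "0 \<le> d"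
        "\<forall>t\<in>{0..T}. \<bar>fst x t - fst y t\<bar> \<le> d \<and> \<bar>snd x t - snd y t\<bar> \<le> d" for x y d
    proof -
      have "\<bar>test_fun hs x - test_fun hs y\<bar> \<le> L * d" "\<bar>\<xi> x - \<xi> y\<bar> \<le> K * d"
        using L K that unfolding lip_def by blast+
      moreover from this(2) have "\<bar>c * \<xi> x - c * \<xi> y\<bar> \<le> c * (K * d)"
        using c(2) mult_left_mono by (simp add: right_diff_distrib[symmetric] abs_mult)
      moreover have "0 \<le> L * d" "0 \<le> c * (K * d)"
        using L K c(2) that(3) by (auto simp: lip_def)
      ultimately have "\<bar>max (c * \<xi> x) (test_fun hs x) - max (c * \<xi> y) (test_fun hs y)\<bar> \<le> L * d + c * (K * d)"
        by linarith
      then show ?thesis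
        by (simp add: c(1) distrib_right mult.assoc)
    qed
    then show ?case
      unfolding lip_def using L K c(2) by (intro exI[of _ "L + c * K"]) (auto simp: lip_def)
  qed
  then show ?thesis
    using hs(2) unfolding lip_def by blast
qed

section \<open>Empirical measures of the inputs\<close>

lemma integral_empirical:
  fixes h :: "'a \<Rightarrow> real"
  assumes "\<And>i. i < N \<Longrightarrow> y i \<in> topspace X" "h \<in> borel_measurable (borel_of X)"
  shows "(\<integral>x. h x \<partial>empirical X N y) = (\<Sum>i<N. h (y i)) / real N"
proof -
  have "y \<in> uniform_count_measure {..<N} \<rightarrow>\<^sub>M borel_of X"
    using assms(1) by (auto simp: measurable_def space_uniform_count_measure sets_uniform_count_measure)
  then have "(\<integral>x. h x \<partial>empirical X N y) = (\<integral>i. h (y i) \<partial>uniform_count_measure {..<N})"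
    unfolding empirical_def using assms(2) by (rule integral_distr)
  then show ?thesis
    by (simp add: integral_uniform_count_measure)
qed

lemma sets_empirical [simp]: "sets (empirical X N y) = sets (borel_of X)"
  by (simp add: empirical_def)

lemma prob_space_empirical:
  assumes "1 \<le> N" "\<And>i. i < N \<Longrightarrow> y i \<in> topspace X"
  shows "prob_space (empirical X N y)"
proof -
  interpret prob_space "uniform_count_measure {..<N}"
    using assms(1) by (intro prob_space_uniform_count_measure) (auto simp: lessThan_empty_iff)
  show ?thesis
    unfolding empirical_def using assms(2)
    by (intro prob_space_distr) (auto simp: measurable_def space_uniform_count_measure sets_uniform_count_measure)
qed

text \<open>By Hoeffding's inequality large deviations of the mean have geometrically small
  probability, and Borel-Cantelli concludes. Identical laws cannot be assumed: the summands to come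
  depend on the individual radii.\<close>

lemma (in prob_space) strong_law_bounded:
  fixes X :: "nat \<Rightarrow> 'a \<Rightarrow> real"
  assumes indep: "indep_vars (\<lambda>_. borel) X UNIV"
    and B: "\<And>i w. w \<in> space M \<Longrightarrow> \<bar>X i w\<bar> \<le> B" and mean: "\<And>i. expectation (X i) = 0"
  shows "AE w in M. (\<lambda>n. (\<Sum>i<n. X i w) / real n) \<longlonglongrightarrow> 0"
proof -
  \<comment> \<open>The added 1 keeps the denominator in Hoeffding's bound positive even if
    \<open>B = 0\<close>.\<close>
  define C where "C = B + 1"
  obtain w0 where "w0 \<in> space M"
    using not_empty by blast
  from B[OF this, of 0] have "0 < C"
    by (simp add: C_def)
  have "\<bar>X i w\<bar> \<le> C" if "w \<in> space M" for i w
    using B[OF that, of i] by (simp add: C_def)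
  note C = \<open>0 < C\<close> this
  have rv [measurable]: "random_variable borel (X i)" for i
    using indep by (auto simp: indep_vars_def)
  have small: "AE w in M. \<forall>\<^sub>F n in sequentially. \<bar>\<Sum>i<n. X i w\<bar> < real n * d" if d: "0 < d" for d
  proof -
    define A where "A n = {w \<in> space M. real (Suc n) * d \<le> \<bar>\<Sum>i<Suc n. X i w\<bar>}" for n
    define \<rho> where "\<rho> = exp (- (d\<^sup>2 / (2 * C\<^sup>2)))"
    have le: "prob (A n) \<le> 2 * \<rho> ^ Suc n" for n
    proof -
      interpret H: Hoeffding_ineq M "{..<Suc n}" X "\<lambda>_. - C" "\<lambda>_. C" 0
      proof unfold_locales
        show "indep_vars (\<lambda>_. borel) X {..<Suc n}"
          by (rule indep_vars_subset[OF indep]) auto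
        show "AE x in M. X i x \<in> {- C..C}" for i
          using C(2) by (intro AE_I2) (auto simp: abs_le_iff minus_le_iff)
        show "0 \<equiv> (\<Sum>i<Suc n. expectation (X i))"
          by (simp add: mean)
      qed auto
      have "prob (A n) \<le> 2 * exp (- 2 * (real (Suc n) * d)\<^sup>2 / (\<Sum>i<Suc n. (C - - C)\<^sup>2))"
        unfolding A_def using H.Hoeffding_ineq_abs_ge[of "real (Suc n) * d"] d C(1)
        by (simp del: sum.lessThan_Suc of_nat_Suc)
      \<comment> \<open>Each summand ranges over an interval of length \<open>2 * C\<close>, so the
        denominator grows linearly in the number of summands and the numerator quadratically; the
        bound is a power of \<open>\<rho>\<close>.\<close>
      also have "- 2 * (real (Suc n) * d)\<^sup>2 / (\<Sum>i<Suc n. (C - - C)\<^sup>2) = real (Suc n) * (- (d\<^sup>2 / (2 * C\<^sup>2)))"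
        using C(1) by (simp add: power2_eq_square field_simps del: sum.lessThan_Suc of_nat_Suc)
      also have "exp \<dots> = \<rho> ^ Suc n"
        unfolding \<rho>_def by (rule exp_of_nat_mult)
      finally show ?thesis .
    qed
    have "\<rho> < 1" "0 \<le> \<rho>"
      using d C(1) by (auto simp: \<rho>_def)
    then have "summable (\<lambda>n. 2 * \<rho> ^ Suc n)"
      by (intro summable_mult) (simp add: summable_Suc_iff summable_geometric)
    then have "summable (\<lambda>n. prob (A n))"
    proof (rule summable_comparison_test')
      show "norm (prob (A n)) \<le> 2 * \<rho> ^ Suc n" for n
        using le[of n] by (simp del: power_Suc)
    qed
    moreover have "A n \<in> events" for n
      unfolding A_def by measurable
    ultimately have "AE w in M. \<forall>\<^sub>F n in sequentially. w \<in> space M - A n"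
      by (intro borel_cantelli_AE1) (auto simp: emeasure_eq_measure)
    then show ?thesis
    proof eventually_elim
      case (elim w)
      then have "\<forall>\<^sub>F n in sequentially. \<bar>\<Sum>i<Suc n. X i w\<bar> < real (Suc n) * d"
        by eventually_elim (auto simp: A_def not_le)
      then show ?case
        by (subst (asm) eventually_sequentially_Suc)
    qed
  qed
  \<comment> \<open>Countably many tolerances suffice for convergence and share one null
    set.\<close>
  have "AE w in M. \<forall>k::nat. \<forall>\<^sub>F n in sequentially. \<bar>\<Sum>i<n. X i w\<bar> < real n * (1 / real (Suc k))"
    unfolding AE_all_countable by (intro allI small) simp
  then show ?thesis
  proof eventually_elim
    case (elim w)
    show ?case
    proof (rule LIMSEQ_I)
      fix r :: real assume "0 < r"
      then obtain k where k: "1 / real (Suc k) < r"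
        using nat_approx_posE by blast
      have "\<forall>\<^sub>F n in sequentially. norm ((\<Sum>i<n. X i w) / real n - 0) < r"
        using elim[rule_format, of k] eventually_gt_at_top[of 0]
      proof eventually_elim
        case (elim n)
        then have "\<bar>(\<Sum>i<n. X i w) / real n\<bar> < 1 / real (Suc k)"
          by (simp add: field_simps)
        then show ?case
          using k by simp
      qed
      then show "\<exists>n0. \<forall>n\<ge>n0. norm ((\<Sum>i<n. X i w) / real n - 0) < r"
        by (simp add: eventually_sequentially)
    qed
  qed
qed

section \<open>Uniqueness of the law of Brownian motion\<close>

definition increments :: "(nat \<Rightarrow> real) \<Rightarrow> (real \<Rightarrow> real) \<Rightarrow> nat \<Rightarrow> real" where
  "increments u f = (\<lambda>j. f (u (Suc j)) - f (u j))"

text \<open>Repeated times give increments that vanish identically, with law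
  \<open>return borel 0\<close>. Allowing them lets an eventually constant sequence \<open>u\<close>
  encode finitely many times.\<close>

lemma brownian_increments_law:
  assumes T: "0 < T" and W: "brownian_motion T M W" and u: "mono u" "range u \<subseteq> {0..T}"
  shows "(\<lambda>w. increments u (W w)) \<in> M \<rightarrow>\<^sub>M (\<Pi>\<^sub>M j\<in>UNIV. borel)"
    and "distr M (\<Pi>\<^sub>M j\<in>UNIV. borel) (\<lambda>w. increments u (W w)) =
      (\<Pi>\<^sub>M j\<in>(UNIV::nat set). if u j < u (Suc j) then density lborel (normal_density 0 (sqrt (u (Suc j) - u j)))
        else return borel (0::real))"
proof -
  interpret prob_space M
    using W by (simp add: brownian_motion_def)
  have ur: "u j \<in> {0..T}" for j
    using u(2) by blast
  have Wm: "W \<in> M \<rightarrow>\<^sub>M borel_of (path_space T UNIV)"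
    using W by (simp add: brownian_motion_def)
  have ev [measurable]: "(\<lambda>w. W w (u j)) \<in> borel_measurable M" for j
    using T ur by (intro measurable_path_eval[OF _ _ Wm]) auto
  show "(\<lambda>w. increments u (W w)) \<in> M \<rightarrow>\<^sub>M (\<Pi>\<^sub>M j\<in>UNIV. borel)"
    by (intro measurable_PiM_single') (auto simp: increments_def)
  have law: "distr M borel (\<lambda>w. W w (u (Suc j)) - W w (u j)) =
      (if u j < u (Suc j) then density lborel (normal_density 0 (sqrt (u (Suc j) - u j))) else return borel 0)" for j
  proof (cases "u j < u (Suc j)")
    case True
    then have "distributed M lborel (\<lambda>w. W w (u (Suc j)) - W w (u j)) (normal_density 0 (sqrt (u (Suc j) - u j)))"
      using W ur[of j] ur[of "Suc j"] by (simp add: brownian_motion_def)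
    then have "distr M lborel (\<lambda>w. W w (u (Suc j)) - W w (u j)) = density lborel (normal_density 0 (sqrt (u (Suc j) - u j)))"
      by (rule distributed_distr_eq_density)
    then show ?thesis
      using True by (simp cong: distr_cong)
  next
    case False
    then have "u (Suc j) = u j"
      using monoD[OF u(1), of j "Suc j"] by simp
    then show ?thesis
      using False by (simp add: distr_const prob_space_axioms)
  qed
  have "indep_vars (\<lambda>_. borel) (\<lambda>j w. W w (u (Suc j)) - W w (u j)) UNIV"
    using W u by (simp add: brownian_motion_def)
  then show "distr M (\<Pi>\<^sub>M j\<in>UNIV. borel) (\<lambda>w. increments u (W w)) =
      (\<Pi>\<^sub>M j\<in>(UNIV::nat set). if u j < u (Suc j) then density lborel (normal_density 0 (sqrt (u (Suc j) - u j)))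
        else return borel (0::real))"
    by (subst (asm) indep_vars_iff_distr_eq_PiM) (auto simp: law increments_def[abs_def] restrict_def)
qed

definition cylinder :: "real \<Rightarrow> real set \<Rightarrow> (real \<Rightarrow> real set) \<Rightarrow> (real \<Rightarrow> real) set" where
  "cylinder T J A = {f \<in> paths T UNIV. \<forall>t\<in>J. f t \<in> A t}"

definition cylinders :: "real \<Rightarrow> (real \<Rightarrow> real) set set" where
  "cylinders T = {cylinder T J A | J A. finite J \<and> J \<subseteq> {0..T} \<and> (\<forall>t. A t \<in> sets borel)}"

lemma Int_stable_cylinders: "Int_stable (cylinders T)"
proof (rule Int_stableI)
  fix a b assume "a \<in> cylinders T" "b \<in> cylinders T"
  then obtain J A J' A' where J: "finite J" "J \<subseteq> {0..T}" "\<And>t. A t \<in> sets borel" "a = cylinder T J A"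
    and J': "finite J'" "J' \<subseteq> {0..T}" "\<And>t. A' t \<in> sets borel" "b = cylinder T J' A'"
    unfolding cylinders_def by blast
  \<comment> \<open>A time that occurs in only one of the two cylinders is unconstrained by the
    other, hence the default \<open>UNIV\<close>.\<close>
  have "a \<inter> b = cylinder T (J \<union> J') (\<lambda>t. (if t \<in> J then A t else UNIV) \<inter> (if t \<in> J' then A' t else UNIV))"
    unfolding J(4) J'(4) cylinder_def by (auto split: if_splits)
  then show "a \<inter> b \<in> cylinders T"
    unfolding cylinders_def mem_Collect_eq using J(1-3) J'(1-3)
    by (intro exI[of _ "J \<union> J'"] exI[of _ "\<lambda>t. (if t \<in> J then A t else UNIV) \<inter> (if t \<in> J' then A' t else UNIV)"]
        conjI allI sets.Int) auto
qed

text \<open>One inclusion is measurability of the identity, which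
  \<open>measurable_into_path_space\<close> reduces to evaluations; the other is measurability of
  the evaluations themselves.\<close>

lemma sets_path_space_cylinders:
  assumes T: "0 < T"
  shows "sets (borel_of (path_space T UNIV)) = sigma_sets (paths T UNIV) (cylinders T)"
proof (rule antisym)
  have sub: "cylinders T \<subseteq> Pow (paths T UNIV)"
    by (auto simp: cylinders_def cylinder_def)
  define \<Sigma> where "\<Sigma> = sigma (paths T UNIV) (cylinders T)"
  have space: "space \<Sigma> = paths T UNIV" and sets: "sets \<Sigma> = sigma_sets (paths T UNIV) (cylinders T)"
    using sub by (auto simp: \<Sigma>_def)
  have "(\<lambda>f. f) \<in> \<Sigma> \<rightarrow>\<^sub>M borel_of (path_space T UNIV)"
  proof (rule measurable_into_path_space[OF T])
    show "f \<in> paths T UNIV" if "f \<in> space \<Sigma>" for f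
      using that space by simp
    show "(\<lambda>f. f t) \<in> borel_measurable \<Sigma>" if t: "t \<in> {0..T}" for t
    proof (rule measurableI)
      fix A :: "real set" assume "A \<in> sets borel"
      then have "cylinder T {t} (\<lambda>_. A) \<in> cylinders T"
        using t unfolding cylinders_def by (intro CollectI exI[of _ "{t}"] exI[of _ "\<lambda>_. A"]) auto
      moreover have "(\<lambda>f. f t) -` A \<inter> space \<Sigma> = cylinder T {t} (\<lambda>_. A)"
        by (auto simp: space cylinder_def)
      ultimately show "(\<lambda>f. f t) -` A \<inter> space \<Sigma> \<in> sets \<Sigma>"
        by (auto simp: sets)
    qed auto
  qed
  then have *: "A \<inter> space \<Sigma> \<in> sets \<Sigma>" if "A \<in> sets (borel_of (path_space T UNIV))" for A
    using measurable_sets[OF _ that, of "\<lambda>f. f" \<Sigma>] by simp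
  show "sets (borel_of (path_space T UNIV)) \<subseteq> sigma_sets (paths T UNIV) (cylinders T)"
  proof
    fix A assume A: "A \<in> sets (borel_of (path_space T UNIV))"
    then have "A \<inter> space \<Sigma> = A"
      using sets.sets_into_space[OF A] space by auto
    then show "A \<in> sigma_sets (paths T UNIV) (cylinders T)"
      using *[OF A] sets by simp
  qed
  have "c \<in> sets (borel_of (path_space T UNIV))" if c: "c \<in> cylinders T" for c
  proof -
    obtain J A where J: "finite J" "J \<subseteq> {0..T}" "\<And>t. A t \<in> sets borel" "c = cylinder T J A"
      using c by (auto simp: cylinders_def)
    have "c = {f \<in> space (borel_of (path_space T UNIV)). \<forall>t\<in>J. f t \<in> A t}"
      by (simp add: J(4) cylinder_def)
    also have "\<dots> \<in> sets (borel_of (path_space T UNIV))"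
    proof (rule sets.sets_Collect_countable_All')
      show "countable J"
        using J(1) by (rule countable_finite)
      show "{f \<in> space (borel_of (path_space T UNIV)). f t \<in> A t} \<in> sets (borel_of (path_space T UNIV))" if "t \<in> J" for t
        using measurable_sets[OF measurable_path_eval[of T t "\<lambda>f. f" "borel_of (path_space T UNIV)" UNIV] J(3)[of t]] T J(2) that
        by (auto simp: vimage_def Int_def conj_commute)
    qed
    finally show ?thesis .
  qed
  then have "sigma_sets (space (borel_of (path_space T UNIV))) (cylinders T) \<subseteq> sets (borel_of (path_space T UNIV))"
    by (intro sets.sigma_sets_subset) auto
  then show "sigma_sets (paths T UNIV) (cylinders T) \<subseteq> sets (borel_of (path_space T UNIV))"
    by simp
qed

text \<open>The sorted times are continued by the last one, as infinite monotone sequences are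
  required. Starting at 0 lets the values of a path be recovered from its increments.\<close>

lemma finite_times_enumeration:
  fixes J :: "real set"
  assumes "finite J" "J \<subseteq> {0..T}" "0 \<le> T"
  shows "\<exists>u. mono u \<and> range u \<subseteq> {0..T} \<and> u 0 = 0 \<and> (\<forall>t\<in>J. \<exists>j::nat. t = u j)"
proof -
  define xs where "xs = sorted_list_of_set (insert 0 J)"
  have xs: "sorted xs" "set xs = insert 0 J" "xs \<noteq> []"
    using assms(1) by (auto simp: xs_def simp del: sorted_list_of_set_insert_remove)
  define u where "u j = xs ! min j (length xs - 1)" for j
  have lt: "min j (length xs - 1) < length xs" for j
    using xs(3) by (cases xs) auto
  have "mono u"
    unfolding u_def by (intro monoI sorted_nth_mono[OF xs(1) _ lt]) auto
  have mem: "u j \<in> insert 0 J" for j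
    using nth_mem[OF lt[of j]] xs(2) by (simp add: u_def)
  have "u j \<in> {0..T}" for j
    using mem[of j] assms(2,3) by auto
  then have r: "range u \<subseteq> {0..T}"
    by blast
  have all: "\<exists>j. t = u j" if "t \<in> insert 0 J" for t
  proof -
    obtain i where "i < length xs" "xs ! i = t"
      using \<open>t \<in> insert 0 J\<close> xs(2) by (metis in_set_conv_nth)
    then show ?thesis
      by (intro exI[of _ i]) (auto simp: u_def min_def)
  qed
  obtain j where "0 = u j"
    using all[of 0] by auto
  then have "u 0 \<le> 0"
    using monoD[OF \<open>mono u\<close>, of 0 j] by simp
  moreover have "u 0 \<in> {0..T}"
    using r by blast
  ultimately have "u 0 = 0"
    by auto
  then show ?thesis
    using \<open>mono u\<close> r all by (intro exI[of _ u]) auto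
qed

text \<open>Since the path starts at 0 almost surely, its values at finitely many times are partial
  sums of increments of known joint law. Thus the law is fixed on the intersection-stable generator
  of cylinders.\<close>

lemma brownian_law_unique:
  assumes T: "0 < T" and W: "brownian_motion T M W" and W': "brownian_motion T M' W'"
  shows "distr M (borel_of (path_space T UNIV)) W = distr M' (borel_of (path_space T UNIV)) W'"
proof -
  let ?P = "borel_of (path_space T UNIV)"
  \<comment> \<open>The right-hand side mentions only the times and the sets of the cylinder,
    neither the probability space nor the process.\<close>
  have cyl: "emeasure (distr M ?P W) (cylinder T J A) =
      emeasure (\<Pi>\<^sub>M j\<in>(UNIV::nat set). if u j < u (Suc j) then density lborel (normal_density 0 (sqrt (u (Suc j) - u j)))
        else return borel (0::real)) {d \<in> space (\<Pi>\<^sub>M j\<in>UNIV. borel). \<forall>t\<in>J. (\<Sum>i<j t. d i) \<in> A t}"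
    if W: "brownian_motion T M W" and J: "finite J" "J \<subseteq> {0..T}" "\<And>t. A t \<in> sets borel"
      and u: "mono u" "range u \<subseteq> {0..T}" "u 0 = 0" "\<forall>t\<in>J. t = u (j t)"
    for M :: "'c measure" and W J A u j
  proof -
    interpret prob_space M
      using W by (simp add: brownian_motion_def)
    have Wm: "W \<in> M \<rightarrow>\<^sub>M ?P" and W0: "AE w in M. W w 0 = 0"
      using W by (auto simp: brownian_motion_def)
    have cs: "cylinder T J A \<in> sets ?P"
      unfolding sets_path_space_cylinders[OF T] using J by (intro sigma_sets.Basic) (auto simp: cylinders_def)
    let ?E = "{d \<in> space (\<Pi>\<^sub>M j\<in>UNIV. borel). \<forall>t\<in>J. (\<Sum>i<j t. d i) \<in> A t}"
    have Es: "?E \<in> sets (\<Pi>\<^sub>M j\<in>(UNIV::nat set). borel)"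
    proof (rule sets.sets_Collect_countable_All')
      show "countable J"
        using J(1) by (rule countable_finite)
      show "{d \<in> space (\<Pi>\<^sub>M j\<in>UNIV. borel). (\<Sum>i<j t. d i) \<in> A t} \<in> sets (\<Pi>\<^sub>M j\<in>(UNIV::nat set). (borel :: real measure))" for t
        using J(3)[of t] by measurable
    qed
    note inc = brownian_increments_law[OF T W u(1,2)]
    have "emeasure (distr M ?P W) (cylinder T J A) = emeasure M (W -` cylinder T J A \<inter> space M)"
      by (rule emeasure_distr[OF Wm cs])
    also have "\<dots> = emeasure M ((\<lambda>w. increments u (W w)) -` ?E \<inter> space M)"
    proof (rule emeasure_eq_AE)
      show "AE w in M. w \<in> W -` cylinder T J A \<inter> space M \<longleftrightarrow> w \<in> (\<lambda>w. increments u (W w)) -` ?E \<inter> space M"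
        using W0 AE_space
      proof eventually_elim
        case (elim w)
        have sum: "(\<Sum>i<n. increments u (W w) i) = W w (u n)" for n
          using elim(1) u(3) sum_lessThan_telescope[of "\<lambda>i. W w (u i)" n] by (simp add: increments_def)
        have "W w \<in> paths T UNIV"
          using measurable_space[OF Wm elim(2)] by simp
        then show ?case
          using elim(2) u(4) by (auto simp: cylinder_def sum space_PiM)
      qed
    qed (use measurable_sets[OF Wm cs] measurable_sets[OF inc(1) Es] in auto)
    also have "\<dots> = emeasure (distr M (\<Pi>\<^sub>M j\<in>UNIV. borel) (\<lambda>w. increments u (W w))) ?E"
      by (rule emeasure_distr[OF inc(1) Es, symmetric])
    finally show ?thesis
      by (simp only: inc(2))
  qed
  have sets: "sets ?P = sigma_sets (paths T UNIV) (cylinders T)"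
    by (rule sets_path_space_cylinders[OF T])
  show ?thesis
  proof (rule measure_eqI_generator_eq[OF Int_stable_cylinders, where A = "\<lambda>_. paths T UNIV"])
    show "cylinders T \<subseteq> Pow (paths T UNIV)"
      by (auto simp: cylinders_def cylinder_def)
    fix c assume "c \<in> cylinders T"
    then obtain J A where J: "finite J" "J \<subseteq> {0..T}" "\<And>t. A t \<in> sets borel" "c = cylinder T J A"
      unfolding cylinders_def by blast
    obtain u where u: "mono u" "range u \<subseteq> {0..T}" "u 0 = 0" "\<forall>t\<in>J. \<exists>j::nat. t = u j"
      using finite_times_enumeration[OF J(1,2)] T by auto
    obtain j where j: "\<forall>t\<in>J. t = u (j t)"
      using u(4) by metis
    show "emeasure (distr M ?P W) c = emeasure (distr M' ?P W') c"
      unfolding J(4) cyl[of M W J A u j, OF W J(1-3) u(1-3) j] cyl[of M' W' J A u j, OF W' J(1-3) u(1-3) j] ..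
  next
    have "cylinder T {} (\<lambda>_. UNIV) = paths T UNIV"
      by (auto simp: cylinder_def)
    then show "range (\<lambda>_::nat. paths T UNIV) \<subseteq> cylinders T"
      unfolding cylinders_def by force
    interpret prob_space M
      using W by (simp add: brownian_motion_def)
    interpret D: prob_space "distr M ?P W"
      using W by (intro prob_space_distr) (simp add: brownian_motion_def)
    show "emeasure (distr M ?P W) (paths T UNIV) \<noteq> \<infinity>" for i :: nat
      by simp
  qed (use sets in auto)
qed

lemma second_countable_euclidean: "second_countable (top_of_set (S :: 'a :: second_countable_topology set))"
proof (rule second_countable_subtopology)
  obtain B :: "'a set set" where B: "countable B" "\<And>C. C \<in> B \<Longrightarrow> open C" "\<And>S. open S \<Longrightarrow> \<exists>U. U \<subseteq> B \<and> S = \<Union>U"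
    by (rule univ_second_countable) blast
  have "\<exists>V\<in>B. x \<in> V \<and> V \<subseteq> U" if "open U" "x \<in> U" for U x
    using B(3)[OF that(1)] that(2) by blast
  then show "second_countable (euclidean :: 'a topology)"
    unfolding second_countable_def using B(1,2) by (intro exI[of _ B]) auto
qed

text \<open>Only the noise is random: the law of large numbers replaces \<open>h (W\<^sup>i, r\<^sup>i)\<close> by its mean, and
  the means converge along the deterministic radii.\<close>

lemma empirical_input_converges:
  fixes r :: "nat \<Rightarrow> real"
  assumes T: "0 < T" and W: "\<And>i. brownian_motion T M (W i)"
    and indep: "prob_space.indep_vars M (\<lambda>_. borel_of (path_space T UNIV)) W UNIV"
    and \<mu>W: "wiener_measure T \<mu>W" and r: "\<And>i. r i \<in> I"
    and lam: "prob_space lam" "sets lam = sets (borel_of (top_of_set I))"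
    and r_lim: "weak_conv_on (top_of_set I) (\<lambda>N. empirical (top_of_set I) N r) lam"
  shows "AE w in M. weak_conv_on (prod_topology (path_space T UNIV) (top_of_set I))
    (\<lambda>N. empirical (prod_topology (path_space T UNIV) (top_of_set I)) N (\<lambda>i. (W i w, r i))) (\<mu>W \<Otimes>\<^sub>M lam)"
proof -
  let ?P = "path_space T UNIV" and ?I = "top_of_set I"
  let ?E = "prod_topology ?P ?I"
  have psM: "prob_space M" using W[of 0] by (simp add: brownian_motion_def)
  interpret prob_space M by fact
  have \<mu>s: "sets \<mu>W = sets (borel_of ?P)" and bW: "brownian_motion T \<mu>W (\<lambda>w. w)"
    using \<mu>W by (auto simp: wiener_measure_def)
  interpret \<mu>W: prob_space \<mu>W using bW by (simp add: brownian_motion_def)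
  interpret lam: prob_space lam by (rule lam(1))
  interpret PP: pair_prob_space \<mu>W lam ..
  have Wm [measurable]: "W i \<in> M \<rightarrow>\<^sub>M borel_of ?P" for i
    using W[of i] by (simp add: brownian_motion_def)
  have law: "distr M (borel_of ?P) (W i) = \<mu>W" for i
  proof -
    have "distr M (borel_of ?P) (W i) = distr \<mu>W (borel_of ?P) (\<lambda>w. w)"
      by (rule brownian_law_unique[OF T W bW])
    then show ?thesis
      using \<mu>s by (simp add: distr_id2)
  qed
  have sc: "second_countable ?P" "second_countable ?I"
    by (auto intro: second_countable_path_space[OF T] second_countable_euclidean)
  have setsE: "sets (\<mu>W \<Otimes>\<^sub>M lam) = sets (borel_of ?E)"
    unfolding sets_borel_of_prod[OF sc] using \<mu>s lam(2) by (rule sets_pair_measure_cong)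
  define \<Phi> where "\<Phi> = prod_bumps (path_bumps T) real_bumps"
  have \<Phi>: "bump_family ?E \<Phi>"
    unfolding \<Phi>_def by (intro bump_family_prod bump_family_path bump_family_real T)
  have Wsp: "W i w \<in> paths T UNIV" if "w \<in> space M" for i w
    using measurable_space[OF Wm that] by simp
  have one: "AE w in M. (\<lambda>N. \<integral>x. h x \<partial>empirical ?E N (\<lambda>i. (W i w, r i))) \<longlonglongrightarrow> (\<integral>x. h x \<partial>(\<mu>W \<Otimes>\<^sub>M lam))"
    if h: "continuous_map ?E euclideanreal h" and B: "\<And>x. x \<in> topspace ?E \<Longrightarrow> \<bar>h x\<bar> \<le> B" for h B
  proof -
    have hm: "h \<in> borel_measurable (borel_of ?E)"
      using continuous_map_measurable[OF h] by (simp add: borel_of_euclidean)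
    have hcr: "continuous_map ?P euclideanreal (\<lambda>f. h (f, x))" if "x \<in> I" for x
      using continuous_map_compose[OF _ h, of ?P "\<lambda>f. (f, x)"] that
      by (simp add: o_def continuous_map_pairwise)
    have hcf: "continuous_map ?I euclideanreal (\<lambda>x. h (f, x))" if "f \<in> paths T UNIV" for f
      using continuous_map_compose[OF _ h, of ?I "\<lambda>x. (f, x)"] that
      by (simp add: o_def continuous_map_pairwise)
    have hmr: "(\<lambda>f. h (f, x)) \<in> borel_measurable (borel_of ?P)" if "x \<in> I" for x
      using continuous_map_measurable[OF hcr[OF that]] by (simp add: borel_of_euclidean)
    \<comment> \<open>The mean over the noise at a fixed radius. Subtracting it centres the
      variables to which the strong law is applied.\<close>
    define m where "m x = (\<integral>f. h (f, x) \<partial>\<mu>W)" for x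
    have B': "\<bar>h (f, x)\<bar> \<le> B" if "f \<in> paths T UNIV" "x \<in> I" for f x
      using B that by simp
    have sp\<mu>: "space \<mu>W = paths T UNIV"
      using sets_eq_imp_space_eq[OF \<mu>s] by simp
    have int: "integrable \<mu>W (\<lambda>f. h (f, x))" if "x \<in> I" for x
      using hcr[OF that] B' that by (intro integrable_bounded_continuous[OF \<mu>W.prob_space_axioms \<mu>s]) auto
    have mB: "\<bar>m x\<bar> \<le> B" if "x \<in> I" for x
    proof -
      have "\<bar>m x\<bar> \<le> (\<integral>f. \<bar>h (f, x)\<bar> \<partial>\<mu>W)"
        unfolding m_def by (rule integral_abs_bound)
      also have "\<dots> \<le> (\<integral>f. B \<partial>\<mu>W)"
        using int[OF that] B' that sp\<mu> by (intro integral_mono) auto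
      finally show ?thesis
        by (simp add: \<mu>W.prob_space)
    qed
    define X where "X i w = h (W i w, r i) - m (r i)" for i w
    have mean: "expectation (X i) = 0" for i
    proof -
      have "expectation (\<lambda>w. h (W i w, r i)) = (\<integral>f. h (f, r i) \<partial>distr M (borel_of ?P) (W i))"
        using hmr[OF r] by (intro integral_distr[symmetric]) auto
      also have "\<dots> = m (r i)"
        by (simp add: law m_def)
      finally have *: "expectation (\<lambda>w. h (W i w, r i)) = m (r i)" .
      have "(\<lambda>w. h (W i w, r i)) \<in> borel_measurable M"
        using hmr[OF r] by measurable
      then have "integrable M (\<lambda>w. h (W i w, r i))"
        using B' r Wsp by (intro integrable_const_bound[of _ B]) auto
      then show ?thesis
        unfolding X_def using * by (simp add: prob_space)
    qed
    have "indep_vars (\<lambda>_. borel) X UNIV"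
      unfolding X_def using hmr[OF r]
      by (intro indep_vars_compose2[OF indep, of "\<lambda>i f. h (f, r i) - m (r i)"]) auto
    moreover have "\<bar>X i w\<bar> \<le> 2 * B" if "w \<in> space M" for i w
      using B'[OF Wsp[OF that, of i] r[of i]] mB[OF r[of i]] unfolding X_def by linarith
    ultimately have slln: "AE w in M. (\<lambda>n. (\<Sum>i<n. X i w) / real n) \<longlonglongrightarrow> 0"
      using mean by (rule strong_law_bounded)
    have lim: "(\<lambda>N. (\<Sum>i<N. m (r i)) / real N) \<longlonglongrightarrow> (\<integral>x. h x \<partial>(\<mu>W \<Otimes>\<^sub>M lam))"
    proof -
      \<comment> \<open>The hypothesis on the radii concerns continuous functions, so the mean must
        depend continuously on the radius; dominated convergence with the constant \<open>B\<close>
        gives this.\<close>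
      have mc: "continuous_on I m"
        unfolding continuous_on_sequentially
      proof (intro ballI allI impI, elim conjE)
        fix z x assume x: "x \<in> I" and z: "\<forall>n. z n \<in> I" "z \<longlonglongrightarrow> x"
        show "(m \<circ> z) \<longlonglongrightarrow> m x"
          unfolding m_def o_def
        proof (rule integral_dominated_convergence[where w = "\<lambda>_. B"])
          show "(\<lambda>f. h (f, x)) \<in> borel_measurable \<mu>W" "\<And>n. (\<lambda>f. h (f, z n)) \<in> borel_measurable \<mu>W"
            using hmr x z(1) measurable_cong_sets[OF \<mu>s refl] by blast+
          show "AE f in \<mu>W. (\<lambda>n. h (f, z n)) \<longlonglongrightarrow> h (f, x)"
          proof (rule AE_I2)
            fix f assume "f \<in> space \<mu>W"
            then have "continuous_on I (\<lambda>x. h (f, x))"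
              using hcf sp\<mu> by simp
            then show "(\<lambda>n. h (f, z n)) \<longlonglongrightarrow> h (f, x)"
              using x z unfolding continuous_on_sequentially by (auto simp: o_def)
          qed
          show "AE f in \<mu>W. norm (h (f, z n)) \<le> B" for n
            using B' z(1) sp\<mu> by (intro AE_I2) auto
        qed auto
      qed
      have "(\<lambda>N. \<integral>x. m x \<partial>empirical ?I N r) \<longlonglongrightarrow> (\<integral>x. m x \<partial>lam)"
        using r_lim mc mB unfolding weak_conv_on_def bounded_iff by (auto simp: image_iff)
      moreover have "m \<in> borel_measurable (borel_of ?I)"
        using continuous_map_measurable[of ?I euclideanreal m] mc by (simp add: borel_of_euclidean)
      then have "(\<integral>x. m x \<partial>empirical ?I N r) = (\<Sum>i<N. m (r i)) / real N" for N
        using r by (intro integral_empirical) auto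
      moreover have "(\<integral>x. h x \<partial>(\<mu>W \<Otimes>\<^sub>M lam)) = (\<integral>x. m x \<partial>lam)"
      proof -
        have "integrable (\<mu>W \<Otimes>\<^sub>M lam) h"
          using setsE h B by (rule integrable_bounded_continuous[OF PP.prob_space_axioms])
        then show ?thesis
          unfolding m_def using PP.integral_snd[of "\<lambda>f x. h (f, x)"] by simp
      qed
      ultimately show ?thesis
        by simp
    qed
    from slln AE_space show ?thesis
    proof eventually_elim
      case (elim w)
      have "(\<integral>x. h x \<partial>empirical ?E N (\<lambda>i. (W i w, r i))) = (\<Sum>i<N. X i w) / real N + (\<Sum>i<N. m (r i)) / real N" for N
      proof -
        have "(\<integral>x. h x \<partial>empirical ?E N (\<lambda>i. (W i w, r i))) = (\<Sum>i<N. h (W i w, r i)) / real N"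
          using Wsp[OF elim(2)] r hm by (intro integral_empirical) auto
        also have "(\<Sum>i<N. h (W i w, r i)) = (\<Sum>i<N. X i w) + (\<Sum>i<N. m (r i))"
          by (simp add: X_def sum_subtractf)
        finally show ?thesis
          by (simp add: add_divide_distrib)
      qed
      then show ?case
        using tendsto_add[OF elim(1) lim] by simp
    qed
  qed
  \<comment> \<open>Countability of the test functions yields one exceptional set for all of them,
    which is what weak convergence for fixed \<open>w\<close> requires.\<close>
  have "AE w in M. \<forall>h\<in>test_funs \<Phi>. (\<lambda>N. \<integral>x. h x \<partial>empirical ?E N (\<lambda>i. (W i w, r i))) \<longlonglongrightarrow> (\<integral>x. h x \<partial>(\<mu>W \<Otimes>\<^sub>M lam))"
  proof (subst AE_ball_countable[OF countable_test_funs[OF bump_familyD(1)[OF \<Phi>]]], intro ballI)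
    fix h assume "h \<in> test_funs \<Phi>"
    then obtain hs where hs: "hs \<in> lists ((\<rat> \<inter> {0..}) \<times> \<Phi>)" "h = test_fun hs"
      by (auto simp: test_funs_def)
    show "AE w in M. (\<lambda>N. \<integral>x. h x \<partial>empirical ?E N (\<lambda>i. (W i w, r i))) \<longlonglongrightarrow> (\<integral>x. h x \<partial>(\<mu>W \<Otimes>\<^sub>M lam))"
    proof (rule one)
      show "continuous_map ?E euclideanreal h"
        unfolding hs(2) by (rule continuous_map_test_fun[OF hs(1) bump_familyD(2)[OF \<Phi>]])
      show "\<bar>h x\<bar> \<le> sum_list (map fst hs)" if "x \<in> topspace ?E" for x
        unfolding hs(2) using test_fun_nonneg[of hs x] test_fun_bounded[OF hs(1), of x] bump_familyD(3)[OF \<Phi> _ that]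
        by auto
    qed
  qed
  then show ?thesis
    using AE_space
  proof eventually_elim
    case (elim w)
    show ?case
      using elim(1) Wsp[OF elim(2)] r setsE PP.prob_space_axioms
      by (intro weak_conv_onI_bump[OF \<Phi>] prob_space_empirical) auto
  qed
qed

section \<open>Stability and Picard iteration\<close>

lemma set_integrable_continuous:
  fixes f :: "real \<Rightarrow> real"
  assumes "continuous_on {0..T} f" "t \<le> T"
  shows "set_integrable lborel {0..t} f"
  using assms by (intro borel_integrable_atLeastAtMost') (auto elim!: continuous_on_subset)

lemma continuous_primitive:
  fixes f :: "real \<Rightarrow> real"
  assumes f: "continuous_on {0..T} f"
  shows "continuous_on {0..T} (\<lambda>t. LINT s:{0..t}|lborel. f s)"
proof -
  have "continuous_on {0..T} (\<lambda>t. integral {0..t} f)"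
    using f by (intro indefinite_integral_continuous_1 integrable_continuous_real)
  moreover have "(LINT s:{0..t}|lborel. f s) = integral {0..t} f" if "t \<in> {0..T}" for t
    using that by (intro set_borel_integral_eq_integral set_integrable_continuous[OF f]) auto
  ultimately show ?thesis
    by (subst continuous_on_cong[OF refl, of _ _ "\<lambda>t. integral {0..t} f"]) auto
qed

lemma primitive_at_0: "(LINT s:{0::real}|lborel. f s) = (0::real)"
proof -
  have "AE s in lborel. indicator {0::real} s *\<^sub>R f s = (0::real)"
    using AE_lborel_singleton[of "0::real"] by eventually_elim (auto simp: indicator_def)
  then show ?thesis
    unfolding set_lebesgue_integral_def by (rule integral_eq_zero_AE)
qed

lemma primitive_diff_le:
  fixes f g h :: "real \<Rightarrow> real"
  assumes f: "continuous_on {0..T} f" and g: "continuous_on {0..T} g" and h: "continuous_on {0..T} h"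
    and le: "\<And>s. s \<in> {0..t} \<Longrightarrow> \<bar>f s - g s\<bar> \<le> h s" and t: "t \<in> {0..T}"
  shows "\<bar>(LINT s:{0..t}|lborel. f s) - (LINT s:{0..t}|lborel. g s)\<bar> \<le> (LINT s:{0..t}|lborel. h s)"
proof -
  have int: "set_integrable lborel {0..t} f" "set_integrable lborel {0..t} g" "set_integrable lborel {0..t} h"
    "set_integrable lborel {0..t} (\<lambda>s. f s - g s)" "set_integrable lborel {0..t} (\<lambda>s. \<bar>f s - g s\<bar>)"
    using t by (auto intro!: set_integrable_continuous continuous_intros f g h)
  have "\<bar>(LINT s:{0..t}|lborel. f s) - (LINT s:{0..t}|lborel. g s)\<bar> = \<bar>LINT s:{0..t}|lborel. f s - g s\<bar>"
    by (simp add: set_integral_diff(2)[OF int(1,2)])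
  also have "\<dots> \<le> (LINT s:{0..t}|lborel. \<bar>f s - g s\<bar>)"
    using set_integral_norm_bound[OF int(4)] by simp
  also have "\<dots> \<le> (LINT s:{0..t}|lborel. h s)"
    using int(5,3) le by (rule set_integral_mono)
  finally show ?thesis .
qed

lemma integral_exp_le:
  fixes c t S :: real
  assumes "0 < c" "0 \<le> t" "0 \<le> S"
  shows "(LINT s:{0..t}|lborel. S * exp (c * s)) \<le> S * exp (c * t) / c"
proof -
  have "(LINT s:{0..t}|lborel. S * exp (c * s)) = S * exp (c * t) / c - S * exp (c * 0) / c"
    unfolding set_lebesgue_integral_def
  proof (rule integral_FTC_atLeastAtMost[where F = "\<lambda>s. S * exp (c * s) / c"])
    show "((\<lambda>s. S * exp (c * s) / c) has_vector_derivative S * exp (c * x)) (at x within {0..t})" for x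
      using assms(1) by (auto intro!: derivative_eq_intros simp: has_real_derivative_iff_has_vector_derivative[symmetric])
  qed (use assms in \<open>auto intro!: continuous_intros\<close>)
  then show ?thesis
    using assms by simp
qed

text \<open>The pushing terms are as close as the driving paths. The reflected path is the
  difference of the two, hence the factor 2.\<close>

lemma reflected_equation_compare:
  assumes "reflected_equation T a b z x k" "reflected_equation T a b' z' x' k'"
    and "x \<in> paths T {0..1}" "x' \<in> paths T {0..1}" "k \<in> paths T UNIV" "k' \<in> paths T UNIV"
    and t: "t \<in> {0..T}"
    and le: "\<And>s. s \<in> {0..t} \<Longrightarrow> \<bar>(LINT u:{0..s}|lborel. b u) - (LINT u:{0..s}|lborel. b' u)\<bar> + \<bar>z s - z' s\<bar> \<le> d"
  shows "\<bar>k t - k' t\<bar> \<le> d" "\<bar>x t - x' t\<bar> \<le> 2 * d"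
proof -
  note R = reflected_equation_imp_skorokhod[OF assms(1) pathsD(3,4)[OF assms(3)] pathsD(3)[OF assms(5)]]
    and R' = reflected_equation_imp_skorokhod[OF assms(2) pathsD(3,4)[OF assms(4)] pathsD(3)[OF assms(6)]]
  show k: "\<bar>k t - k' t\<bar> \<le> d"
  proof (rule skorokhod_compare[OF R(1) R'(1) t])
    show "\<bar>(a + (LINT s:{0..s}|lborel. b s) + z s) - (a + (LINT s:{0..s}|lborel. b' s) + z' s)\<bar> \<le> d"
      if "s \<in> {0..t}" for s
      using le[OF that] by linarith
  qed
  show "\<bar>x t - x' t\<bar> \<le> 2 * d"
    using R(2)[OF t] R'(2)[OF t] k le[of t] t by auto
qed

text \<open>Gronwall's lemma by weights: measured against \<open>exp (4 L t)\<close>, the supremum \<open>S\<close> of the distances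
  of two solutions satisfies \<open>S \<le> S / 2 + 2 (\<eta> + \<zeta>)\<close>.\<close>

lemma reflected_stability:
  fixes x x' k k' b b' z z' :: "'i \<Rightarrow> real \<Rightarrow> real"
  assumes T: "0 < T" and L: "0 < L"
    and eq: "\<And>i. i \<in> D \<Longrightarrow> reflected_equation T a (b i) (z i) (x i) (k i)"
      "\<And>i. i \<in> D \<Longrightarrow> reflected_equation T a (b' i) (z' i) (x' i) (k' i)"
    and x: "\<And>i. i \<in> D \<Longrightarrow> x i \<in> paths T {0..1}" "\<And>i. i \<in> D \<Longrightarrow> x' i \<in> paths T {0..1}"
    and k: "\<And>i. i \<in> D \<Longrightarrow> k i \<in> paths T UNIV" "\<And>i. i \<in> D \<Longrightarrow> k' i \<in> paths T UNIV"
    and b: "\<And>i. i \<in> D \<Longrightarrow> continuous_on {0..T} (b i)" "\<And>i. i \<in> D \<Longrightarrow> continuous_on {0..T} (b' i)"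
    and z: "\<And>i s. i \<in> D \<Longrightarrow> s \<in> {0..T} \<Longrightarrow> \<bar>z i s - z' i s\<bar> \<le> \<zeta>"
    and close: "\<And>s e i. s \<in> {0..T} \<Longrightarrow> 0 \<le> e \<Longrightarrow> (\<And>j. j \<in> D \<Longrightarrow> \<bar>x j s - x' j s\<bar> \<le> e) \<Longrightarrow> i \<in> D \<Longrightarrow>
      \<bar>b i s - b' i s\<bar> \<le> L * e + \<epsilon> s"
    and \<epsilon>: "continuous_on {0..T} \<epsilon>" "\<And>s. s \<in> {0..T} \<Longrightarrow> 0 \<le> \<epsilon> s"
    and \<eta>: "(LINT s:{0..T}|lborel. \<epsilon> s) \<le> \<eta>"
    and it: "i \<in> D" "t \<in> {0..T}"
  shows "\<bar>x i t - x' i t\<bar> \<le> 4 * exp (4 * L * T) * (\<eta> + \<zeta>)" "\<bar>k i t - k' i t\<bar> \<le> 4 * exp (4 * L * T) * (\<eta> + \<zeta>)"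
proof -
  \<comment> \<open>With this rate the integral of \<open>L * S * exp (c * s)\<close> is at most
    \<open>S * exp (c * t) / 4\<close>; the factor 2 from drivers to reflected paths then leaves
    \<open>S / 2\<close>, which can be absorbed.\<close>
  define c where "c = 4 * L"
  have c: "0 < c" using L by (simp add: c_def)
  define S where "S = (SUP (i, t)\<in>D \<times> {0..T}. \<bar>x i t - x' i t\<bar> * exp (- c * t))"
  have le1: "\<bar>x i t - x' i t\<bar> \<le> 1" if "i \<in> D" "t \<in> {0..T}" for i t
    using pathsD(2)[OF x(1)[OF that(1)] that(2)] pathsD(2)[OF x(2)[OF that(1)] that(2)] by auto
  \<comment> \<open>Absorbing \<open>S / 2\<close> requires a finite supremum even over an infinite
    index set; it is finite because all paths take values in \<open>[0,1]\<close>.\<close>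
  have bdd: "bdd_above ((\<lambda>(i, t). \<bar>x i t - x' i t\<bar> * exp (- c * t)) ` (D \<times> {0..T}))"
  proof (rule bdd_aboveI2)
    fix p assume p: "p \<in> D \<times> {0..T}"
    then have "\<bar>x (fst p) (snd p) - x' (fst p) (snd p)\<bar> * exp (- c * snd p) \<le> 1 * 1"
      using le1[of "fst p" "snd p"] c by (intro mult_mono) (auto simp: mem_Times_iff)
    then show "(case p of (i, t) \<Rightarrow> \<bar>x i t - x' i t\<bar> * exp (- c * t)) \<le> 1"
      by (simp add: case_prod_beta')
  qed
  have S: "\<bar>x i t - x' i t\<bar> \<le> S * exp (c * t)" if "i \<in> D" "t \<in> {0..T}" for i t
  proof -
    have "\<bar>x i t - x' i t\<bar> * exp (- c * t) \<le> S"
      unfolding S_def using cSUP_upper[OF _ bdd, of "(i, t)"] that by simp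
    then have "\<bar>x i t - x' i t\<bar> * exp (- c * t) * exp (c * t) \<le> S * exp (c * t)"
      by (intro mult_right_mono) auto
    then show ?thesis
      by (simp add: mult.assoc exp_add[symmetric])
  qed
  have S0: "0 \<le> S"
  proof -
    have "0 \<le> S * exp (c * t)"
      using S[OF it] by (meson abs_ge_zero order_trans)
    then show ?thesis
      by (simp add: zero_le_mult_iff)
  qed
  have \<eta>0: "0 \<le> \<eta>"
  proof -
    have "0 \<le> (LINT s:{0..T}|lborel. \<epsilon> s)"
      unfolding set_lebesgue_integral_def using \<epsilon>(2)
      by (intro integral_nonneg_AE AE_I2) (auto simp: indicator_def)
    then show ?thesis using \<eta> by simp
  qed
  have \<zeta>0: "0 \<le> \<zeta>"
    using z[OF it] by (meson abs_ge_zero order_trans)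
  have prim: "\<bar>(LINT u:{0..s}|lborel. b i u) - (LINT u:{0..s}|lborel. b' i u)\<bar> + \<bar>z i s - z' i s\<bar>
      \<le> S * exp (c * t) / 4 + (\<eta> + \<zeta>)" if i: "i \<in> D" and t: "t \<in> {0..T}" and s: "s \<in> {0..t}" for i s t
  proof -
    have sT: "s \<in> {0..T}" using s t by auto
    have ce: "continuous_on {0..T} (\<lambda>u. (L * S) * exp (c * u))"
      by (intro continuous_intros)
    have bound: "\<bar>b i u - b' i u\<bar> \<le> (L * S) * exp (c * u) + \<epsilon> u" if u: "u \<in> {0..s}" for u
    proof -
      have uT: "u \<in> {0..T}" using u sT by auto
      show ?thesis
        using close[OF uT _ S[OF _ uT] i] S0 by (simp add: mult.assoc)
    qed
    have "\<bar>(LINT u:{0..s}|lborel. b i u) - (LINT u:{0..s}|lborel. b' i u)\<bar>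
        \<le> (LINT u:{0..s}|lborel. (L * S) * exp (c * u) + \<epsilon> u)"
      by (rule primitive_diff_le[OF b(1)[OF i] b(2)[OF i] continuous_on_add[OF ce \<epsilon>(1)] bound sT])
    also have "\<dots> = (LINT u:{0..s}|lborel. (L * S) * exp (c * u)) + (LINT u:{0..s}|lborel. \<epsilon> u)"
      using sT by (intro set_integral_add(2) set_integrable_continuous[OF ce] set_integrable_continuous[OF \<epsilon>(1)]) auto
    also have "(LINT u:{0..s}|lborel. (L * S) * exp (c * u)) \<le> (L * S) * exp (c * s) / c"
      using c L S0 s by (intro integral_exp_le) auto
    also have "\<dots> = S * exp (c * s) / 4"
      using L by (simp add: c_def)
    also have "\<dots> \<le> S * exp (c * t) / 4"
      using S0 s c by (intro divide_right_mono mult_left_mono) auto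
    also have "(LINT u:{0..s}|lborel. \<epsilon> u) \<le> (LINT u:{0..T}|lborel. \<epsilon> u)"
      unfolding set_lebesgue_integral_def
    proof (rule integral_mono)
      show "integrable lborel (\<lambda>u. indicator {0..s} u *\<^sub>R \<epsilon> u)" "integrable lborel (\<lambda>u. indicator {0..T} u *\<^sub>R \<epsilon> u)"
        using set_integrable_continuous[OF \<epsilon>(1), of s] set_integrable_continuous[OF \<epsilon>(1), of T] sT
        by (auto simp: set_integrable_def)
      show "indicator {0..s} u *\<^sub>R \<epsilon> u \<le> indicator {0..T} u *\<^sub>R \<epsilon> u" for u
        using \<epsilon>(2)[of u] sT by (auto simp: indicator_def)
    qed
    finally show ?thesis
      using \<eta> z[OF i sT] by linarith
  qed
  note cmp = reflected_equation_compare[OF eq(1) eq(2) x(1) x(2) k(1) k(2) _ prim]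
  have "S \<le> S / 2 + 2 * (\<eta> + \<zeta>)"
    unfolding S_def
  proof (rule cSUP_least, safe)
    show "D \<times> {0..T} = {} \<Longrightarrow> False"
      using it by auto
    fix i t assume i: "i \<in> D" and t: "t \<in> {0..T}"
    have "\<bar>x i t - x' i t\<bar> \<le> 2 * (S * exp (c * t) / 4 + (\<eta> + \<zeta>))"
      using cmp(2)[OF i i i i i i t i t] by simp
    then have "\<bar>x i t - x' i t\<bar> * exp (- c * t) \<le> 2 * (S * exp (c * t) / 4 + (\<eta> + \<zeta>)) * exp (- c * t)"
      by (intro mult_right_mono) auto
    also have "\<dots> = S / 2 * (exp (c * t) * exp (- c * t)) + 2 * (\<eta> + \<zeta>) * exp (- c * t)"
      by (simp add: algebra_simps)
    also have "exp (c * t) * exp (- c * t) = 1"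
      by (simp add: exp_add[symmetric])
    also have "2 * (\<eta> + \<zeta>) * exp (- c * t) \<le> 2 * (\<eta> + \<zeta>) * 1"
      using \<eta>0 \<zeta>0 c t by (intro mult_left_mono) auto
    finally show "\<bar>x i t - x' i t\<bar> * exp (- c * t) \<le> (SUP (i, t)\<in>D \<times> {0..T}. \<bar>x i t - x' i t\<bar> * exp (- c * t)) / 2 + 2 * (\<eta> + \<zeta>)"
      unfolding S_def[symmetric] by simp
  qed
  then have S4: "S \<le> 4 * (\<eta> + \<zeta>)"
    by simp
  have "S * exp (c * t) \<le> 4 * (\<eta> + \<zeta>) * exp (c * T)"
    using S4 S0 \<eta>0 \<zeta>0 c it by (intro mult_mono) auto
  then have St: "S * exp (c * t) \<le> 4 * exp (4 * L * T) * (\<eta> + \<zeta>)"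
    by (simp add: c_def algebra_simps)
  then show "\<bar>x i t - x' i t\<bar> \<le> 4 * exp (4 * L * T) * (\<eta> + \<zeta>)"
    using S[OF it] by linarith
  \<comment> \<open>The pushing terms differ by at most
    \<open>S * exp (c * t) / 4 + (\<eta> + \<zeta>)\<close>, and each of the two summands is below
    \<open>exp (4 * L * T) * (\<eta> + \<zeta>)\<close>. The constant 4 of the reflected paths is
    kept for uniformity.\<close>
  have "1 * (\<eta> + \<zeta>) \<le> exp (4 * L * T) * (\<eta> + \<zeta>)"
    using \<eta>0 \<zeta>0 L T by (intro mult_right_mono) auto
  moreover have "\<bar>k i t - k' i t\<bar> \<le> S * exp (c * t) / 4 + (\<eta> + \<zeta>)"
    using cmp(1)[OF it(1) it(1) it(1) it(1) it(1) it(1) it(2) it] by simp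
  moreover have "S * exp (c * t) / 4 \<le> exp (4 * L * T) * (\<eta> + \<zeta>)"
    using St by simp
  moreover have "0 \<le> exp (4 * L * T) * (\<eta> + \<zeta>)"
    using \<eta>0 \<zeta>0 by simp
  ultimately have "\<bar>k i t - k' i t\<bar> \<le> 4 * (exp (4 * L * T) * (\<eta> + \<zeta>))"
    by (simp only: mult_1_left)
  then show "\<bar>k i t - k' i t\<bar> \<le> 4 * exp (4 * L * T) * (\<eta> + \<zeta>)"
    by (simp only: mult.assoc)
qed

section \<open>The reflection map and measurability of time integrals\<close>

definition reflector :: "real \<Rightarrow> real \<Rightarrow> (real \<Rightarrow> real) \<Rightarrow> real \<Rightarrow> real" where
  "reflector T a y = restrict (SOME k. skorokhod T (\<lambda>t. y t - y 0 + a) k) {0..T}"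

lemma skorokhod_cong:
  assumes "skorokhod T y k" "\<And>t. t \<in> {0..T} \<Longrightarrow> y' t = y t" "\<And>t. t \<in> {0..T} \<Longrightarrow> k' t = k t" "0 \<le> T"
  shows "skorokhod T y' k'"
proof -
  have "continuous_on {0..T} k'"
    using assms(1,3) by (subst continuous_on_cong[OF refl, of _ k' k]) (auto simp: skorokhod_def skorokhod_on_def)
  moreover have "k' s \<le> k' t" if st: "0 \<le> s" "s \<le> t" "t \<le> T" "\<forall>u\<in>{s<..t}. 0 < y' u - k' u" for s t
  proof -
    have "\<forall>u\<in>{s<..t}. 0 < y u - k u"
      using assms(2,3) st by force
    then have "k s \<le> k t"
      using assms(1) st unfolding skorokhod_def skorokhod_on_def by blast
    then show ?thesis
      using assms(3) st by simp
  qed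
  moreover have "k' t \<le> k' s" if st: "0 \<le> s" "s \<le> t" "t \<le> T" "\<forall>u\<in>{s<..t}. y' u - k' u < 1" for s t
  proof -
    have "\<forall>u\<in>{s<..t}. y u - k u < 1"
      using assms(2,3) st by force
    then have "k t \<le> k s"
      using assms(1) st unfolding skorokhod_def skorokhod_on_def by blast
    then show ?thesis
      using assms(3) st by simp
  qed
  moreover have "\<forall>t\<in>{0..T}. y' t - k' t \<in> {0..1}" "k' 0 = 0"
    using assms by (auto simp: skorokhod_def skorokhod_on_def)
  ultimately show ?thesis
    unfolding skorokhod_def skorokhod_on_def by blast
qed

lemma reflector_skorokhod:
  assumes T: "0 < T" and a: "a \<in> {0..1}" and y: "continuous_on {0..T} y"
  shows "skorokhod T (\<lambda>t. y t - y 0 + a) (reflector T a y)" "reflector T a y \<in> paths T UNIV"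
proof -
  have "\<exists>k. skorokhod T (\<lambda>t. y t - y 0 + a) k"
    using T a y by (intro skorokhod_exists continuous_intros) auto
  then have "skorokhod T (\<lambda>t. y t - y 0 + a) (SOME k. skorokhod T (\<lambda>t. y t - y 0 + a) k)"
    by (rule someI_ex)
  then show *: "skorokhod T (\<lambda>t. y t - y 0 + a) (reflector T a y)"
    by (rule skorokhod_cong) (use T in \<open>auto simp: reflector_def\<close>)
  show "reflector T a y \<in> paths T UNIV"
    using * by (auto simp: paths_def reflector_def skorokhod_def skorokhod_on_def)
qed

text \<open>The shift \<open>y - y 0 + a\<close> makes \<open>reflector\<close> meaningful for every
  continuous path, whatever its starting point, and it is the source of the factor 2. For paths
  starting at \<open>a\<close> the shift does nothing.\<close>

lemma reflector_Lipschitz: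
  assumes T: "0 < T" and a: "a \<in> {0..1}" and y: "continuous_on {0..T} y" "continuous_on {0..T} y'"
    and t: "t \<in> {0..T}" and d: "\<And>s. s \<in> {0..t} \<Longrightarrow> \<bar>y s - y' s\<bar> \<le> d"
  shows "\<bar>reflector T a y t - reflector T a y' t\<bar> \<le> 2 * d"
proof (rule skorokhod_compare[OF reflector_skorokhod(1)[OF T a y(1)] reflector_skorokhod(1)[OF T a y(2)] t])
  show "\<bar>(y s - y 0 + a) - (y' s - y' 0 + a)\<bar> \<le> 2 * d" if "s \<in> {0..t}" for s
    using d[OF that] d[of 0] t by auto
qed

text \<open>Measurability comes from continuity for the supremum distance. The choice operator in
  \<open>reflector\<close> does no harm because the Lipschitz estimate holds for any solutions of
  the two Skorokhod problems.\<close>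

lemma measurable_reflector:
  assumes T: "0 < T" and a: "a \<in> {0..1}" and y: "y \<in> N \<rightarrow>\<^sub>M borel_of (path_space T UNIV)"
  shows "(\<lambda>w. reflector T a (y w)) \<in> N \<rightarrow>\<^sub>M borel_of (path_space T UNIV)"
proof -
  have T0: "0 \<le> T" using T by simp
  have "continuous_map (path_space T UNIV) (path_space T UNIV) (reflector T a)"
  proof (rule continuous_map_into_path_space[OF T0])
    show "reflector T a y \<in> paths T UNIV" if "y \<in> topspace (path_space T UNIV)" for y
      using that by (intro reflector_skorokhod(2)[OF T a] pathsD(3)) auto
    fix y and e :: real assume y: "y \<in> topspace (path_space T UNIV)" and e: "0 < e"
    then have yc: "continuous_on {0..T} y" and yp: "y \<in> paths T UNIV"
      by (auto intro: pathsD(3))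
    show "\<exists>U. openin (path_space T UNIV) U \<and> y \<in> U \<and> (\<forall>q\<in>U. \<forall>t\<in>{0..T}. \<bar>reflector T a q t - reflector T a y t\<bar> \<le> e)"
    proof (intro exI[of _ "{f \<in> paths T UNIV. sup_dist T f y < e/2}"] conjI ballI)
      show "openin (path_space T UNIV) {f \<in> paths T UNIV. sup_dist T f y < e/2}"
        by (rule openin_path_ball[OF T0 yc])
      have "sup_dist T y y \<le> 0"
        by (rule sup_dist_least[OF T0 yc yc]) simp
      then show "y \<in> {f \<in> paths T UNIV. sup_dist T f y < e/2}"
        using yp e by simp
      fix q t assume q: "q \<in> {f \<in> paths T UNIV. sup_dist T f y < e/2}" and t: "t \<in> {0..T}"
      then have qc: "continuous_on {0..T} q"
        by (auto intro: pathsD(3))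
      have "\<bar>q s - y s\<bar> \<le> e/2" if "s \<in> {0..t}" for s
        using sup_dist_upper[OF T0 qc yc, of s] q t that by auto
      then show "\<bar>reflector T a q t - reflector T a y t\<bar> \<le> e"
        using reflector_Lipschitz[OF T a qc yc t, of "e/2"] by simp
    qed
  qed
  then show ?thesis
    by (rule measurable_compose[OF y continuous_map_measurable])
qed

text \<open>A function continuous in time and measurable in \<open>w\<close> is jointly measurable,
  as a limit of functions that are piecewise constant in time; integrating out the time then
  preserves measurability.\<close>

lemma measurable_primitive:
  fixes f :: "real \<Rightarrow> 'a \<Rightarrow> real"
  assumes T: "0 < T" and c: "\<And>w. w \<in> space N \<Longrightarrow> continuous_on {0..T} (\<lambda>s. f s w)"
    and m: "\<And>s. s \<in> {0..T} \<Longrightarrow> f s \<in> borel_measurable N" and t: "t \<in> {0..T}"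
  shows "(\<lambda>w. LINT s:{0..t}|lborel. f s w) \<in> borel_measurable N"
proof -
  \<comment> \<open>Time rounded down to a multiple of \<open>1 / Suc n\<close> and clamped to
    \<open>[0,T]\<close>, where \<open>f\<close> is known to be measurable. The integer part takes
    countably many values.\<close>
  define d where "d n s = max 0 (min T (of_int \<lfloor>real (Suc n) * s\<rfloor> / real (Suc n)))" for n s
  have dT: "d n s \<in> {0..T}" for n s
    using T by (auto simp: d_def)
  have dl: "(\<lambda>n. d n s) \<longlonglongrightarrow> s" if s: "s \<in> {0..T}" for s
  proof -
    have "(\<lambda>n. of_int \<lfloor>real (Suc n) * s\<rfloor> / real (Suc n)) \<longlonglongrightarrow> s"
    proof (rule tendsto_sandwich[where f = "\<lambda>n. s - 1 / real (Suc n)" and h = "\<lambda>n. s"])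
      show "\<forall>\<^sub>F n in sequentially. s - 1 / real (Suc n) \<le> of_int \<lfloor>real (Suc n) * s\<rfloor> / real (Suc n)"
      proof (rule always_eventually, rule allI)
        fix n
        have "real (Suc n) * s - 1 \<le> of_int \<lfloor>real (Suc n) * s\<rfloor>"
          by linarith
        then have "(real (Suc n) * s - 1) / real (Suc n) \<le> of_int \<lfloor>real (Suc n) * s\<rfloor> / real (Suc n)"
          by (intro divide_right_mono) auto
        then show "s - 1 / real (Suc n) \<le> of_int \<lfloor>real (Suc n) * s\<rfloor> / real (Suc n)"
          by (simp add: diff_divide_distrib)
      qed
      show "\<forall>\<^sub>F n in sequentially. of_int \<lfloor>real (Suc n) * s\<rfloor> / real (Suc n) \<le> s"
      proof (rule always_eventually, rule allI)
        fix n
        have "of_int \<lfloor>real (Suc n) * s\<rfloor> \<le> real (Suc n) * s"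
          by linarith
        then have "of_int \<lfloor>real (Suc n) * s\<rfloor> / real (Suc n) \<le> (real (Suc n) * s) / real (Suc n)"
          by (intro divide_right_mono) auto
        then show "of_int \<lfloor>real (Suc n) * s\<rfloor> / real (Suc n) \<le> s"
          by simp
      qed
      show "(\<lambda>n. s - 1 / real (Suc n)) \<longlonglongrightarrow> s"
        using tendsto_diff[OF tendsto_const[of s] LIMSEQ_inverse_real_of_nat] by (simp add: inverse_eq_divide)
    qed simp
    then have "(\<lambda>n. max 0 (min T (of_int \<lfloor>real (Suc n) * s\<rfloor> / real (Suc n)))) \<longlonglongrightarrow> max 0 (min T s)"
      by (intro tendsto_intros)
    then show ?thesis
      using s by (simp add: d_def)
  qed
  define g where "g n w s = indicator {0..t} s * f (d n s) w" for n w s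
  have gm: "(\<lambda>(w, s). g n w s) \<in> borel_measurable (N \<Otimes>\<^sub>M lborel)" for n
  proof -
    have "(\<lambda>p. f (max 0 (min T (of_int \<lfloor>real (Suc n) * snd p\<rfloor> / real (Suc n)))) (fst p)) \<in> borel_measurable (N \<Otimes>\<^sub>M lborel)"
    proof (rule measurable_compose_countable[where f = "\<lambda>i p. f (max 0 (min T (of_int i / real (Suc n)))) (fst p)"])
      fix i :: int
      have "f (max 0 (min T (of_int i / real (Suc n)))) \<in> borel_measurable N"
        using T by (intro m) auto
      then show "(\<lambda>p. f (max 0 (min T (of_int i / real (Suc n)))) (fst p)) \<in> borel_measurable (N \<Otimes>\<^sub>M lborel)"
        by measurable
    qed measurable
    then show ?thesis
      unfolding g_def d_def case_prod_beta' by measurable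
  qed
  have "(\<lambda>(w, s). indicator {0..t} s * f s w) \<in> borel_measurable (N \<Otimes>\<^sub>M lborel)"
  proof (rule borel_measurable_LIMSEQ_real[where u = "\<lambda>n (w, s). g n w s"])
    fix p assume p: "p \<in> space (N \<Otimes>\<^sub>M (lborel :: real measure))"
    obtain w s where ws: "p = (w, s)" by (cases p)
    show "(\<lambda>n. case p of (w, s) \<Rightarrow> g n w s) \<longlonglongrightarrow> (case p of (w, s) \<Rightarrow> indicator {0..t} s * f s w)"
    proof (cases "s \<in> {0..t}")
      case True
      then have s: "s \<in> {0..T}" using t by auto
      have "continuous_on {0..T} (\<lambda>s. f s w)"
        using p ws by (intro c) (auto simp: space_pair_measure)
      then have "(\<lambda>n. f (d n s) w) \<longlonglongrightarrow> f s w"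
        using dl[OF s] dT s unfolding continuous_on_sequentially by (auto simp: o_def)
      then show ?thesis
        using True by (simp add: ws g_def)
    qed (simp add: ws g_def)
  qed (rule gm)
  then show ?thesis
    unfolding set_lebesgue_integral_def by (intro lborel.borel_measurable_lebesgue_integral) simp
qed

section \<open>Picard iteration for interacting components\<close>

definition process :: "real \<Rightarrow> 't measure \<Rightarrow> ('t \<Rightarrow> real \<Rightarrow> real) \<Rightarrow> bool" where
  "process T N X \<longleftrightarrow> X \<in> N \<rightarrow>\<^sub>M borel_of (path_space T {0..1})"

lemma processD:
  assumes "process T N X"
  shows "\<And>\<theta>. \<theta> \<in> space N \<Longrightarrow> X \<theta> \<in> paths T {0..1}"
    and "\<And>t. t \<in> {0..T} \<Longrightarrow> (\<lambda>\<theta>. X \<theta> t) \<in> borel_measurable N"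
proof -
  have X: "X \<in> N \<rightarrow>\<^sub>M borel_of (path_space T {0..1})"
    using assms by (simp add: process_def)
  show "\<And>\<theta>. \<theta> \<in> space N \<Longrightarrow> X \<theta> \<in> paths T {0..1}"
    using measurable_space[OF X] by simp
  show "(\<lambda>\<theta>. X \<theta> t) \<in> borel_measurable N" if "t \<in> {0..T}" for t
    using that by (intro measurable_path_eval[OF _ that X]) auto
qed

text \<open>The drift \<open>b s \<xi> \<theta>\<close> of the component \<open>\<theta>\<close> at time \<open>s\<close> depends on the configuration \<open>\<xi>\<close> of all
  components at that time. Components are pairs of a particle and a sample point for the particle
  system and sample points for the limit equation.\<close>

locale interacting_drift =
  fixes T a C :: real and N :: "'t measure" and z :: "'t \<Rightarrow> real \<Rightarrow> real"
    and b :: "real \<Rightarrow> ('t \<Rightarrow> real) \<Rightarrow> 't \<Rightarrow> real"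
  assumes T: "0 < T" and a: "a \<in> {0..1}" and C: "0 < C"
    and z: "z \<in> N \<rightarrow>\<^sub>M borel_of (path_space T UNIV)" and z0: "\<And>\<theta>. \<theta> \<in> space N \<Longrightarrow> z \<theta> 0 = 0"
    and b_cont: "\<And>X \<theta>. process T N X \<Longrightarrow> \<theta> \<in> space N \<Longrightarrow> continuous_on {0..T} (\<lambda>s. b s (\<lambda>\<theta>'. X \<theta>' s) \<theta>)"
    and b_meas: "\<And>X s. process T N X \<Longrightarrow> s \<in> {0..T} \<Longrightarrow> b s (\<lambda>\<theta>'. X \<theta>' s) \<in> borel_measurable N"
    and b_Lip: "\<And>X X' s e \<theta>. process T N X \<Longrightarrow> process T N X' \<Longrightarrow> s \<in> {0..T} \<Longrightarrow>
      (\<And>\<theta>'. \<theta>' \<in> space N \<Longrightarrow> \<bar>X \<theta>' s - X' \<theta>' s\<bar> \<le> e) \<Longrightarrow> \<theta> \<in> space N \<Longrightarrow>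
      \<bar>b s (\<lambda>\<theta>'. X \<theta>' s) \<theta> - b s (\<lambda>\<theta>'. X' \<theta>' s) \<theta>\<bar> \<le> C * e"
begin

lemma T0: "0 \<le> T" using T by simp

lemma zD: "\<theta> \<in> space N \<Longrightarrow> z \<theta> \<in> paths T UNIV"
  using measurable_space[OF z] by simp

definition driver :: "('t \<Rightarrow> real \<Rightarrow> real) \<Rightarrow> 't \<Rightarrow> real \<Rightarrow> real" where
  "driver X \<theta> = (\<lambda>t\<in>{0..T}. a + (LINT s:{0..t}|lborel. b s (\<lambda>\<theta>'. X \<theta>' s) \<theta>) + z \<theta> t)"

definition pushed :: "('t \<Rightarrow> real \<Rightarrow> real) \<Rightarrow> 't \<Rightarrow> real \<Rightarrow> real" where
  "pushed X \<theta> = (\<lambda>t\<in>{0..T}. driver X \<theta> t - reflector T a (driver X \<theta>) t)"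

lemma driver:
  assumes X: "process T N X"
  shows "\<theta> \<in> space N \<Longrightarrow> driver X \<theta> \<in> paths T UNIV" "\<theta> \<in> space N \<Longrightarrow> driver X \<theta> 0 = a"
    "driver X \<in> N \<rightarrow>\<^sub>M borel_of (path_space T UNIV)"
proof -
  show *: "driver X \<theta> \<in> paths T UNIV" if "\<theta> \<in> space N" for \<theta>
  proof -
    have "continuous_on {0..T} (\<lambda>t. a + (LINT s:{0..t}|lborel. b s (\<lambda>\<theta>'. X \<theta>' s) \<theta>) + z \<theta> t)"
      using that by (intro continuous_on_add continuous_on_const continuous_primitive b_cont[OF X] pathsD(3)[OF zD])
    then show ?thesis
      unfolding driver_def by (rule restrict_in_paths) simp
  qed
  show "driver X \<theta> 0 = a" if "\<theta> \<in> space N"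
    using T0 z0[OF that] by (simp add: driver_def primitive_at_0)
  show "driver X \<in> N \<rightarrow>\<^sub>M borel_of (path_space T UNIV)"
  proof (rule measurable_into_path_space[OF T *])
    fix t assume t: "t \<in> {0..T}"
    have "(\<lambda>\<theta>. a + (LINT s:{0..t}|lborel. b s (\<lambda>\<theta>'. X \<theta>' s) \<theta>) + z \<theta> t) \<in> borel_measurable N"
      by (intro borel_measurable_add borel_measurable_const measurable_primitive[OF T b_cont[OF X] b_meas[OF X] t]
          measurable_path_eval[OF T0 t z])
    then show "(\<lambda>\<theta>. driver X \<theta> t) \<in> borel_measurable N"
      using t by (simp add: driver_def)
  qed
qed

lemma driver_skorokhod:
  assumes X: "process T N X" and \<theta>: "\<theta> \<in> space N"
  shows "skorokhod T (driver X \<theta>) (reflector T a (driver X \<theta>))"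
  using reflector_skorokhod(1)[OF T a pathsD(3)[OF driver(1)[OF X \<theta>]]] driver(2)[OF X \<theta>] by simp

lemma measurable_driver_reflector:
  assumes X: "process T N X"
  shows "(\<lambda>\<theta>. reflector T a (driver X \<theta>)) \<in> N \<rightarrow>\<^sub>M borel_of (path_space T UNIV)"
  by (rule measurable_reflector[OF T a driver(3)[OF X]])

lemma process_pushed:
  assumes X: "process T N X"
  shows "process T N (pushed X)"
  unfolding process_def
proof (rule measurable_into_path_space[OF T])
  fix \<theta> assume \<theta>: "\<theta> \<in> space N"
  have sk: "skorokhod_on 0 T (driver X \<theta>) (reflector T a (driver X \<theta>))"
    using driver_skorokhod[OF X \<theta>] by (simp add: skorokhod_def)
  have "continuous_on {0..T} (\<lambda>t. driver X \<theta> t - reflector T a (driver X \<theta>) t)"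
    by (intro continuous_on_diff pathsD(3)[OF driver(1)[OF X \<theta>]] skorokhod_onD(1)[OF sk])
  then show "pushed X \<theta> \<in> paths T {0..1}"
    unfolding pushed_def by (rule restrict_in_paths) (rule skorokhod_onD(2)[OF sk])
next
  fix t assume t: "t \<in> {0..T}"
  have "(\<lambda>\<theta>. driver X \<theta> t - reflector T a (driver X \<theta>) t) \<in> borel_measurable N"
    by (intro borel_measurable_diff measurable_path_eval[OF T0 t driver(3)[OF X]]
        measurable_path_eval[OF T0 t measurable_driver_reflector[OF X]])
  then show "(\<lambda>\<theta>. pushed X \<theta> t) \<in> borel_measurable N"
    using t by (simp add: pushed_def)
qed

text \<open>Integrating \<open>C * S\<close> against the weight \<open>exp (6 * C * s)\<close> gives
  one sixth of \<open>S\<close>, the reflector doubles it to a third, and their sum is a half: a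
  contraction on all of \<open>[0,T]\<close> for the weighted supremum.\<close>

lemma pushed_contraction:
  assumes X: "process T N X" and X': "process T N X'" and S: "0 \<le> S"
    and le: "\<And>\<theta> s. \<theta> \<in> space N \<Longrightarrow> s \<in> {0..T} \<Longrightarrow> \<bar>X \<theta> s - X' \<theta> s\<bar> \<le> S * exp (6 * C * s)"
    and \<theta>: "\<theta> \<in> space N" and t: "t \<in> {0..T}"
  shows "\<bar>driver X \<theta> t - driver X' \<theta> t\<bar> \<le> S / 6 * exp (6 * C * t)"
    and "\<bar>reflector T a (driver X \<theta>) t - reflector T a (driver X' \<theta>) t\<bar> \<le> S / 3 * exp (6 * C * t)"
    and "\<bar>pushed X \<theta> t - pushed X' \<theta> t\<bar> \<le> S / 2 * exp (6 * C * t)"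
proof -
  have dr: "\<bar>driver X \<theta> t - driver X' \<theta> t\<bar> \<le> S / 6 * exp (6 * C * t)" if t: "t \<in> {0..T}" for t
  proof -
    let ?b = "\<lambda>X s. b s (\<lambda>\<theta>'. X \<theta>' s) \<theta>"
    have "\<bar>(LINT s:{0..t}|lborel. ?b X s) - (LINT s:{0..t}|lborel. ?b X' s)\<bar>
        \<le> (LINT s:{0..t}|lborel. (C * S) * exp (6 * C * s))"
    proof (rule primitive_diff_le[OF b_cont[OF X \<theta>] b_cont[OF X' \<theta>] _ _ t])
      fix s assume "s \<in> {0..t}"
      then have s: "s \<in> {0..T}" using t by auto
      show "\<bar>?b X s - ?b X' s\<bar> \<le> (C * S) * exp (6 * C * s)"
        using b_Lip[OF X X' s le[OF _ s] \<theta>] by (simp add: mult.assoc)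
    qed (intro continuous_intros)
    also have "\<dots> \<le> (C * S) * exp (6 * C * t) / (6 * C)"
      using C S t by (intro integral_exp_le) auto
    also have "\<dots> = S / 6 * exp (6 * C * t)"
      using C by simp
    finally show ?thesis
      using t by (simp add: driver_def)
  qed
  then show d: "\<bar>driver X \<theta> t - driver X' \<theta> t\<bar> \<le> S / 6 * exp (6 * C * t)"
    using t by simp
  have "\<bar>reflector T a (driver X \<theta>) t - reflector T a (driver X' \<theta>) t\<bar> \<le> 2 * (S / 6 * exp (6 * C * t))"
  proof (rule reflector_Lipschitz[OF T a pathsD(3)[OF driver(1)[OF X \<theta>]] pathsD(3)[OF driver(1)[OF X' \<theta>]] t])
    fix s assume s: "s \<in> {0..t}"
    have "\<bar>driver X \<theta> s - driver X' \<theta> s\<bar> \<le> S / 6 * exp (6 * C * s)"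
      using s t by (intro dr) auto
    also have "\<dots> \<le> S / 6 * exp (6 * C * t)"
      using s S C by (intro mult_left_mono) auto
    finally show "\<bar>driver X \<theta> s - driver X' \<theta> s\<bar> \<le> S / 6 * exp (6 * C * t)" .
  qed
  then show r: "\<bar>reflector T a (driver X \<theta>) t - reflector T a (driver X' \<theta>) t\<bar> \<le> S / 3 * exp (6 * C * t)"
    by simp
  have "pushed X \<theta> t - pushed X' \<theta> t = (driver X \<theta> t - driver X' \<theta> t)
      - (reflector T a (driver X \<theta>) t - reflector T a (driver X' \<theta>) t)"
    using t by (simp add: pushed_def)
  then have "\<bar>pushed X \<theta> t - pushed X' \<theta> t\<bar> \<le> S / 6 * exp (6 * C * t) + S / 3 * exp (6 * C * t)"
    using d r by linarith
  also have "\<dots> = S / 2 * exp (6 * C * t)"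
    by simp
  finally show "\<bar>pushed X \<theta> t - pushed X' \<theta> t\<bar> \<le> S / 2 * exp (6 * C * t)" .
qed

primrec picard :: "nat \<Rightarrow> 't \<Rightarrow> real \<Rightarrow> real" where
  "picard 0 = (\<lambda>\<theta>. \<lambda>t\<in>{0..T}. a)"
| "picard (Suc n) = pushed (picard n)"

lemma process_picard: "process T N (picard n)"
proof (induction n)
  case 0
  show ?case
    unfolding process_def picard.simps
    by (rule measurable_into_path_space[OF T]) (use a in \<open>auto intro!: restrict_in_paths\<close>)
next
  case (Suc n)
  then show ?case
    by (simp add: process_pushed)
qed

lemma picard_step:
  assumes "\<theta> \<in> space N" "t \<in> {0..T}"
  shows "\<bar>picard (Suc n) \<theta> t - picard n \<theta> t\<bar> \<le> (1/2) ^ n * exp (6 * C * t)"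
  using assms
proof (induction n arbitrary: \<theta> t)
  case 0
  \<comment> \<open>All iterates take values in \<open>[0,1]\<close>, so the first step is at most 1
    and the weight is at least 1.\<close>
  have "\<bar>picard (Suc 0) \<theta> t - picard 0 \<theta> t\<bar> \<le> 1"
    using pathsD(2)[OF processD(1)[OF process_picard 0(1)] 0(2), of "Suc 0"]
      pathsD(2)[OF processD(1)[OF process_picard 0(1)] 0(2), of 0] by auto
  moreover have "1 \<le> exp (6 * C * t)"
    using C 0(2) by simp
  ultimately have "\<bar>picard (Suc 0) \<theta> t - picard 0 \<theta> t\<bar> \<le> exp (6 * C * t)"
    by linarith
  then show ?case
    by (simp del: picard.simps)
next
  case (Suc n)
  have "\<bar>pushed (picard (Suc n)) \<theta> t - pushed (picard n) \<theta> t\<bar> \<le> (1/2) ^ n / 2 * exp (6 * C * t)"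
    using Suc by (intro pushed_contraction(3)[OF process_picard process_picard]) auto
  then show ?case
    by simp
qed

text \<open>The bound is the exact geometric sum of the steps from \<open>n\<close> to
  \<open>m\<close>; keeping the subtracted term is what lets the induction close.\<close>

lemma picard_diff:
  assumes \<theta>: "\<theta> \<in> space N" "t \<in> {0..T}" and nm: "n \<le> m"
  shows "\<bar>picard m \<theta> t - picard n \<theta> t\<bar> \<le> (2 * (1/2) ^ n - 2 * (1/2) ^ m) * exp (6 * C * t)"
  using nm
proof (induction m rule: dec_induct)
  case (step m)
  have "\<bar>picard (Suc m) \<theta> t - picard n \<theta> t\<bar> \<le>
      (1/2) ^ m * exp (6 * C * t) + (2 * (1/2) ^ n - 2 * (1/2) ^ m) * exp (6 * C * t)"
    using picard_step[OF \<theta>, of m] step.IH by linarith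
  also have "\<dots> = (2 * (1/2) ^ n - 2 * (1/2) ^ Suc m) * exp (6 * C * t)"
    by (simp add: algebra_simps)
  finally show ?case .
qed simp

definition solution :: "'t \<Rightarrow> real \<Rightarrow> real" where
  "solution \<theta> = (\<lambda>t\<in>{0..T}. lim (\<lambda>n. picard n \<theta> t))"

lemma picard_limit:
  assumes \<theta>: "\<theta> \<in> space N" and t: "t \<in> {0..T}"
  shows "(\<lambda>n. picard n \<theta> t) \<longlonglongrightarrow> solution \<theta> t"
    and "\<bar>solution \<theta> t - picard n \<theta> t\<bar> \<le> 2 * (1/2) ^ n * exp (6 * C * t)"
proof -
  have diff: "\<bar>picard m \<theta> t - picard n \<theta> t\<bar> \<le> 2 * (1/2) ^ n * exp (6 * C * t)" if "n \<le> m" for m n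
  proof -
    have "(2 * (1/2) ^ n - 2 * (1/2) ^ m) * exp (6 * C * t) \<le> 2 * (1/2) ^ n * exp (6 * C * t)"
      by (intro mult_right_mono) auto
    then show ?thesis
      using picard_diff[OF \<theta> t that] by linarith
  qed
  have zero: "(\<lambda>n. 2 * (1/2) ^ n * exp (6 * C * t)) \<longlonglongrightarrow> 0"
    using tendsto_mult[OF tendsto_mult[OF tendsto_const[of 2] LIMSEQ_realpow_zero[of "1/2"]] tendsto_const[of "exp (6 * C * t)"]]
    by simp
  have "Cauchy (\<lambda>n. picard n \<theta> t)"
  proof (rule metric_CauchyI)
    fix e :: real assume "0 < e"
    then have "\<forall>\<^sub>F n in sequentially. 2 * (1/2) ^ n * exp (6 * C * t) < e/2"
      by (intro order_tendstoD(2)[OF zero]) auto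
    then obtain n where n: "2 * (1/2) ^ n * exp (6 * C * t) < e/2"
      by (meson eventually_happens' sequentially_bot)
    show "\<exists>M. \<forall>m\<ge>M. \<forall>l\<ge>M. dist (picard m \<theta> t) (picard l \<theta> t) < e"
    proof (intro exI[of _ n] allI impI)
      fix m l assume "n \<le> m" "n \<le> l"
      then show "dist (picard m \<theta> t) (picard l \<theta> t) < e"
        using diff[of n m] diff[of n l] n by (simp add: dist_real_def)
    qed
  qed
  then have "convergent (\<lambda>n. picard n \<theta> t)"
    by (rule Cauchy_convergent)
  then show lim: "(\<lambda>n. picard n \<theta> t) \<longlonglongrightarrow> solution \<theta> t"
    using t by (simp add: solution_def convergent_LIMSEQ_iff)
  show "\<bar>solution \<theta> t - picard n \<theta> t\<bar> \<le> 2 * (1/2) ^ n * exp (6 * C * t)"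
  proof (rule tendsto_upperbound)
    show "(\<lambda>m. \<bar>picard m \<theta> t - picard n \<theta> t\<bar>) \<longlonglongrightarrow> \<bar>solution \<theta> t - picard n \<theta> t\<bar>"
      by (intro tendsto_intros lim)
    show "\<forall>\<^sub>F m in sequentially. \<bar>picard m \<theta> t - picard n \<theta> t\<bar> \<le> 2 * (1/2) ^ n * exp (6 * C * t)"
      using eventually_ge_at_top[of n] by eventually_elim (rule diff)
  qed simp
qed

lemma process_solution: "process T N solution"
  unfolding process_def
proof (rule measurable_into_path_space[OF T])
  fix \<theta> assume \<theta>: "\<theta> \<in> space N"
  have "uniform_limit {0..T} (\<lambda>n t. picard n \<theta> t) (solution \<theta>) sequentially"
  proof (rule uniform_limitI)
    fix e :: real assume e: "0 < e"
    have "(\<lambda>n. 2 * (1/2) ^ n * exp (6 * C * T)) \<longlonglongrightarrow> 0"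
      using tendsto_mult[OF tendsto_mult[OF tendsto_const[of 2] LIMSEQ_realpow_zero[of "1/2"]] tendsto_const[of "exp (6 * C * T)"]]
      by simp
    then have "\<forall>\<^sub>F n in sequentially. 2 * (1/2) ^ n * exp (6 * C * T) < e"
      by (rule order_tendstoD(2)) (rule e)
    then show "\<forall>\<^sub>F n in sequentially. \<forall>t\<in>{0..T}. dist (picard n \<theta> t) (solution \<theta> t) < e"
    proof eventually_elim
      case (elim n)
      show ?case
      proof
        fix t assume t: "t \<in> {0..T}"
        have "2 * (1/2) ^ n * exp (6 * C * t) \<le> 2 * (1/2) ^ n * exp (6 * C * T)"
          using C t by (intro mult_left_mono) auto
        then have "\<bar>solution \<theta> t - picard n \<theta> t\<bar> < e"
          using picard_limit(2)[OF \<theta> t, of n] elim by linarith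
        then show "dist (picard n \<theta> t) (solution \<theta> t) < e"
          by (simp add: dist_real_def abs_minus_commute)
      qed
    qed
  qed
  then have "continuous_on {0..T} (solution \<theta>)"
    by (rule uniform_limit_theorem[rotated])
      (auto intro!: always_eventually pathsD(3) processD(1)[OF process_picard \<theta>])
  moreover have "solution \<theta> t \<in> {0..1}" if t: "t \<in> {0..T}" for t
  proof (rule closed_sequentially[OF _ _ picard_limit(1)[OF \<theta> t]])
    show "picard n \<theta> t \<in> {0..1}" for n
      by (rule pathsD(2)[OF processD(1)[OF process_picard \<theta>] t])
  qed simp
  ultimately show "solution \<theta> \<in> paths T {0..1}"
    by (auto simp: paths_def solution_def)
next
  fix t assume t: "t \<in> {0..T}"
  show "(\<lambda>\<theta>. solution \<theta> t) \<in> borel_measurable N"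
    using picard_limit(1)[OF _ t] processD(2)[OF process_picard t] by (rule borel_measurable_LIMSEQ_real)
qed

lemma solution_fixed:
  assumes \<theta>: "\<theta> \<in> space N" and t: "t \<in> {0..T}"
  shows "solution \<theta> t = pushed solution \<theta> t"
proof (rule LIMSEQ_unique)
  show "(\<lambda>n. picard (Suc n) \<theta> t) \<longlonglongrightarrow> solution \<theta> t"
    using picard_limit(1)[OF \<theta> t] by (rule LIMSEQ_Suc)
  have "(\<lambda>n. pushed solution \<theta> t - picard (Suc n) \<theta> t) \<longlonglongrightarrow> 0"
  proof (rule Lim_null_comparison)
    \<comment> \<open>The contraction estimate with \<open>S = 2 * (1/2) ^ n\<close>, the distance
      of the limit from the iterate, carries the Picard map through the limit.\<close>
    have "\<bar>pushed solution \<theta> t - pushed (picard n) \<theta> t\<bar> \<le> 2 * (1/2) ^ n / 2 * exp (6 * C * t)" for n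
      using \<theta> t picard_limit(2) by (intro pushed_contraction(3)[OF process_solution process_picard]) auto
    then show "\<forall>\<^sub>F n in sequentially. norm (pushed solution \<theta> t - picard (Suc n) \<theta> t) \<le> (1/2) ^ n * exp (6 * C * t)"
      by (intro always_eventually) simp
    show "(\<lambda>n. (1/2) ^ n * exp (6 * C * t)) \<longlonglongrightarrow> 0"
      using tendsto_mult[OF LIMSEQ_realpow_zero[of "1/2"] tendsto_const[of "exp (6 * C * t)"]] by simp
  qed
  from tendsto_diff[OF tendsto_const[of "pushed solution \<theta> t"] this]
  show "(\<lambda>n. picard (Suc n) \<theta> t) \<longlonglongrightarrow> pushed solution \<theta> t"
    by simp
qed

text \<open>Applying the reflector to the driver of the fixed point, rather than passing to the
  limit in the pushing terms, gives the Skorokhod property at once.\<close>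

definition reflection :: "'t \<Rightarrow> real \<Rightarrow> real" where
  "reflection \<theta> = reflector T a (driver solution \<theta>)"

lemma measurable_reflection: "reflection \<in> N \<rightarrow>\<^sub>M borel_of (path_space T UNIV)"
  using measurable_driver_reflector[OF process_solution] by (simp add: reflection_def[abs_def])

lemma solution_equation:
  assumes \<theta>: "\<theta> \<in> space N"
  shows "reflected_equation T a (\<lambda>s. b s (\<lambda>\<theta>'. solution \<theta>' s) \<theta>) (z \<theta>) (solution \<theta>) (reflection \<theta>)"
proof (rule skorokhod_imp_reflected_equation[OF T])
  show "set_integrable lborel {0..T} (\<lambda>s. b s (\<lambda>\<theta>'. solution \<theta>' s) \<theta>)"
    by (rule set_integrable_continuous[OF b_cont[OF process_solution \<theta>] order_refl])
  show "continuous_on {0..T} (driver solution \<theta>)"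
    by (rule pathsD(3)[OF driver(1)[OF process_solution \<theta>]])
  show "driver solution \<theta> t = a + (LINT s:{0..t}|lborel. b s (\<lambda>\<theta>'. solution \<theta>' s) \<theta>) + z \<theta> t" if "t \<in> {0..T}" for t
    using that by (simp add: driver_def)
  show "driver solution \<theta> 0 = a"
    by (rule driver(2)[OF process_solution \<theta>])
  show "skorokhod T (driver solution \<theta>) (reflection \<theta>)"
    unfolding reflection_def by (rule driver_skorokhod[OF process_solution \<theta>])
  show "solution \<theta> t = driver solution \<theta> t - reflection \<theta> t" if "t \<in> {0..T}" for t
    using solution_fixed[OF \<theta> that] that by (simp add: pushed_def reflection_def)
qed

end

section \<open>The mean field\<close>

text \<open>The data in quantitative form. \<open>c\<close> and \<open>Lm\<close> are taken positive
  so that \<open>2 * c * Lm\<close> is an admissible contraction rate, and \<open>w0\<close> bounds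
  the denominator of \<open>Lambda\<close> from below for every probability measure of
  radii.\<close>

locale population =
  fixes T a :: real and I :: "real set" and \<tau> \<sigma> \<mu> q' :: "real \<Rightarrow> real"
    and c Lc Ls sB Lm mB w0 wB uB qB :: real
  assumes T: "0 < T" and a: "a \<in> {0..1}"
    and c: "0 < c" "\<And>r. r \<in> I \<Longrightarrow> 0 \<le> 1 / \<tau> r \<and> 1 / \<tau> r \<le> c"
    and Lc: "0 \<le> Lc" "\<And>r r'. r \<in> I \<Longrightarrow> r' \<in> I \<Longrightarrow> \<bar>1 / \<tau> r - 1 / \<tau> r'\<bar> \<le> Lc * \<bar>r - r'\<bar>"
    and Ls: "0 \<le> Ls" "\<And>r r'. r \<in> I \<Longrightarrow> r' \<in> I \<Longrightarrow> \<bar>\<sigma> r - \<sigma> r'\<bar> \<le> Ls * \<bar>r - r'\<bar>"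
    and sB: "0 \<le> sB" "\<And>r. r \<in> I \<Longrightarrow> \<bar>\<sigma> r\<bar> \<le> sB"
    and Lm: "0 < Lm" "\<And>x y. \<bar>\<mu> x - \<mu> y\<bar> \<le> Lm * \<bar>x - y\<bar>"
    and mB: "\<And>x. \<bar>\<mu> x\<bar> \<le> mB"
    and weight: "0 < w0" "continuous_on I (\<lambda>r. vol r / \<tau> r)"
      "\<And>r. r \<in> I \<Longrightarrow> w0 \<le> vol r / \<tau> r \<and> vol r / \<tau> r \<le> wB"
    and uB: "\<And>r. r \<in> I \<Longrightarrow> \<bar>vol r\<bar> \<le> uB"
    and qB: "continuous_on {0..T} q'" "\<And>s. s \<in> {0..T} \<Longrightarrow> \<bar>q' s\<bar> \<le> qB"
begin

lemma T0: "0 \<le> T" using T by simp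

lemma mu_continuous: "continuous_on A \<mu>"
proof (rule continuous_on_subset)
  have "Lm-lipschitz_on UNIV \<mu>"
    using Lm by (auto simp: lipschitz_on_def dist_real_def)
  then show "continuous_on UNIV \<mu>"
    by (rule lipschitz_on_continuous_on)
qed simp

lemma vol_continuous: "continuous_on A vol"
  unfolding vol_def by (intro continuous_intros) auto

lemma sigma_continuous: "continuous_on I \<sigma>"
proof -
  have "Ls-lipschitz_on I \<sigma>"
    using Ls by (auto simp: lipschitz_on_def dist_real_def)
  then show ?thesis
    by (rule lipschitz_on_continuous_on)
qed

lemma tau_inverse_continuous: "continuous_on I (\<lambda>r. 1 / \<tau> r)"
proof -
  have "Lc-lipschitz_on I (\<lambda>r. 1 / \<tau> r)"
    using Lc by (auto simp: lipschitz_on_def dist_real_def)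
  then show ?thesis
    by (rule lipschitz_on_continuous_on)
qed

lemma measurable_radius:
  fixes g :: "real \<Rightarrow> real"
  assumes "R \<in> m \<rightarrow>\<^sub>M borel_of (top_of_set I)" "continuous_on I g"
  shows "(\<lambda>\<omega>. g (R \<omega>)) \<in> borel_measurable m"
proof -
  have "g \<in> borel_of (top_of_set I) \<rightarrow>\<^sub>M borel"
    using continuous_map_measurable[of "top_of_set I" euclideanreal g] assms(2) by (simp add: borel_of_euclidean)
  then show ?thesis
    by (rule measurable_compose[OF assms(1)])
qed

lemma radius_in: "R \<in> m \<rightarrow>\<^sub>M borel_of (top_of_set I) \<Longrightarrow> \<omega> \<in> space m \<Longrightarrow> R \<omega> \<in> I"
  using measurable_space[of R m "borel_of (top_of_set I)"] by simp

lemma measurable_mu: "\<xi> \<in> borel_measurable m \<Longrightarrow> (\<lambda>\<omega>. \<mu> (\<xi> \<omega>)) \<in> borel_measurable m"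
  by (rule measurable_compose[OF _ borel_measurable_continuous_onI[OF mu_continuous]])

text \<open>The term \<open>Lm * e\<close> occurs twice, once through the field and once through the
  particle's own position. This is the origin of the rate \<open>2 * c * Lm\<close> used
  throughout.\<close>

lemma drift_Lipschitz:
  assumes r: "r \<in> I" and x: "\<bar>x - x'\<bar> \<le> e" and f: "\<bar>f - f'\<bar> \<le> Lm * e + d"
  shows "\<bar>1 / \<tau> r * (f - \<mu> x) - 1 / \<tau> r * (f' - \<mu> x')\<bar> \<le> 2 * c * Lm * e + c * d"
proof -
  have "\<bar>\<mu> x - \<mu> x'\<bar> \<le> Lm * e"
    using Lm(2)[of x x'] mult_left_mono[OF x, of Lm] Lm(1) by linarith
  then have "\<bar>(f - \<mu> x) - (f' - \<mu> x')\<bar> \<le> 2 * (Lm * e) + d"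
    using f by linarith
  then have "1 / \<tau> r * \<bar>(f - \<mu> x) - (f' - \<mu> x')\<bar> \<le> c * (2 * (Lm * e) + d)"
    using c(1) c(2)[OF r] by (intro mult_mono) auto
  also have "1 / \<tau> r * \<bar>(f - \<mu> x) - (f' - \<mu> x')\<bar> = \<bar>1 / \<tau> r * (f - \<mu> x) - 1 / \<tau> r * (f' - \<mu> x')\<bar>"
    using c(2)[OF r] by (simp only: right_diff_distrib[symmetric] abs_mult abs_of_nonneg)
  also have "c * (2 * (Lm * e) + d) = 2 * c * Lm * e + c * d"
    by (simp add: algebra_simps)
  finally show ?thesis .
qed

text \<open>The noise starts at 0 only almost surely, while the fixed point scheme asks for this at
  every sample point; subtracting the initial value changes nothing almost everywhere.\<close>

lemma measurable_noise:
  assumes R: "R \<in> m \<rightarrow>\<^sub>M borel_of (top_of_set I)" and W: "W \<in> m \<rightarrow>\<^sub>M borel_of (path_space T UNIV)"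
  shows "(\<lambda>\<omega>. \<lambda>t\<in>{0..T}. \<sigma> (R \<omega>) * (W \<omega> t - W \<omega> 0)) \<in> m \<rightarrow>\<^sub>M borel_of (path_space T UNIV)"
proof (rule measurable_into_path_space[OF T])
  show "(\<lambda>t\<in>{0..T}. \<sigma> (R \<omega>) * (W \<omega> t - W \<omega> 0)) \<in> paths T UNIV" if "\<omega> \<in> space m" for \<omega>
    using measurable_space[OF W that] pathsD(3)[of "W \<omega>" T UNIV]
    by (intro restrict_in_paths continuous_intros) auto
  fix t assume t: "t \<in> {0..T}"
  have "(\<lambda>\<omega>. \<sigma> (R \<omega>) * (W \<omega> t - W \<omega> 0)) \<in> borel_measurable m"
    using T0 t by (intro borel_measurable_times borel_measurable_diff measurable_radius[OF R sigma_continuous]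
        measurable_path_eval[OF T0 _ W]) auto
  then show "(\<lambda>\<omega>. (\<lambda>t\<in>{0..T}. \<sigma> (R \<omega>) * (W \<omega> t - W \<omega> 0)) t) \<in> borel_measurable m"
    using t by simp
qed

text \<open>\<open>Lambda\<close> of the joint law of \<open>\<xi>\<close> and \<open>R\<close>,
  pulled back to the underlying probability space. The uniform measure on indices gives the particle
  field and the input law gives the limit field, so both are treated by the same estimates.\<close>

definition field :: "'m measure \<Rightarrow> ('m \<Rightarrow> real) \<Rightarrow> ('m \<Rightarrow> real) \<Rightarrow> real \<Rightarrow> real" where
  "field m R \<xi> s = (\<integral>\<omega>. vol (R \<omega>) * q' s + \<mu> (\<xi> \<omega>) * (vol (R \<omega>) / \<tau> (R \<omega>)) \<partial>m)
    / (\<integral>\<omega>. vol (R \<omega>) / \<tau> (R \<omega>) \<partial>m)"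

lemma Lambda_field:
  assumes R: "R \<in> m \<rightarrow>\<^sub>M borel_of (top_of_set I)" and \<xi>: "\<xi> \<in> borel_measurable m"
  shows "Lambda \<tau> \<mu> q' s (distr m (borel_of (state_space I)) (\<lambda>\<omega>. (\<xi> \<omega>, R \<omega>))) = field m R \<xi> s"
proof -
  have st: "state_space I = top_of_set (UNIV \<times> I)"
    using prod_topology_subtopology_eu[of UNIV I] by simp
  have meas: "(\<lambda>\<omega>. (\<xi> \<omega>, R \<omega>)) \<in> m \<rightarrow>\<^sub>M borel_of (state_space I)"
    using second_countable_euclidean[of "UNIV :: real set"] second_countable_euclidean[of I] \<xi> R
    by (intro measurable_borel_of_prod) (simp_all add: borel_of_euclidean)
  have cont: "continuous_on (UNIV \<times> I) (\<lambda>(x, r). vol r * q' s + \<mu> x * (vol r / \<tau> r))"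
    unfolding case_prod_beta'
    by (intro continuous_on_add continuous_on_mult continuous_on_const
        continuous_on_compose2[OF vol_continuous[of UNIV]] continuous_on_compose2[OF mu_continuous[of UNIV]]
        continuous_on_compose2[OF weight(2)] continuous_on_fst continuous_on_snd continuous_on_id) auto
  have cont': "continuous_on (UNIV \<times> I) (\<lambda>(x :: real, r). vol r / \<tau> r)"
    unfolding case_prod_beta'
    by (intro continuous_on_compose2[OF weight(2)] continuous_on_snd continuous_on_id) auto
  have "(\<lambda>(x, r). vol r * q' s + \<mu> x * (vol r / \<tau> r)) \<in> borel_measurable (borel_of (state_space I))"
    "(\<lambda>(x :: real, r). vol r / \<tau> r) \<in> borel_measurable (borel_of (state_space I))"
    using cont cont' continuous_map_measurable[of "state_space I" euclideanreal]
    by (auto simp: st borel_of_euclidean)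
  then show ?thesis
    unfolding Lambda_def field_def by (simp add: integral_distr[OF meas])
qed

lemma Lambda_empirical:
  assumes "\<And>i. i < n \<Longrightarrow> r i \<in> I"
  shows "Lambda \<tau> \<mu> q' s (empirical (state_space I) n (\<lambda>j. (\<xi> j, r j))) = field (uniform_count_measure {..<n}) r \<xi> s"
  unfolding empirical_def using assms
  by (intro Lambda_field) (auto simp: measurable_def space_uniform_count_measure sets_uniform_count_measure)

context
  fixes m :: "'m measure" and R :: "'m \<Rightarrow> real"
  assumes m: "prob_space m" and R: "R \<in> m \<rightarrow>\<^sub>M borel_of (top_of_set I)"
begin

interpretation prob_space m by (rule m)

lemma field_parts:
  assumes \<xi>: "\<xi> \<in> borel_measurable m"
  shows "integrable m (\<lambda>\<omega>. vol (R \<omega>))" "integrable m (\<lambda>\<omega>. vol (R \<omega>) / \<tau> (R \<omega>))"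
    "integrable m (\<lambda>\<omega>. \<mu> (\<xi> \<omega>) * (vol (R \<omega>) / \<tau> (R \<omega>)))"
    "w0 \<le> (\<integral>\<omega>. vol (R \<omega>) / \<tau> (R \<omega>) \<partial>m)"
    "field m R \<xi> s = ((\<integral>\<omega>. vol (R \<omega>) \<partial>m) * q' s + (\<integral>\<omega>. \<mu> (\<xi> \<omega>) * (vol (R \<omega>) / \<tau> (R \<omega>)) \<partial>m))
      / (\<integral>\<omega>. vol (R \<omega>) / \<tau> (R \<omega>) \<partial>m)"
proof -
  have RI: "R \<omega> \<in> I" if "\<omega> \<in> space m" for \<omega>
    using radius_in[OF R that] .
  show 1: "integrable m (\<lambda>\<omega>. vol (R \<omega>))"
    using uB RI by (intro integrable_const_bound[of _ uB] measurable_radius[OF R vol_continuous]) auto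
  show 2: "integrable m (\<lambda>\<omega>. vol (R \<omega>) / \<tau> (R \<omega>))"
    using weight RI by (intro integrable_const_bound[of _ wB] measurable_radius[OF R weight(2)] AE_I2) force
  have "\<bar>\<mu> (\<xi> \<omega>) * (vol (R \<omega>) / \<tau> (R \<omega>))\<bar> \<le> mB * wB" if "\<omega> \<in> space m" for \<omega>
    unfolding abs_mult using mB[of "\<xi> \<omega>"] weight(1) weight(3)[OF RI[OF that]] by (intro mult_mono) auto
  then show 3: "integrable m (\<lambda>\<omega>. \<mu> (\<xi> \<omega>) * (vol (R \<omega>) / \<tau> (R \<omega>)))"
    by (intro integrable_const_bound[of _ "mB * wB"] borel_measurable_times measurable_mu[OF \<xi>]
        measurable_radius[OF R weight(2)] AE_I2) simp
  have "(\<integral>\<omega>. w0 \<partial>m) \<le> (\<integral>\<omega>. vol (R \<omega>) / \<tau> (R \<omega>) \<partial>m)"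
    using 2 weight(3) RI by (intro integral_mono) auto
  then show "w0 \<le> (\<integral>\<omega>. vol (R \<omega>) / \<tau> (R \<omega>) \<partial>m)"
    by (simp add: prob_space)
  show "field m R \<xi> s = ((\<integral>\<omega>. vol (R \<omega>) \<partial>m) * q' s + (\<integral>\<omega>. \<mu> (\<xi> \<omega>) * (vol (R \<omega>) / \<tau> (R \<omega>)) \<partial>m))
      / (\<integral>\<omega>. vol (R \<omega>) / \<tau> (R \<omega>) \<partial>m)"
    unfolding field_def using 1 3 by simp
qed

text \<open>The denominator and the \<open>q'\<close> term depend on the radii alone and cancel.
  What remains is a weighted mean of differences of \<open>\<mu>\<close>, normalised by the same
  weights, so the constant is that of \<open>\<mu>\<close>. An almost everywhere bound is enough, as
  uniqueness of the limit equation will require.\<close>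

lemma field_Lipschitz:
  assumes \<xi>: "\<xi> \<in> borel_measurable m" and \<xi>': "\<xi>' \<in> borel_measurable m"
    and le: "AE \<omega> in m. \<bar>\<xi> \<omega> - \<xi>' \<omega>\<bar> \<le> e"
  shows "\<bar>field m R \<xi> s - field m R \<xi>' s\<bar> \<le> Lm * e"
proof -
  let ?w = "\<lambda>\<omega>. vol (R \<omega>) / \<tau> (R \<omega>)"
  note P = field_parts[OF \<xi>] and P' = field_parts[OF \<xi>']
  have "\<bar>(\<integral>\<omega>. \<mu> (\<xi> \<omega>) * ?w \<omega> \<partial>m) - (\<integral>\<omega>. \<mu> (\<xi>' \<omega>) * ?w \<omega> \<partial>m)\<bar>
      = \<bar>\<integral>\<omega>. \<mu> (\<xi> \<omega>) * ?w \<omega> - \<mu> (\<xi>' \<omega>) * ?w \<omega> \<partial>m\<bar>"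
    using P(3) P'(3) by simp
  also have "\<dots> \<le> (\<integral>\<omega>. \<bar>\<mu> (\<xi> \<omega>) * ?w \<omega> - \<mu> (\<xi>' \<omega>) * ?w \<omega>\<bar> \<partial>m)"
    by (rule integral_abs_bound)
  also have "\<dots> \<le> (\<integral>\<omega>. Lm * e * ?w \<omega> \<partial>m)"
  proof (rule integral_mono_AE)
    show "AE \<omega> in m. \<bar>\<mu> (\<xi> \<omega>) * ?w \<omega> - \<mu> (\<xi>' \<omega>) * ?w \<omega>\<bar> \<le> Lm * e * ?w \<omega>"
      using le AE_space
    proof eventually_elim
      case (elim \<omega>)
      have w: "0 \<le> ?w \<omega>"
        using weight(1) weight(3)[OF radius_in[OF R elim(2)]] by simp
      have "\<bar>\<mu> (\<xi> \<omega>) - \<mu> (\<xi>' \<omega>)\<bar> \<le> Lm * e"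
        using Lm(2)[of "\<xi> \<omega>" "\<xi>' \<omega>"] mult_left_mono[OF elim(1), of Lm] Lm(1) by linarith
      then have "\<bar>\<mu> (\<xi> \<omega>) - \<mu> (\<xi>' \<omega>)\<bar> * ?w \<omega> \<le> Lm * e * ?w \<omega>"
        using w by (rule mult_right_mono)
      then show ?case
        using w by (simp only: left_diff_distrib[symmetric] abs_mult abs_of_nonneg)
    qed
    show "integrable m (\<lambda>\<omega>. \<bar>\<mu> (\<xi> \<omega>) * ?w \<omega> - \<mu> (\<xi>' \<omega>) * ?w \<omega>\<bar>)"
      by (intro integrable_abs Bochner_Integration.integrable_diff P(3) P'(3))
    show "integrable m (\<lambda>\<omega>. Lm * e * ?w \<omega>)"
      by (rule integrable_mult_right) (rule P(2))
  qed
  also have "\<dots> = Lm * e * (\<integral>\<omega>. ?w \<omega> \<partial>m)"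
    by (rule integral_mult_right_zero)
  finally have num: "\<bar>(\<integral>\<omega>. \<mu> (\<xi> \<omega>) * ?w \<omega> \<partial>m) - (\<integral>\<omega>. \<mu> (\<xi>' \<omega>) * ?w \<omega> \<partial>m)\<bar> \<le> Lm * e * (\<integral>\<omega>. ?w \<omega> \<partial>m)" .
  have pos: "0 < (\<integral>\<omega>. ?w \<omega> \<partial>m)"
    using P(4) weight(1) by linarith
  have "field m R \<xi> s - field m R \<xi>' s =
      ((\<integral>\<omega>. \<mu> (\<xi> \<omega>) * ?w \<omega> \<partial>m) - (\<integral>\<omega>. \<mu> (\<xi>' \<omega>) * ?w \<omega> \<partial>m)) / (\<integral>\<omega>. ?w \<omega> \<partial>m)"
    unfolding P(5) P'(5) by (simp only: diff_divide_distrib[symmetric] add_diff_cancel_left)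
  then show ?thesis
    using num pos by (simp only: abs_divide abs_of_pos[OF pos] divide_le_eq if_True)
qed

lemma field_continuous:
  assumes X: "process T m X"
  shows "continuous_on {0..T} (\<lambda>s. field m R (\<lambda>\<omega>. X \<omega> s) s)"
proof -
  let ?w = "\<lambda>\<omega>. vol (R \<omega>) / \<tau> (R \<omega>)"
  have "continuous_on {0..T} (\<lambda>s. \<integral>\<omega>. \<mu> (X \<omega> s) * ?w \<omega> \<partial>m)"
    unfolding continuous_on_sequentially
  proof (intro ballI allI impI, elim conjE)
    fix u s assume s: "s \<in> {0..T}" and u: "\<forall>n. u n \<in> {0..T}" "u \<longlonglongrightarrow> s"
    have "(\<lambda>n. \<integral>\<omega>. \<mu> (X \<omega> (u n)) * ?w \<omega> \<partial>m) \<longlonglongrightarrow> (\<integral>\<omega>. \<mu> (X \<omega> s) * ?w \<omega> \<partial>m)"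
    proof (rule integral_dominated_convergence[where w = "\<lambda>_. mB * wB"])
      show "(\<lambda>\<omega>. \<mu> (X \<omega> s) * ?w \<omega>) \<in> borel_measurable m" "(\<lambda>\<omega>. \<mu> (X \<omega> (u n)) * ?w \<omega>) \<in> borel_measurable m" for n
        using u(1) s by (intro borel_measurable_times measurable_mu measurable_radius[OF R weight(2)] processD(2)[OF X]; simp)+
      show "AE \<omega> in m. (\<lambda>n. \<mu> (X \<omega> (u n)) * ?w \<omega>) \<longlonglongrightarrow> \<mu> (X \<omega> s) * ?w \<omega>"
      proof (rule AE_I2)
        fix \<omega> assume "\<omega> \<in> space m"
        then have "continuous_on {0..T} (\<lambda>s. \<mu> (X \<omega> s))"
          by (intro continuous_on_compose2[OF mu_continuous[of UNIV]] pathsD(3)[OF processD(1)[OF X]]) auto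
        then have "(\<lambda>n. \<mu> (X \<omega> (u n))) \<longlonglongrightarrow> \<mu> (X \<omega> s)"
          using s u unfolding continuous_on_sequentially by (auto simp: o_def)
        then show "(\<lambda>n. \<mu> (X \<omega> (u n)) * ?w \<omega>) \<longlonglongrightarrow> \<mu> (X \<omega> s) * ?w \<omega>"
          by (intro tendsto_intros)
      qed
      show "AE \<omega> in m. norm (\<mu> (X \<omega> (u n)) * ?w \<omega>) \<le> mB * wB" for n
      proof (rule AE_I2)
        fix \<omega> assume "\<omega> \<in> space m"
        then show "norm (\<mu> (X \<omega> (u n)) * ?w \<omega>) \<le> mB * wB"
          unfolding real_norm_def abs_mult using mB[of "X \<omega> (u n)"] weight(1) weight(3)[OF radius_in[OF R]]
          by (intro mult_mono) force+
      qed
    qed simp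
    then show "((\<lambda>s. \<integral>\<omega>. \<mu> (X \<omega> s) * ?w \<omega> \<partial>m) \<circ> u) \<longlonglongrightarrow> (\<integral>\<omega>. \<mu> (X \<omega> s) * ?w \<omega> \<partial>m)"
      by (simp add: o_def)
  qed
  \<comment> \<open>The lower bound on the denominator is stated for some configuration; the zero
    one serves as a placeholder.\<close>
  moreover have "(\<integral>\<omega>. ?w \<omega> \<partial>m) \<noteq> 0"
    using field_parts(4)[of "\<lambda>_. 0"] weight(1) by simp
  ultimately have "continuous_on {0..T} (\<lambda>s. ((\<integral>\<omega>. vol (R \<omega>) \<partial>m) * q' s + (\<integral>\<omega>. \<mu> (X \<omega> s) * ?w \<omega> \<partial>m)) / (\<integral>\<omega>. ?w \<omega> \<partial>m))"
    using qB(1) by (intro continuous_intros) auto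
  then show ?thesis
    using field_parts(5)[OF processD(2)[OF X]] by (subst continuous_on_cong) auto
qed

lemma interacting_drift_field:
  assumes W: "W \<in> m \<rightarrow>\<^sub>M borel_of (path_space T UNIV)"
  shows "interacting_drift T a (2 * c * Lm) m (\<lambda>\<omega>. \<lambda>t\<in>{0..T}. \<sigma> (R \<omega>) * (W \<omega> t - W \<omega> 0))
    (\<lambda>s \<xi> \<omega>. 1 / \<tau> (R \<omega>) * (field m R \<xi> s - \<mu> (\<xi> \<omega>)))"
proof
  show "(\<lambda>\<omega>. \<lambda>t\<in>{0..T}. \<sigma> (R \<omega>) * (W \<omega> t - W \<omega> 0)) \<in> m \<rightarrow>\<^sub>M borel_of (path_space T UNIV)"
    by (rule measurable_noise[OF R W])
  show "(\<lambda>t\<in>{0..T}. \<sigma> (R \<omega>) * (W \<omega> t - W \<omega> 0)) 0 = 0" for \<omega>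
    using T0 by simp
  show "continuous_on {0..T} (\<lambda>s. 1 / \<tau> (R \<omega>) * (field m R (\<lambda>\<omega>'. X \<omega>' s) s - \<mu> (X \<omega> s)))"
    if X: "process T m X" and \<omega>: "\<omega> \<in> space m" for X \<omega>
    by (intro continuous_on_mult continuous_on_const continuous_on_diff field_continuous[OF X]
        continuous_on_compose2[OF mu_continuous[of UNIV] pathsD(3)[OF processD(1)[OF X \<omega>]]]) auto
  show "(\<lambda>\<omega>. 1 / \<tau> (R \<omega>) * (field m R (\<lambda>\<omega>'. X \<omega>' s) s - \<mu> (X \<omega> s))) \<in> borel_measurable m"
    if X: "process T m X" and s: "s \<in> {0..T}" for X s
    by (intro borel_measurable_times borel_measurable_diff borel_measurable_const measurable_mu
        measurable_radius[OF R tau_inverse_continuous] processD(2)[OF X s])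
  show "\<bar>1 / \<tau> (R \<omega>) * (field m R (\<lambda>\<omega>'. X \<omega>' s) s - \<mu> (X \<omega> s))
      - 1 / \<tau> (R \<omega>) * (field m R (\<lambda>\<omega>'. X' \<omega>' s) s - \<mu> (X' \<omega> s))\<bar> \<le> 2 * c * Lm * e"
    if X: "process T m X" "process T m X'" and s: "s \<in> {0..T}"
      and le: "\<And>\<omega>'. \<omega>' \<in> space m \<Longrightarrow> \<bar>X \<omega>' s - X' \<omega>' s\<bar> \<le> e" and \<omega>: "\<omega> \<in> space m" for X X' s e \<omega>
  proof -
    have "\<bar>field m R (\<lambda>\<omega>'. X \<omega>' s) s - field m R (\<lambda>\<omega>'. X' \<omega>' s) s\<bar> \<le> Lm * e"
      using le by (intro field_Lipschitz processD(2)[OF X(1) s] processD(2)[OF X(2) s] AE_I2)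
    then show ?thesis
      using drift_Lipschitz[OF radius_in[OF R \<omega>] le[OF \<omega>], of _ _ 0] by simp
  qed
qed (use T a c Lm in auto)

end

end

section \<open>Existence and uniqueness\<close>

lemma reflected_equation_cong:
  assumes eq: "reflected_equation T a b z x k"
    and b: "\<And>s. s \<in> {0..T} \<Longrightarrow> b' s = b s" and z: "\<And>s. s \<in> {0..T} \<Longrightarrow> z' s = z s"
  shows "reflected_equation T a b' z' x k"
proof -
  have "set_integrable lborel {0..T} b' = set_integrable lborel {0..T} b"
    using b by (intro set_integrable_cong) auto
  moreover have "(LINT s:{0..t}|lborel. b' s) = (LINT s:{0..t}|lborel. b s)" if "t \<in> {0..T}" for t
    using b that by (intro set_lebesgue_integral_cong) auto
  ultimately show ?thesis
    using eq z unfolding reflected_equation_def by simp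
qed

lemma process_uniform_count_measure:
  assumes "\<And>i. i < n \<Longrightarrow> Y i \<in> paths T {0..1}"
  shows "process T (uniform_count_measure {..<n}) Y"
  using assms unfolding process_def
  by (auto simp: measurable_def space_uniform_count_measure sets_uniform_count_measure)

lemma prob_space_uniform_count_measure_lessThan:
  assumes "1 \<le> n"
  shows "prob_space (uniform_count_measure {..<n :: nat})"
  using assms by (intro prob_space_uniform_count_measure) (auto simp: lessThan_empty_iff)

lemma measurable_uniform_count_measure:
  assumes "\<And>i. i < n \<Longrightarrow> r i \<in> space N"
  shows "r \<in> uniform_count_measure {..<n} \<rightarrow>\<^sub>M N"
  using assms by (auto simp: measurable_def space_uniform_count_measure sets_uniform_count_measure)

context population
begin

text \<open>The constant of \<open>reflected_stability\<close> for
  \<open>L = 2 * c * Lm\<close>.\<close>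

definition gain :: real where
  "gain = 4 * exp (4 * (2 * c * Lm) * T)"

lemma gain_pos: "0 < gain"
  by (simp add: gain_def)

text \<open>Noises and radii coincide and only the fields differ. \<open>\<epsilon>\<close> is the
  part of the difference of the fields that is not explained by the difference of the paths.\<close>

lemma population_stability:
  fixes x x' k k' z :: "'i \<Rightarrow> real \<Rightarrow> real"
  assumes \<rho>: "\<And>i. i \<in> D \<Longrightarrow> \<rho> i \<in> I"
    and eq: "\<And>i. i \<in> D \<Longrightarrow> reflected_equation T a (\<lambda>s. 1 / \<tau> (\<rho> i) * (f s - \<mu> (x i s))) (z i) (x i) (k i)"
      "\<And>i. i \<in> D \<Longrightarrow> reflected_equation T a (\<lambda>s. 1 / \<tau> (\<rho> i) * (f' s - \<mu> (x' i s))) (z i) (x' i) (k' i)"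
    and x: "\<And>i. i \<in> D \<Longrightarrow> x i \<in> paths T {0..1}" "\<And>i. i \<in> D \<Longrightarrow> x' i \<in> paths T {0..1}"
    and k: "\<And>i. i \<in> D \<Longrightarrow> k i \<in> paths T UNIV" "\<And>i. i \<in> D \<Longrightarrow> k' i \<in> paths T UNIV"
    and f: "continuous_on {0..T} f" "continuous_on {0..T} f'"
    and close: "\<And>s e. s \<in> {0..T} \<Longrightarrow> 0 \<le> e \<Longrightarrow> (\<And>j. j \<in> D \<Longrightarrow> \<bar>x j s - x' j s\<bar> \<le> e) \<Longrightarrow>
      \<bar>f s - f' s\<bar> \<le> Lm * e + \<epsilon> s"
    and \<epsilon>: "continuous_on {0..T} \<epsilon>" "\<And>s. s \<in> {0..T} \<Longrightarrow> 0 \<le> \<epsilon> s"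
    and it: "i \<in> D" "t \<in> {0..T}"
  shows "\<bar>x i t - x' i t\<bar> \<le> gain * (c * (LINT s:{0..T}|lborel. \<epsilon> s))"
    and "\<bar>k i t - k' i t\<bar> \<le> gain * (c * (LINT s:{0..T}|lborel. \<epsilon> s))"
proof -
  have cont: "continuous_on {0..T} (\<lambda>s. 1 / \<tau> (\<rho> i) * (f s - \<mu> (x i s)))"
    if "continuous_on {0..T} f" "x i \<in> paths T {0..1}" for f :: "real \<Rightarrow> real" and x :: "'i \<Rightarrow> real \<Rightarrow> real" and i
    by (intro continuous_on_mult continuous_on_const continuous_on_diff that(1)
        continuous_on_compose2[OF mu_continuous[of UNIV] pathsD(3)[OF that(2)]]) auto
  have b: "\<bar>1 / \<tau> (\<rho> i) * (f s - \<mu> (x i s)) - 1 / \<tau> (\<rho> i) * (f' s - \<mu> (x' i s))\<bar> \<le> 2 * c * Lm * e + c * \<epsilon> s"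
    if s: "s \<in> {0..T}" and e: "0 \<le> e" "\<And>j. j \<in> D \<Longrightarrow> \<bar>x j s - x' j s\<bar> \<le> e" and i: "i \<in> D" for s e i
    by (rule drift_Lipschitz[OF \<rho>[OF i] e(2)[OF i] close[OF s e]])
  let ?b = "\<lambda>i s. 1 / \<tau> (\<rho> i) * (f s - \<mu> (x i s))" and ?b' = "\<lambda>i s. 1 / \<tau> (\<rho> i) * (f' s - \<mu> (x' i s))"
  have L: "0 < 2 * c * Lm"
    using c(1) Lm(1) by simp
  have cb: "continuous_on {0..T} (?b i)" "continuous_on {0..T} (?b' i)" if "i \<in> D" for i
    using cont[OF f(1) x(1)] cont[OF f(2) x(2)] that by auto
  have zz: "\<bar>z i s - z i s\<bar> \<le> 0" if "i \<in> D" "s \<in> {0..T}" for i s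
    by simp
  have c\<epsilon>: "0 \<le> c * \<epsilon> s" if "s \<in> {0..T}" for s
    using \<epsilon>(2)[OF that] c(1) by simp
  have c\<epsilon>': "continuous_on {0..T} (\<lambda>s. c * \<epsilon> s)"
    using \<epsilon> by (intro continuous_intros)
  have le: "(LINT s:{0..T}|lborel. c * \<epsilon> s) \<le> c * (LINT s:{0..T}|lborel. \<epsilon> s)"
    by simp
  have "\<bar>x i t - x' i t\<bar> \<le> 4 * exp (4 * (2 * c * Lm) * T) * (c * (LINT s:{0..T}|lborel. \<epsilon> s) + 0)"
    by (rule reflected_stability(1)[where D = D and a = a and x = x and x' = x' and k = k and k' = k' and i = i and t = t and b = ?b and b' = ?b' and z = z and z' = z and \<zeta> = 0 and \<epsilon> = "\<lambda>s. c * \<epsilon> s"])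
      (fact T L eq x k cb zz b c\<epsilon>' c\<epsilon> le it)+
  then show "\<bar>x i t - x' i t\<bar> \<le> gain * (c * (LINT s:{0..T}|lborel. \<epsilon> s))"
    by (simp add: gain_def)
  have "\<bar>k i t - k' i t\<bar> \<le> 4 * exp (4 * (2 * c * Lm) * T) * (c * (LINT s:{0..T}|lborel. \<epsilon> s) + 0)"
    by (rule reflected_stability(2)[where D = D and a = a and x = x and x' = x' and k = k and k' = k' and i = i and t = t and b = ?b and b' = ?b' and z = z and z' = z and \<zeta> = 0 and \<epsilon> = "\<lambda>s. c * \<epsilon> s"])
      (fact T L eq x k cb zz b c\<epsilon>' c\<epsilon> le it)+
  then show "\<bar>k i t - k' i t\<bar> \<le> gain * (c * (LINT s:{0..T}|lborel. \<epsilon> s))"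
    by (simp add: gain_def)
qed

lemma limit_solution_field:
  assumes m: "prob_space m" and R: "R \<in> m \<rightarrow>\<^sub>M borel_of (top_of_set I)"
    and X: "process T m X" and k: "k \<in> m \<rightarrow>\<^sub>M borel_of (path_space T UNIV)"
  shows "limit_solution T I \<tau> \<sigma> \<mu> q' a m W R X k \<longleftrightarrow>
    (AE \<omega> in m. reflected_equation T a (\<lambda>s. 1 / \<tau> (R \<omega>) * (field m R (\<lambda>\<omega>'. X \<omega>' s) s - \<mu> (X \<omega> s)))
      (\<lambda>t. \<sigma> (R \<omega>) * W \<omega> t) (X \<omega>) (k \<omega>))"
proof -
  have "Lambda \<tau> \<mu> q' s (distr m (borel_of (state_space I)) (\<lambda>\<omega>'. (X \<omega>' s, R \<omega>'))) = field m R (\<lambda>\<omega>'. X \<omega>' s) s"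
    if "s \<in> {0..T}" for s
    using Lambda_field[OF R processD(2)[OF X that]] .
  then have "reflected_equation T a
        (\<lambda>s. 1 / \<tau> (R \<omega>) * (Lambda \<tau> \<mu> q' s (distr m (borel_of (state_space I)) (\<lambda>\<omega>'. (X \<omega>' s, R \<omega>'))) - \<mu> (X \<omega> s)))
        (\<lambda>t. \<sigma> (R \<omega>) * W \<omega> t) (X \<omega>) (k \<omega>) \<longleftrightarrow>
      reflected_equation T a (\<lambda>s. 1 / \<tau> (R \<omega>) * (field m R (\<lambda>\<omega>'. X \<omega>' s) s - \<mu> (X \<omega> s)))
        (\<lambda>t. \<sigma> (R \<omega>) * W \<omega> t) (X \<omega>) (k \<omega>)" for \<omega>
    by (auto elim!: reflected_equation_cong)
  then show ?thesis
    using X k unfolding limit_solution_def process_def by simp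
qed

text \<open>The stability estimate with the sample points satisfying both equations as index set and
  \<open>\<epsilon> = 0\<close>. All of them must be treated together since the field depends on the
  whole law.\<close>

lemma limit_solution_unique:
  assumes m: "prob_space m" and R: "R \<in> m \<rightarrow>\<^sub>M borel_of (top_of_set I)"
    and 1: "limit_solution T I \<tau> \<sigma> \<mu> q' a m W R X k" and 2: "limit_solution T I \<tau> \<sigma> \<mu> q' a m W R X' k'"
  shows "AE \<omega> in m. X \<omega> = X' \<omega> \<and> k \<omega> = k' \<omega>"
proof -
  have X: "process T m X" and k: "k \<in> m \<rightarrow>\<^sub>M borel_of (path_space T UNIV)"
    using 1 by (auto simp: limit_solution_def process_def)
  have X': "process T m X'" and k': "k' \<in> m \<rightarrow>\<^sub>M borel_of (path_space T UNIV)"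
    using 2 by (auto simp: limit_solution_def process_def)
  have kp: "k \<omega> \<in> paths T UNIV" "k' \<omega> \<in> paths T UNIV" if "\<omega> \<in> space m" for \<omega>
    using measurable_space[OF k that] measurable_space[OF k' that] by auto
  define good where "good X k \<omega> \<longleftrightarrow> \<omega> \<in> space m \<and>
    reflected_equation T a (\<lambda>s. 1 / \<tau> (R \<omega>) * (field m R (\<lambda>\<omega>'. X \<omega>' s) s - \<mu> (X \<omega> s)))
      (\<lambda>t. \<sigma> (R \<omega>) * W \<omega> t) (X \<omega>) (k \<omega>)" for X k \<omega>
  have ae: "AE \<omega> in m. good X k \<omega> \<and> good X' k' \<omega>"
    using 1 2 unfolding limit_solution_field[OF m R X k] limit_solution_field[OF m R X' k']
    by (auto simp: good_def)
  let ?D = "{\<omega>. good X k \<omega> \<and> good X' k' \<omega>}"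
  have D: "\<omega> \<in> space m" "R \<omega> \<in> I" "X \<omega> \<in> paths T {0..1}" "X' \<omega> \<in> paths T {0..1}"
    "k \<omega> \<in> paths T UNIV" "k' \<omega> \<in> paths T UNIV"
    "reflected_equation T a (\<lambda>s. 1 / \<tau> (R \<omega>) * (field m R (\<lambda>\<omega>'. X \<omega>' s) s - \<mu> (X \<omega> s)))
      (\<lambda>t. \<sigma> (R \<omega>) * W \<omega> t) (X \<omega>) (k \<omega>)"
    "reflected_equation T a (\<lambda>s. 1 / \<tau> (R \<omega>) * (field m R (\<lambda>\<omega>'. X' \<omega>' s) s - \<mu> (X' \<omega> s)))
      (\<lambda>t. \<sigma> (R \<omega>) * W \<omega> t) (X' \<omega>) (k' \<omega>)"
    if "\<omega> \<in> ?D" for \<omega>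
    using that radius_in[OF R] processD(1)[OF X] processD(1)[OF X'] kp by (auto simp: good_def)
  have close: "\<bar>field m R (\<lambda>\<omega>'. X \<omega>' s) s - field m R (\<lambda>\<omega>'. X' \<omega>' s) s\<bar> \<le> Lm * e + 0"
    if s: "s \<in> {0..T}" and "0 \<le> e" and e: "\<And>\<omega>. \<omega> \<in> ?D \<Longrightarrow> \<bar>X \<omega> s - X' \<omega> s\<bar> \<le> e" for s e
  proof -
    \<comment> \<open>The bound is given on the index set only, but that set has full measure and
      the field does not see the rest.\<close>
    have "AE \<omega> in m. \<bar>X \<omega> s - X' \<omega> s\<bar> \<le> e"
      using ae by eventually_elim (rule e, simp)
    then show ?thesis
      using field_Lipschitz[OF m R processD(2)[OF X s] processD(2)[OF X' s]] by simp
  qed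
  have fc: "continuous_on {0..T} (\<lambda>s. field m R (\<lambda>\<omega>'. X \<omega>' s) s)" "continuous_on {0..T} (\<lambda>s. field m R (\<lambda>\<omega>'. X' \<omega>' s) s)"
    by (intro field_continuous[OF m R X] field_continuous[OF m R X'])+
  have zero: "continuous_on {0..T} (\<lambda>_. 0 :: real)"
    by simp
  have zero': "(0 :: real) \<le> 0" if "s \<in> {0..T}" for s
    by simp
  have eqX: "\<bar>X \<omega> t - X' \<omega> t\<bar> \<le> gain * (c * (LINT s:{0..T}|lborel. 0))" if \<omega>: "\<omega> \<in> ?D" "t \<in> {0..T}" for \<omega> t
    by (rule population_stability(1)[where D = ?D and \<rho> = R and z = "\<lambda>\<omega> t. \<sigma> (R \<omega>) * W \<omega> t" and \<epsilon> = "\<lambda>_. 0"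
      and x = X and x' = X' and k = k and k' = k' and i = \<omega> and t = t
      and f = "\<lambda>s. field m R (\<lambda>\<omega>'. X \<omega>' s) s" and f' = "\<lambda>s. field m R (\<lambda>\<omega>'. X' \<omega>' s) s"])
      (fact D(2-8) fc close zero zero' \<omega>)+
  have eqk: "\<bar>k \<omega> t - k' \<omega> t\<bar> \<le> gain * (c * (LINT s:{0..T}|lborel. 0))" if \<omega>: "\<omega> \<in> ?D" "t \<in> {0..T}" for \<omega> t
    by (rule population_stability(2)[where D = ?D and \<rho> = R and z = "\<lambda>\<omega> t. \<sigma> (R \<omega>) * W \<omega> t" and \<epsilon> = "\<lambda>_. 0"
      and x = X and x' = X' and k = k and k' = k' and i = \<omega> and t = t
      and f = "\<lambda>s. field m R (\<lambda>\<omega>'. X \<omega>' s) s" and f' = "\<lambda>s. field m R (\<lambda>\<omega>'. X' \<omega>' s) s"])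
      (fact D(2-8) fc close zero zero' \<omega>)+
  show ?thesis
    using ae
  proof eventually_elim
    case (elim \<omega>)
    then have \<omega>: "\<omega> \<in> ?D" by simp
    have "X \<omega> = X' \<omega>"
      using eqX[OF \<omega>] by (intro paths_eqI[OF D(3)[OF \<omega>] D(4)[OF \<omega>]]) simp
    moreover have "k \<omega> = k' \<omega>"
      using eqk[OF \<omega>] by (intro paths_eqI[OF D(5)[OF \<omega>] D(6)[OF \<omega>]]) simp
    ultimately show ?case
      by simp
  qed
qed

lemma limit_solution_exists:
  assumes m: "prob_space m" and R: "R \<in> m \<rightarrow>\<^sub>M borel_of (top_of_set I)"
    and W: "W \<in> m \<rightarrow>\<^sub>M borel_of (path_space T UNIV)" and W0: "AE \<omega> in m. W \<omega> 0 = 0"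
  shows "\<exists>X k. limit_solution T I \<tau> \<sigma> \<mu> q' a m W R X k"
proof -
  interpret D: interacting_drift T a "2 * c * Lm" m "\<lambda>\<omega>. \<lambda>t\<in>{0..T}. \<sigma> (R \<omega>) * (W \<omega> t - W \<omega> 0)"
    "\<lambda>s \<xi> \<omega>. 1 / \<tau> (R \<omega>) * (field m R \<xi> s - \<mu> (\<xi> \<omega>))"
    by (rule interacting_drift_field[OF m R W])
  have "limit_solution T I \<tau> \<sigma> \<mu> q' a m W R D.solution D.reflection"
    unfolding limit_solution_field[OF m R D.process_solution D.measurable_reflection]
    using W0 AE_space
  proof eventually_elim
    case (elim \<omega>)
    show ?case
      by (rule reflected_equation_cong[OF D.solution_equation[OF elim(2)]]) (auto simp: elim(1))
  qed
  then show ?thesis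
    by blast
qed

text \<open>The particle system for a frozen sample point. Uniqueness and the comparison with the
  limit dynamics hold path by path, so probability enters only to exclude a null set.\<close>

definition particle_path ::
    "(nat \<Rightarrow> real) \<Rightarrow> (nat \<Rightarrow> real \<Rightarrow> real) \<Rightarrow> nat \<Rightarrow> (nat \<Rightarrow> real \<Rightarrow> real) \<Rightarrow> (nat \<Rightarrow> real \<Rightarrow> real) \<Rightarrow> bool" where
  "particle_path r w n y k \<longleftrightarrow> (\<forall>i<n. y i \<in> paths T {0..1} \<and> k i \<in> paths T UNIV \<and>
    reflected_equation T a (\<lambda>s. 1 / \<tau> (r i) * (field (uniform_count_measure {..<n}) r (\<lambda>j. y j s) s - \<mu> (y i s)))
      (\<lambda>t. \<sigma> (r i) * w i t) (y i) (k i))"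

lemma particle_solution_path:
  assumes r: "\<And>i. r i \<in> I" and Y: "particle_solution T I \<tau> \<sigma> \<mu> q' a r M W n Y K"
  shows "AE \<omega> in M. particle_path r (\<lambda>i. W i \<omega>) n (\<lambda>i. Y i \<omega>) (\<lambda>i. K i \<omega>)"
proof -
  have YK: "Y i \<in> M \<rightarrow>\<^sub>M borel_of (path_space T {0..1})" "K i \<in> M \<rightarrow>\<^sub>M borel_of (path_space T UNIV)" if "i < n" for i
    using Y that by (auto simp: particle_solution_def)
  have "AE \<omega> in M. \<forall>i<n. reflected_equation T a
      (\<lambda>s. 1 / \<tau> (r i) * (field (uniform_count_measure {..<n}) r (\<lambda>j. Y j \<omega> s) s - \<mu> (Y i \<omega> s)))
      (\<lambda>t. \<sigma> (r i) * W i \<omega> t) (Y i \<omega>) (K i \<omega>)"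
    using Y r by (simp add: particle_solution_def Lambda_empirical)
  then show ?thesis
    using AE_space
  proof eventually_elim
    case (elim \<omega>)
    then show ?case
      using measurable_space[OF YK(1) elim(2)] measurable_space[OF YK(2) elim(2)]
      by (auto simp: particle_path_def)
  qed
qed

text \<open>\<open>A\<close> measures how far the prescribed field \<open>f\<close> is from the
  field generated by the decoupled paths \<open>x\<close>. It involves no particle of the coupled
  system; the remaining difference between the two empirical fields is absorbed by the Lipschitz
  estimate.\<close>

lemma particle_path_stability:
  assumes n: "1 \<le> n" and r: "\<And>i. r i \<in> I" and y: "particle_path r w n y k"
    and x: "\<And>i. i < n \<Longrightarrow> x i \<in> paths T {0..1}" "\<And>i. i < n \<Longrightarrow> l i \<in> paths T UNIV"
      "\<And>i. i < n \<Longrightarrow> reflected_equation T a (\<lambda>s. 1 / \<tau> (r i) * (f s - \<mu> (x i s))) (\<lambda>t. \<sigma> (r i) * w i t) (x i) (l i)"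
    and f: "continuous_on {0..T} f" and it: "i < n" "t \<in> {0..T}"
  defines "A \<equiv> LINT s:{0..T}|lborel. \<bar>field (uniform_count_measure {..<n}) r (\<lambda>j. x j s) s - f s\<bar>"
  shows "\<bar>y i t - x i t\<bar> \<le> gain * (c * A)" "\<bar>k i t - l i t\<bar> \<le> gain * (c * A)"
proof -
  let ?m = "uniform_count_measure {..<n}"
  have m: "prob_space ?m"
    using n by (rule prob_space_uniform_count_measure_lessThan)
  have R: "r \<in> ?m \<rightarrow>\<^sub>M borel_of (top_of_set I)"
    using r by (intro measurable_uniform_count_measure) simp
  have y': "y i \<in> paths T {0..1}" "k i \<in> paths T UNIV"
    "reflected_equation T a (\<lambda>s. 1 / \<tau> (r i) * (field ?m r (\<lambda>j. y j s) s - \<mu> (y i s))) (\<lambda>t. \<sigma> (r i) * w i t) (y i) (k i)"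
    if "i < n" for i
    using y that by (auto simp: particle_path_def)
  have py: "process T ?m y" and px: "process T ?m x"
    using y'(1) x(1) by (auto intro: process_uniform_count_measure)
  have cont: "continuous_on {0..T} (\<lambda>s. \<bar>field ?m r (\<lambda>j. x j s) s - f s\<bar>)"
    by (intro continuous_on_rabs continuous_on_diff field_continuous[OF m R px] f)
  have close: "\<bar>field ?m r (\<lambda>j. y j s) s - f s\<bar> \<le> Lm * e + \<bar>field ?m r (\<lambda>j. x j s) s - f s\<bar>"
    if s: "s \<in> {0..T}" and "0 \<le> e" and e: "\<And>j. j \<in> {..<n} \<Longrightarrow> \<bar>y j s - x j s\<bar> \<le> e" for s e
  proof -
    have "\<bar>field ?m r (\<lambda>j. y j s) s - field ?m r (\<lambda>j. x j s) s\<bar> \<le> Lm * e"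
      using e by (intro field_Lipschitz[OF m R processD(2)[OF py s] processD(2)[OF px s]] AE_I2)
        (simp add: space_uniform_count_measure)
    then show ?thesis
      by linarith
  qed
  have fc: "continuous_on {0..T} (\<lambda>s. field ?m r (\<lambda>j. y j s) s)"
    by (rule field_continuous[OF m R py])
  have D: "r i \<in> I" "y i \<in> paths T {0..1}" "x i \<in> paths T {0..1}" "k i \<in> paths T UNIV" "l i \<in> paths T UNIV"
    "reflected_equation T a (\<lambda>s. 1 / \<tau> (r i) * (field ?m r (\<lambda>j. y j s) s - \<mu> (y i s))) (\<lambda>t. \<sigma> (r i) * w i t) (y i) (k i)"
    "reflected_equation T a (\<lambda>s. 1 / \<tau> (r i) * (f s - \<mu> (x i s))) (\<lambda>t. \<sigma> (r i) * w i t) (x i) (l i)"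
    if "i \<in> {..<n}" for i
    using that r y' x by auto
  have pos: "0 \<le> \<bar>field ?m r (\<lambda>j. x j s) s - f s\<bar>" if "s \<in> {0..T}" for s
    by simp
  have it': "i \<in> {..<n}" "t \<in> {0..T}"
    using it by auto
  show "\<bar>y i t - x i t\<bar> \<le> gain * (c * A)"
    unfolding A_def by (rule population_stability(1)[where D = "{..<n}" and \<rho> = r and z = "\<lambda>i t. \<sigma> (r i) * w i t"
      and x = y and x' = x and k = k and k' = l and i = i and t = t
      and f = "\<lambda>s. field ?m r (\<lambda>j. y j s) s" and f' = f and \<epsilon> = "\<lambda>s. \<bar>field ?m r (\<lambda>j. x j s) s - f s\<bar>"])
      (fact D fc f close cont pos it')+
  show "\<bar>k i t - l i t\<bar> \<le> gain * (c * A)"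
    unfolding A_def by (rule population_stability(2)[where D = "{..<n}" and \<rho> = r and z = "\<lambda>i t. \<sigma> (r i) * w i t"
      and x = y and x' = x and k = k and k' = l and i = i and t = t
      and f = "\<lambda>s. field ?m r (\<lambda>j. y j s) s" and f' = f and \<epsilon> = "\<lambda>s. \<bar>field ?m r (\<lambda>j. x j s) s - f s\<bar>"])
      (fact D fc f close cont pos it')+
qed

text \<open>The second solution is a decoupled family for the field it generates itself, and with
  this choice of \<open>f\<close> the discrepancy vanishes.\<close>

lemma particle_path_unique:
  assumes n: "1 \<le> n" and r: "\<And>i. r i \<in> I"
    and y: "particle_path r w n y k" and y': "particle_path r w n y' k'" and i: "i < n"
  shows "y i = y' i \<and> k i = k' i"
proof -
  let ?m = "uniform_count_measure {..<n}"
  have p: "y' i \<in> paths T {0..1}" "k' i \<in> paths T UNIV"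
    "reflected_equation T a (\<lambda>s. 1 / \<tau> (r i) * (field ?m r (\<lambda>j. y' j s) s - \<mu> (y' i s))) (\<lambda>t. \<sigma> (r i) * w i t) (y' i) (k' i)"
    if "i < n" for i
    using y' that by (auto simp: particle_path_def)
  have m: "prob_space ?m"
    using n by (rule prob_space_uniform_count_measure_lessThan)
  have R: "r \<in> ?m \<rightarrow>\<^sub>M borel_of (top_of_set I)"
    using r by (intro measurable_uniform_count_measure) simp
  have "continuous_on {0..T} (\<lambda>s. field ?m r (\<lambda>j. y' j s) s)"
    using p(1) by (intro field_continuous[OF m R] process_uniform_count_measure)
  note st = particle_path_stability[OF n r y p this i]
  have "y i = y' i" "k i = k' i"
    using y i st p(1,2)[OF i] by (auto simp: particle_path_def intro!: paths_eqI)
  then show ?thesis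
    by simp
qed

text \<open>The fixed point is taken on pairs of an index and a sample point, which yields
  measurability in the sample point together with existence. Interaction stays within the slice of
  pairs that share the sample point.\<close>

lemma particle_solution_exists:
  assumes n: "1 \<le> n" and r: "\<And>i. r i \<in> I" and W: "\<And>i. W i \<in> M \<rightarrow>\<^sub>M borel_of (path_space T UNIV)"
    and W0: "AE \<omega> in M. \<forall>i<n. W i \<omega> 0 = 0"
  shows "\<exists>Y K. particle_solution T I \<tau> \<sigma> \<mu> q' a r M W n Y K"
proof -
  let ?m = "uniform_count_measure {..<n}"
  let ?N = "count_space {..<n} \<Otimes>\<^sub>M M"
  let ?z = "\<lambda>p. \<lambda>t\<in>{0..T}. \<sigma> (r (fst p)) * (W (fst p) (snd p) t - W (fst p) (snd p) 0)"
  let ?b = "\<lambda>s \<xi> p. 1 / \<tau> (r (fst p)) * (field ?m r (\<lambda>j. \<xi> (j, snd p)) s - \<mu> (\<xi> p))"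
  have m: "prob_space ?m"
    using n by (rule prob_space_uniform_count_measure_lessThan)
  have R: "r \<in> ?m \<rightarrow>\<^sub>M borel_of (top_of_set I)"
    using r by (intro measurable_uniform_count_measure) simp
  have slice: "process T ?m (\<lambda>j. X (j, \<omega>))" if X: "process T ?N X" and \<omega>: "\<omega> \<in> space M" for X \<omega>
    using \<omega> by (intro process_uniform_count_measure processD(1)[OF X]) (auto simp: space_pair_measure)
  have part: "(\<lambda>\<omega>. X (j, \<omega>) s) \<in> borel_measurable M"
    if X: "process T ?N X" and s: "s \<in> {0..T}" and j: "j < n" for X s j
    using measurable_compose[OF measurable_Pair1'[of j "count_space {..<n}" M] processD(2)[OF X s]] j by simp
  interpret D: interacting_drift T a "2 * c * Lm" ?N ?z ?b
  proof
    show "?z \<in> ?N \<rightarrow>\<^sub>M borel_of (path_space T UNIV)"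
    proof (rule measurable_pair_measure_countable1)
      show "(\<lambda>\<omega>. ?z (i, \<omega>)) \<in> M \<rightarrow>\<^sub>M borel_of (path_space T UNIV)" for i
        using r measurable_noise[OF measurable_const W, of "r i" i] by simp
    qed simp
    show "?z p 0 = 0" for p
      using T0 by simp
    show "continuous_on {0..T} (\<lambda>s. ?b s (\<lambda>p. X p s) p)" if X: "process T ?N X" and p: "p \<in> space ?N" for X p
      using p
      by (intro continuous_on_mult continuous_on_const continuous_on_diff field_continuous[OF m R slice[OF X]]
        continuous_on_compose2[OF mu_continuous[of UNIV] pathsD(3)[OF processD(1)[OF X p]]])
        (auto simp: space_pair_measure)
    show "?b s (\<lambda>p. X p s) \<in> borel_measurable ?N" if X: "process T ?N X" and s: "s \<in> {0..T}" for X s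
    proof (rule measurable_pair_measure_countable1)
      fix i assume i: "i \<in> {..<n}"
      \<comment> \<open>As an average of finitely many terms the field is visibly measurable in the
        sample point.\<close>
      have "(\<integral>j. \<mu> (X (j, \<omega>) s) * (vol (r j) / \<tau> (r j)) \<partial>?m) = (\<Sum>j<n. \<mu> (X (j, \<omega>) s) * (vol (r j) / \<tau> (r j))) / real n" for \<omega>
        by (simp add: integral_uniform_count_measure)
      then have "(\<lambda>\<omega>. field ?m r (\<lambda>j. X (j, \<omega>) s) s) \<in> borel_measurable M \<longleftrightarrow>
          (\<lambda>\<omega>. ((\<integral>j. vol (r j) \<partial>?m) * q' s + (\<Sum>j<n. \<mu> (X (j, \<omega>) s) * (vol (r j) / \<tau> (r j))) / real n)
            / (\<integral>j. vol (r j) / \<tau> (r j) \<partial>?m)) \<in> borel_measurable M"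
        using field_parts(5)[OF m R processD(2)[OF slice[OF X] s]] by (intro measurable_cong) simp
      moreover have "(\<lambda>\<omega>. ((\<integral>j. vol (r j) \<partial>?m) * q' s + (\<Sum>j<n. \<mu> (X (j, \<omega>) s) * (vol (r j) / \<tau> (r j))) / real n)
            / (\<integral>j. vol (r j) / \<tau> (r j) \<partial>?m)) \<in> borel_measurable M"
        by (intro borel_measurable_divide borel_measurable_add borel_measurable_sum borel_measurable_times
            borel_measurable_const measurable_mu part[OF X s]) auto
      ultimately show "(\<lambda>\<omega>. ?b s (\<lambda>p. X p s) (i, \<omega>)) \<in> borel_measurable M"
        using i by (simp, intro borel_measurable_times borel_measurable_diff borel_measurable_divide
            borel_measurable_const measurable_mu part[OF X s]) auto
    qed simp
    show "\<bar>?b s (\<lambda>p. X p s) p - ?b s (\<lambda>p. X' p s) p\<bar> \<le> 2 * c * Lm * e"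
      if X: "process T ?N X" "process T ?N X'" and s: "s \<in> {0..T}"
        and le: "\<And>p. p \<in> space ?N \<Longrightarrow> \<bar>X p s - X' p s\<bar> \<le> e" and p: "p \<in> space ?N" for X X' s e p
    proof -
      let ?f = "\<lambda>X. field ?m r (\<lambda>j. X (j, snd p) s) s"
      have p2: "snd p \<in> space M"
        using p by (auto simp: space_pair_measure)
      have "\<bar>?f X - ?f X'\<bar> \<le> Lm * e"
        using le p2
        by (intro field_Lipschitz[OF m R processD(2)[OF slice[OF X(1) p2] s] processD(2)[OF slice[OF X(2) p2] s]] AE_I2)
          (auto simp: space_uniform_count_measure space_pair_measure)
      then show ?thesis
        using drift_Lipschitz[OF r le[OF p], of _ _ 0] by simp
    qed
  qed (use T a c Lm in auto)
  have sec: "(\<lambda>\<omega>. (i, \<omega>)) \<in> M \<rightarrow>\<^sub>M ?N" if "i < n" for i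
    using that by (intro measurable_Pair1') simp
  have "particle_solution T I \<tau> \<sigma> \<mu> q' a r M W n (\<lambda>i \<omega>. D.solution (i, \<omega>)) (\<lambda>i \<omega>. D.reflection (i, \<omega>))"
    unfolding particle_solution_def
  proof (intro conjI allI impI)
    show "(\<lambda>\<omega>. D.solution (i, \<omega>)) \<in> M \<rightarrow>\<^sub>M borel_of (path_space T {0..1})" if "i < n" for i
      using D.process_solution unfolding process_def by (rule measurable_compose[OF sec[OF that]])
    show "(\<lambda>\<omega>. D.reflection (i, \<omega>)) \<in> M \<rightarrow>\<^sub>M borel_of (path_space T UNIV)" if "i < n" for i
      by (rule measurable_compose[OF sec[OF that] D.measurable_reflection])
    show "AE \<omega> in M. \<forall>i<n. reflected_equation T a
        (\<lambda>s. 1 / \<tau> (r i) * (Lambda \<tau> \<mu> q' s (empirical (state_space I) n (\<lambda>j. (D.solution (j, \<omega>) s, r j))) - \<mu> (D.solution (i, \<omega>) s)))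
        (\<lambda>t. \<sigma> (r i) * W i \<omega> t) (D.solution (i, \<omega>)) (D.reflection (i, \<omega>))"
      using W0 AE_space
    proof eventually_elim
      case (elim \<omega>)
      show ?case
      proof (intro allI impI)
        fix i assume i: "i < n"
        then have p: "(i, \<omega>) \<in> space ?N"
          using elim(2) by (simp add: space_pair_measure)
        show "reflected_equation T a
          (\<lambda>s. 1 / \<tau> (r i) * (Lambda \<tau> \<mu> q' s (empirical (state_space I) n (\<lambda>j. (D.solution (j, \<omega>) s, r j))) - \<mu> (D.solution (i, \<omega>) s)))
          (\<lambda>t. \<sigma> (r i) * W i \<omega> t) (D.solution (i, \<omega>)) (D.reflection (i, \<omega>))"
          by (rule reflected_equation_cong[OF D.solution_equation[OF p]]) (use elim(1) i r in \<open>auto simp: Lambda_empirical\<close>)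
      qed
    qed
  qed
  then show ?thesis
    by blast
qed

end

section \<open>Convergence of the particle system\<close>

context population
begin

abbreviation input_space :: "((real \<Rightarrow> real) \<times> real) topology" where
  "input_space \<equiv> prod_topology (path_space T UNIV) (top_of_set I)"

text \<open>The bound is uniform in the measure and the configuration. It dominates the field
  discrepancies over time and controls the effect of a change of the radius.\<close>

lemma field_bound:
  assumes m: "prob_space m" and R: "R \<in> m \<rightarrow>\<^sub>M borel_of (top_of_set I)" and \<xi>: "\<xi> \<in> borel_measurable m"
    and s: "s \<in> {0..T}"
  shows "\<bar>field m R \<xi> s\<bar> \<le> (uB * qB + mB * wB) / w0"
proof -
  interpret prob_space m by (rule m)
  note P = field_parts[OF m R \<xi>]
  let ?n = "\<lambda>\<omega>. vol (R \<omega>) * q' s + \<mu> (\<xi> \<omega>) * (vol (R \<omega>) / \<tau> (R \<omega>))"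
  have n: "\<bar>?n \<omega>\<bar> \<le> uB * qB + mB * wB" if "\<omega> \<in> space m" for \<omega>
  proof -
    have RI: "R \<omega> \<in> I"
      using radius_in[OF R that] .
    have "\<bar>vol (R \<omega>) * q' s\<bar> \<le> uB * qB"
      unfolding abs_mult using uB[OF RI] qB(2)[OF s] by (intro mult_mono) auto
    moreover have "\<bar>\<mu> (\<xi> \<omega>) * (vol (R \<omega>) / \<tau> (R \<omega>))\<bar> \<le> mB * wB"
      unfolding abs_mult using mB[of "\<xi> \<omega>"] weight(1) weight(3)[OF RI] by (intro mult_mono) auto
    ultimately show ?thesis
      by linarith
  qed
  have "integrable m ?n"
    using P(1,3) by simp
  then have "\<bar>\<integral>\<omega>. ?n \<omega> \<partial>m\<bar> \<le> (\<integral>\<omega>. uB * qB + mB * wB \<partial>m)"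
    by (intro order_trans[OF integral_abs_bound] integral_mono n) auto
  then have num: "\<bar>\<integral>\<omega>. ?n \<omega> \<partial>m\<bar> \<le> uB * qB + mB * wB"
    by (simp add: prob_space)
  show ?thesis
    unfolding field_def abs_divide using num P(4) weight(1) by (intro frac_le) auto
qed

lemma field_distr:
  assumes g: "g \<in> m \<rightarrow>\<^sub>M n" and R: "R \<in> n \<rightarrow>\<^sub>M borel_of (top_of_set I)" and \<xi>: "\<xi> \<in> borel_measurable n"
  shows "field (distr m n g) R \<xi> s = field m (\<lambda>\<omega>. R (g \<omega>)) (\<lambda>\<omega>. \<xi> (g \<omega>)) s"
proof -
  have "(\<lambda>p. vol (R p) * q' s + \<mu> (\<xi> p) * (vol (R p) / \<tau> (R p))) \<in> borel_measurable n"
    "(\<lambda>p. vol (R p) / \<tau> (R p)) \<in> borel_measurable n"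
    by (intro borel_measurable_add borel_measurable_times borel_measurable_const measurable_mu[OF \<xi>]
        measurable_radius[OF R vol_continuous] measurable_radius[OF R weight(2)])+
  then show ?thesis
    unfolding field_def by (simp add: integral_distr[OF g])
qed

text \<open>On the input space itself the solution is a map defined at every pair of path and
  radius, the path being shifted to start at 0. Its continuity is what makes weak convergence of the
  inputs applicable.\<close>

lemma canonical_solution:
  assumes \<nu>: "prob_space \<nu>" "sets \<nu> = sets (borel_of (path_space T UNIV) \<Otimes>\<^sub>M borel_of (top_of_set I))"
  shows "\<exists>x k. process T \<nu> x \<and> k \<in> \<nu> \<rightarrow>\<^sub>M borel_of (path_space T UNIV) \<and>
    continuous_map input_space (path_space T {0..1}) x \<and> continuous_map input_space (path_space T UNIV) k \<and>
    (\<forall>\<theta>\<in>topspace input_space. reflected_equation T a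
      (\<lambda>s. 1 / \<tau> (snd \<theta>) * (field \<nu> snd (\<lambda>\<theta>. x \<theta> s) s - \<mu> (x \<theta> s)))
      (\<lambda>t. \<sigma> (snd \<theta>) * (fst \<theta> t - fst \<theta> 0)) (x \<theta>) (k \<theta>))"
proof -
  have R: "snd \<in> \<nu> \<rightarrow>\<^sub>M borel_of (top_of_set I)" and W: "fst \<in> \<nu> \<rightarrow>\<^sub>M borel_of (path_space T UNIV)"
    using measurable_cong_sets[OF \<nu>(2) refl] by auto
  have sp: "space \<nu> = topspace input_space"
    using sets_eq_imp_space_eq[OF \<nu>(2)] by (simp add: space_pair_measure)
  interpret D: interacting_drift T a "2 * c * Lm" \<nu> "\<lambda>\<theta>. \<lambda>t\<in>{0..T}. \<sigma> (snd \<theta>) * (fst \<theta> t - fst \<theta> 0)"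
    "\<lambda>s \<xi> \<theta>. 1 / \<tau> (snd \<theta>) * (field \<nu> snd \<xi> s - \<mu> (\<xi> \<theta>))"
    by (rule interacting_drift_field[OF \<nu>(1) R W])
  let ?x = "D.solution" and ?k = "D.reflection"
  \<comment> \<open>Once the field is frozen as a function of time, the equation at one input no
    longer refers to the other inputs, and two inputs can be compared by themselves.\<close>
  define f where "f s = field \<nu> snd (\<lambda>\<theta>. ?x \<theta> s) s" for s
  have fc: "continuous_on {0..T} f"
    unfolding f_def by (rule field_continuous[OF \<nu>(1) R D.process_solution])
  define F where "F = (uB * qB + mB * wB) / w0"
  have F: "\<bar>f s\<bar> \<le> F" if "s \<in> {0..T}" for s
    unfolding f_def F_def using that by (intro field_bound[OF \<nu>(1) R] processD(2)[OF D.process_solution])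
  have eq: "reflected_equation T a (\<lambda>s. 1 / \<tau> (snd \<theta>) * (f s - \<mu> (?x \<theta> s)))
      (\<lambda>t. \<sigma> (snd \<theta>) * (fst \<theta> t - fst \<theta> 0)) (?x \<theta>) (?k \<theta>)" if "\<theta> \<in> topspace input_space" for \<theta>
    using that by (intro reflected_equation_cong[OF D.solution_equation]) (auto simp: sp f_def)
  have xp: "?x \<theta> \<in> paths T {0..1}" and kp: "?k \<theta> \<in> paths T UNIV" if "\<theta> \<in> topspace input_space" for \<theta>
    using that processD(1)[OF D.process_solution, of \<theta>] measurable_space[OF D.measurable_reflection, of \<theta>]
    by (simp_all add: sp)
  have F0: "0 \<le> F + mB"
    using F[of 0] mB[of 0] T0 by auto
  have bc: "continuous_on {0..T} (\<lambda>s. 1 / \<tau> (snd \<theta>) * (f s - \<mu> (?x \<theta> s)))" if "\<theta> \<in> topspace input_space" for \<theta>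
    by (intro continuous_on_mult continuous_on_const continuous_on_diff fc
        continuous_on_compose2[OF mu_continuous[of UNIV] pathsD(3)[OF xp[OF that]]]) auto
  have est: "\<bar>?x \<theta>' t - ?x \<theta> t\<bar> \<le> gain * (T * (Lc * d * (F + mB)) + (2 * Ls * B * d + 2 * sB * d)) \<and>
      \<bar>?k \<theta>' t - ?k \<theta> t\<bar> \<le> gain * (T * (Lc * d * (F + mB)) + (2 * Ls * B * d + 2 * sB * d))"
    if \<theta>: "\<theta> \<in> topspace input_space" "\<theta>' \<in> topspace input_space"
      and d: "\<bar>snd \<theta>' - snd \<theta>\<bar> \<le> d" "\<And>s. s \<in> {0..T} \<Longrightarrow> \<bar>fst \<theta>' s - fst \<theta> s\<bar> \<le> d"
      and B: "\<And>s. s \<in> {0..T} \<Longrightarrow> \<bar>fst \<theta> s\<bar> \<le> B" and t: "t \<in> {0..T}" for \<theta> \<theta>' d B t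
  proof -
    have I: "snd \<theta> \<in> I" "snd \<theta>' \<in> I"
      using \<theta> by auto
    have d0: "0 \<le> d" using d(1) by linarith
    have B0: "0 \<le> B" using B[of 0] T0 by auto
    \<comment> \<open>Two single inputs are compared: the index set is \<open>{()}\<close>, the
      noises differ in scale and path, the drifts in rate and position.\<close>
    let ?z = "\<lambda>\<theta> (_::unit) t. \<sigma> (snd \<theta>) * (fst \<theta> t - fst \<theta> 0)"
      and ?b = "\<lambda>\<theta> (_::unit) s. 1 / \<tau> (snd \<theta>) * (f s - \<mu> (?x \<theta> s))"
      and ?e = "\<lambda>_::real. Lc * d * (F + mB)"
    have z: "\<bar>?z \<theta>' i s - ?z \<theta> i s\<bar> \<le> 2 * Ls * B * d + 2 * sB * d" if i: "i \<in> {()}" and s: "s \<in> {0..T}" for i s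
    proof -
      \<comment> \<open>The change of scale is charged to the fixed path
        \<open>fst \<theta>\<close>, bounded by \<open>B\<close>, and the change of path to the
        other scale, bounded by \<open>sB\<close>. The estimate is therefore local in the first
        input.\<close>
      have "?z \<theta>' i s - ?z \<theta> i s = (\<sigma> (snd \<theta>') - \<sigma> (snd \<theta>)) * (fst \<theta> s - fst \<theta> 0)
          + \<sigma> (snd \<theta>') * ((fst \<theta>' s - fst \<theta> s) - (fst \<theta>' 0 - fst \<theta> 0))"
        by (simp add: algebra_simps)
      moreover have "\<bar>(\<sigma> (snd \<theta>') - \<sigma> (snd \<theta>)) * (fst \<theta> s - fst \<theta> 0)\<bar> \<le> (Ls * d) * (2 * B)"
      proof -
        have "\<bar>\<sigma> (snd \<theta>') - \<sigma> (snd \<theta>)\<bar> \<le> Ls * d"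
          using Ls(2)[OF I(2,1)] mult_left_mono[OF d(1) Ls(1)] by linarith
        moreover have "\<bar>fst \<theta> s - fst \<theta> 0\<bar> \<le> 2 * B"
          using B[OF s] B[of 0] T0 by auto
        ultimately show ?thesis
          unfolding abs_mult using Ls(1) d0 by (intro mult_mono) auto
      qed
      moreover have "\<bar>\<sigma> (snd \<theta>') * ((fst \<theta>' s - fst \<theta> s) - (fst \<theta>' 0 - fst \<theta> 0))\<bar> \<le> sB * (2 * d)"
        unfolding abs_mult using sB(2)[OF I(2)] sB(1) d(2)[OF s] d(2)[of 0] T0 by (intro mult_mono) auto
      ultimately show ?thesis
        by (simp add: algebra_simps)
    qed
    have close: "\<bar>?b \<theta>' i s - ?b \<theta> i s\<bar> \<le> 2 * c * Lm * e + ?e s"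
      if s: "s \<in> {0..T}" and e: "0 \<le> e" "\<And>j. j \<in> {()} \<Longrightarrow> \<bar>?x \<theta>' s - ?x \<theta> s\<bar> \<le> e" and i: "i \<in> {()}" for s e i
    proof -
      \<comment> \<open>The field being common to both, only the change of the rate and the change
        of position contribute.\<close>
      have "?b \<theta>' i s - ?b \<theta> i s = (1 / \<tau> (snd \<theta>') - 1 / \<tau> (snd \<theta>)) * (f s - \<mu> (?x \<theta>' s))
          + 1 / \<tau> (snd \<theta>) * (\<mu> (?x \<theta> s) - \<mu> (?x \<theta>' s))"
        by (simp add: algebra_simps)
      moreover have "\<bar>(1 / \<tau> (snd \<theta>') - 1 / \<tau> (snd \<theta>)) * (f s - \<mu> (?x \<theta>' s))\<bar> \<le> (Lc * d) * (F + mB)"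
      proof -
        have "\<bar>1 / \<tau> (snd \<theta>') - 1 / \<tau> (snd \<theta>)\<bar> \<le> Lc * d"
          using Lc(2)[OF I(2,1)] mult_left_mono[OF d(1) Lc(1)] by linarith
        moreover have "\<bar>f s - \<mu> (?x \<theta>' s)\<bar> \<le> F + mB"
          using F[OF s] mB[of "?x \<theta>' s"] by linarith
        ultimately show ?thesis
          unfolding abs_mult using Lc(1) d0 by (intro mult_mono) auto
      qed
      moreover have "\<bar>1 / \<tau> (snd \<theta>) * (\<mu> (?x \<theta> s) - \<mu> (?x \<theta>' s))\<bar> \<le> c * (Lm * e)"
      proof -
        have "\<bar>\<mu> (?x \<theta> s) - \<mu> (?x \<theta>' s)\<bar> \<le> Lm * \<bar>?x \<theta>' s - ?x \<theta> s\<bar>"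
          using Lm(2)[of "?x \<theta> s" "?x \<theta>' s"] by (simp add: abs_minus_commute)
        also have "\<dots> \<le> Lm * e"
          using e(2) Lm(1) by (intro mult_left_mono) auto
        finally show ?thesis
          unfolding abs_mult using c(1) c(2)[OF I(1)] by (intro mult_mono) auto
      qed
      moreover have "0 \<le> c * (Lm * e)"
        using c(1) Lm(1) e(1) by simp
      ultimately have "\<bar>?b \<theta>' i s - ?b \<theta> i s\<bar> \<le> 2 * (c * (Lm * e)) + (Lc * d) * (F + mB)"
        by linarith
      then show ?thesis
        by (simp only: mult.assoc)
    qed
    have L: "0 < 2 * c * Lm"
      using c(1) Lm(1) by simp
    have D: "reflected_equation T a (?b \<theta>' i) (?z \<theta>' i) (?x \<theta>') (?k \<theta>')"
      "reflected_equation T a (?b \<theta> i) (?z \<theta> i) (?x \<theta>) (?k \<theta>)"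
      "?x \<theta>' \<in> paths T {0..1}" "?x \<theta> \<in> paths T {0..1}" "?k \<theta>' \<in> paths T UNIV" "?k \<theta> \<in> paths T UNIV"
      "continuous_on {0..T} (?b \<theta>' i)" "continuous_on {0..T} (?b \<theta> i)" if "i \<in> {()}" for i
      using eq xp kp bc \<theta> by auto
    have ec: "continuous_on {0..T} ?e"
      by simp
    have e0: "0 \<le> ?e s" if "s \<in> {0..T}" for s
      using Lc(1) d0 F0 by simp
    have "(LINT s:{0..T}|lborel. ?e s) \<le> T * (Lc * d * (F + mB))"
      using T0 by (simp add: set_lebesgue_integral_def)
    note \<eta> = this
    have i: "() \<in> {()}" by simp
    have "\<bar>?x \<theta>' t - ?x \<theta> t\<bar> \<le> 4 * exp (4 * (2 * c * Lm) * T) * (T * (Lc * d * (F + mB)) + (2 * Ls * B * d + 2 * sB * d))"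
      by (rule reflected_stability(1)[where D = "{()}" and i = "()" and t = t and a = a and \<epsilon> = ?e
          and x = "\<lambda>_. ?x \<theta>'" and x' = "\<lambda>_. ?x \<theta>" and k = "\<lambda>_. ?k \<theta>'" and k' = "\<lambda>_. ?k \<theta>"
          and b = "?b \<theta>'" and b' = "?b \<theta>" and z = "?z \<theta>'" and z' = "?z \<theta>"])
        (fact T L D z close ec e0 \<eta> i t)+
    moreover have "\<bar>?k \<theta>' t - ?k \<theta> t\<bar> \<le> 4 * exp (4 * (2 * c * Lm) * T) * (T * (Lc * d * (F + mB)) + (2 * Ls * B * d + 2 * sB * d))"
      by (rule reflected_stability(2)[where D = "{()}" and i = "()" and t = t and a = a and \<epsilon> = ?e
          and x = "\<lambda>_. ?x \<theta>'" and x' = "\<lambda>_. ?x \<theta>" and k = "\<lambda>_. ?k \<theta>'" and k' = "\<lambda>_. ?k \<theta>"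
          and b = "?b \<theta>'" and b' = "?b \<theta>" and z = "?z \<theta>'" and z' = "?z \<theta>"])
        (fact T L D z close ec e0 \<eta> i t)+
    ultimately show ?thesis
      unfolding gain_def by blast
  qed
  have nbhd: "\<exists>U. openin input_space U \<and> \<theta> \<in> U \<and>
      (\<forall>\<theta>'\<in>U. \<forall>t\<in>{0..T}. \<bar>?x \<theta>' t - ?x \<theta> t\<bar> \<le> e \<and> \<bar>?k \<theta>' t - ?k \<theta> t\<bar> \<le> e)"
    if \<theta>: "\<theta> \<in> topspace input_space" and e: "0 < e" for \<theta> e
  proof -
    have w: "fst \<theta> \<in> paths T UNIV" and wc: "continuous_on {0..T} (fst \<theta>)" and r: "snd \<theta> \<in> I"
      using \<theta> by (auto intro: pathsD(3))
    have "bounded (fst \<theta> ` {0..T})"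
      using wc by (intro compact_imp_bounded compact_continuous_image) auto
    then obtain B where B: "\<forall>s\<in>{0..T}. \<bar>fst \<theta> s\<bar> \<le> B"
      by (auto simp: bounded_iff)
    have B0: "0 \<le> B" using B T0 by force
    \<comment> \<open>All error terms are proportional to the distance \<open>d\<close> of the
      inputs; \<open>H\<close> collects the factors, and \<open>H + 1\<close> avoids division by
      zero.\<close>
    define H where "H = gain * (T * (Lc * (F + mB)) + (2 * Ls * B + 2 * sB))"
    have H0: "0 \<le> H"
      unfolding H_def using gain_pos T0 Lc(1) F0 Ls(1) B0 sB(1) by simp
    define d where "d = e / (H + 1)"
    have d: "0 < d" "H * d \<le> e"
      using e H0 by (auto simp: d_def field_simps)
    let ?U = "{f \<in> paths T UNIV. sup_dist T f (fst \<theta>) < d} \<times> (I \<inter> {snd \<theta> - d<..<snd \<theta> + d})"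
    show ?thesis
    proof (intro exI[of _ ?U] conjI ballI)
      show "openin input_space ?U"
        unfolding openin_prod_Times_iff
        by (intro disjI2 conjI openin_path_ball[OF T0 wc] openin_open_Int) auto
      have "sup_dist T (fst \<theta>) (fst \<theta>) \<le> 0"
        by (rule sup_dist_least[OF T0 wc wc]) simp
      then show "\<theta> \<in> ?U"
        using w r d(1) by (simp add: mem_Times_iff)
      fix \<theta>' t assume \<theta>': "\<theta>' \<in> ?U" and t: "t \<in> {0..T}"
      then have w': "continuous_on {0..T} (fst \<theta>')" and "\<theta>' \<in> topspace input_space"
        by (auto simp: mem_Times_iff intro: pathsD(3))
      moreover have "\<bar>snd \<theta>' - snd \<theta>\<bar> \<le> d"
        using \<theta>' by (auto simp: mem_Times_iff)
      moreover have "\<bar>fst \<theta>' s - fst \<theta> s\<bar> \<le> d" if "s \<in> {0..T}" for s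
        using sup_dist_upper[OF T0 w' wc that] \<theta>' by (auto simp: mem_Times_iff)
      moreover have "gain * (T * (Lc * d * (F + mB)) + (2 * Ls * B * d + 2 * sB * d)) = H * d"
        by (simp add: H_def algebra_simps)
      ultimately show "\<bar>?x \<theta>' t - ?x \<theta> t\<bar> \<le> e" "\<bar>?k \<theta>' t - ?k \<theta> t\<bar> \<le> e"
        using est[OF \<theta> _ _ _ _ t, of \<theta>' d B] B d(2) by auto
    qed
  qed
  have "continuous_map input_space (path_space T {0..1}) ?x"
  proof (rule continuous_map_into_path_space[OF T0 xp])
    show "\<exists>U. openin input_space U \<and> p \<in> U \<and> (\<forall>q\<in>U. \<forall>t\<in>{0..T}. \<bar>?x q t - ?x p t\<bar> \<le> e)"
      if "p \<in> topspace input_space" "0 < e" for p e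
      using nbhd[OF that] by blast
  qed
  moreover have "continuous_map input_space (path_space T UNIV) ?k"
  proof (rule continuous_map_into_path_space[OF T0 kp])
    show "\<exists>U. openin input_space U \<and> p \<in> U \<and> (\<forall>q\<in>U. \<forall>t\<in>{0..T}. \<bar>?k q t - ?k p t\<bar> \<le> e)"
      if "p \<in> topspace input_space" "0 < e" for p e
      using nbhd[OF that] by blast
  qed
  ultimately show ?thesis
    using D.process_solution D.measurable_reflection eq unfolding f_def
    by (intro exI[of _ ?x] exI[of _ ?k]) blast
qed

lemma continuous_map_radius:
  assumes "continuous_on I g"
  shows "continuous_map input_space euclideanreal (\<lambda>\<theta>. g (snd \<theta>))"
  using continuous_map_compose[OF continuous_map_snd, of "top_of_set I" euclideanreal g "path_space T UNIV"] assms
  by (simp add: o_def)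

text \<open>A deterministic statement in which randomness has been reduced to \<open>weak\<close>.
  The decoupled paths \<open>x (\<theta> i)\<close> are values of a fixed continuous map at the
  inputs, so their averages converge. The particles follow them with an error that is uniform in the
  index.\<close>

lemma particle_paths_converge:
  assumes \<nu>: "prob_space \<nu>" "sets \<nu> = sets (borel_of (path_space T UNIV) \<Otimes>\<^sub>M borel_of (top_of_set I))"
    and x: "process T \<nu> x" "continuous_map input_space (path_space T {0..1}) x"
    and k: "continuous_map input_space (path_space T UNIV) k"
    and eq: "\<And>\<theta>. \<theta> \<in> topspace input_space \<Longrightarrow> reflected_equation T a
      (\<lambda>s. 1 / \<tau> (snd \<theta>) * (field \<nu> snd (\<lambda>\<theta>. x \<theta> s) s - \<mu> (x \<theta> s)))
      (\<lambda>t. \<sigma> (snd \<theta>) * (fst \<theta> t - fst \<theta> 0)) (x \<theta>) (k \<theta>)"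
    and w: "\<And>i. w i \<in> paths T UNIV" "\<And>i. w i 0 = 0" and r: "\<And>i. r i \<in> I"
    and weak: "weak_conv_on input_space (\<lambda>N. empirical input_space N (\<lambda>i. (w i, r i))) \<nu>"
    and Y: "\<And>N. 1 \<le> N \<Longrightarrow> particle_path r w N (Y N) (K N)"
  shows "weak_conv_on (reflected_path_space T)
    (\<lambda>N. empirical (reflected_path_space T) N (\<lambda>i. (Y N i, K N i)))
    (distr \<nu> (borel_of (reflected_path_space T)) (\<lambda>\<theta>. (x \<theta>, k \<theta>)))"
proof -
  interpret \<nu>: prob_space \<nu> by fact
  let ?P = "reflected_path_space T"
  define \<theta> where "\<theta> i = (w i, r i)" for i
  have \<theta>: "\<theta> i \<in> topspace input_space" "fst (\<theta> i) = w i" "snd (\<theta> i) = r i" for i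
    using w r by (auto simp: \<theta>_def)
  have xp: "x p \<in> paths T {0..1}" and kp: "k p \<in> paths T UNIV" if "p \<in> topspace input_space" for p
    using that x(2) k by (auto simp: continuous_map_def)
  have R: "snd \<in> \<nu> \<rightarrow>\<^sub>M borel_of (top_of_set I)"
    using measurable_cong_sets[OF \<nu>(2) refl] by auto
  have sc: "second_countable (path_space T S)" for S
    by (rule second_countable_path_space[OF T])
  have setsE: "sets \<nu> = sets (borel_of input_space)"
    unfolding sets_borel_of_prod[OF sc second_countable_euclidean] by (rule \<nu>(2))
  have avg: "(\<lambda>N. (\<Sum>i<N. g (\<theta> i)) / real N) \<longlonglongrightarrow> (\<integral>p. g p \<partial>\<nu>)"
    if g: "continuous_map input_space euclideanreal g" and B: "\<And>p. p \<in> topspace input_space \<Longrightarrow> \<bar>g p\<bar> \<le> B" for g B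
  proof -
    have "bounded (g ` topspace input_space)"
      unfolding bounded_iff using B by (intro exI[of _ B]) auto
    then have "(\<lambda>N. \<integral>p. g p \<partial>empirical input_space N \<theta>) \<longlonglongrightarrow> (\<integral>p. g p \<partial>\<nu>)"
      using weak g unfolding weak_conv_on_def \<theta>_def by blast
    moreover have "(\<integral>p. g p \<partial>empirical input_space N \<theta>) = (\<Sum>i<N. g (\<theta> i)) / real N" for N
      using continuous_map_measurable[OF g] \<theta>(1) by (intro integral_empirical) (simp_all add: borel_of_euclidean)
    ultimately show ?thesis
      by simp
  qed
  define f where "f s = field \<nu> snd (\<lambda>p. x p s) s" for s
  have fc: "continuous_on {0..T} f"
    unfolding f_def by (rule field_continuous[OF \<nu>(1) R x(1)])
  let ?m = "\<lambda>N. uniform_count_measure {..<N :: nat}"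
  have m: "prob_space (?m N)" "r \<in> ?m N \<rightarrow>\<^sub>M borel_of (top_of_set I)" "process T (?m N) (\<lambda>i. x (\<theta> i))" if "1 \<le> N" for N
    using that r xp[OF \<theta>(1)] prob_space_uniform_count_measure_lessThan[OF that]
    by (auto intro: measurable_uniform_count_measure process_uniform_count_measure)
  define \<epsilon> where "\<epsilon> N s = \<bar>field (?m N) r (\<lambda>i. x (\<theta> i) s) s - f s\<bar>" for N s
  have \<epsilon>0: "(\<lambda>N. \<epsilon> N s) \<longlonglongrightarrow> 0" if s: "s \<in> {0..T}" for s
  proof -
    \<comment> \<open>At a fixed time, numerator and denominator of the field along the decoupled
      paths are averages of bounded continuous functions of the inputs.\<close>
    have 1: "(\<lambda>N. (\<Sum>i<N. vol (snd (\<theta> i))) / real N) \<longlonglongrightarrow> (\<integral>p. vol (snd p) \<partial>\<nu>)"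
      using uB by (intro avg[of _ uB] continuous_map_radius vol_continuous) auto
    have 2: "(\<lambda>N. (\<Sum>i<N. vol (snd (\<theta> i)) / \<tau> (snd (\<theta> i))) / real N) \<longlonglongrightarrow> (\<integral>p. vol (snd p) / \<tau> (snd p) \<partial>\<nu>)"
      using weight(1,3) by (intro avg[of _ wB] continuous_map_radius weight(2)) force
    have xs: "continuous_map input_space euclideanreal (\<lambda>p. \<mu> (x p s))"
    proof -
      have "continuous_map input_space euclideanreal ((\<lambda>f. f s) \<circ> x)"
        by (rule continuous_map_compose[OF x(2) continuous_map_path_eval[OF T0 s]])
      then have "continuous_map input_space euclideanreal (\<mu> \<circ> ((\<lambda>f. f s) \<circ> x))"
        by (rule continuous_map_compose) (simp add: mu_continuous)
      then show ?thesis
        by (simp add: o_def)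
    qed
    have 3: "(\<lambda>N. (\<Sum>i<N. \<mu> (x (\<theta> i) s) * (vol (snd (\<theta> i)) / \<tau> (snd (\<theta> i)))) / real N)
        \<longlonglongrightarrow> (\<integral>p. \<mu> (x p s) * (vol (snd p) / \<tau> (snd p)) \<partial>\<nu>)"
    proof (rule avg[of _ "mB * wB"])
      show "continuous_map input_space euclideanreal (\<lambda>p. \<mu> (x p s) * (vol (snd p) / \<tau> (snd p)))"
        by (intro continuous_map_real_mult xs continuous_map_radius weight(2))
      fix p assume "p \<in> topspace input_space"
      then have "snd p \<in> I" by auto
      then show "\<bar>\<mu> (x p s) * (vol (snd p) / \<tau> (snd p))\<bar> \<le> mB * wB"
        unfolding abs_mult using mB[of "x p s"] weight(1) weight(3)[of "snd p"] by (intro mult_mono) auto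
    qed
    note P = field_parts[OF \<nu>(1) R processD(2)[OF x(1) s]]
    have "(\<integral>p. vol (snd p) / \<tau> (snd p) \<partial>\<nu>) \<noteq> 0"
      using P(4) weight(1) by simp
    then have "(\<lambda>N. ((\<Sum>i<N. vol (snd (\<theta> i))) / real N * q' s
        + (\<Sum>i<N. \<mu> (x (\<theta> i) s) * (vol (snd (\<theta> i)) / \<tau> (snd (\<theta> i)))) / real N)
        / ((\<Sum>i<N. vol (snd (\<theta> i)) / \<tau> (snd (\<theta> i))) / real N)) \<longlonglongrightarrow> f s"
      unfolding f_def P(5) by (intro tendsto_divide tendsto_add tendsto_mult tendsto_const 1 2 3)
    moreover have "\<forall>\<^sub>F N in sequentially. ((\<Sum>i<N. vol (snd (\<theta> i))) / real N * q' s
        + (\<Sum>i<N. \<mu> (x (\<theta> i) s) * (vol (snd (\<theta> i)) / \<tau> (snd (\<theta> i)))) / real N)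
        / ((\<Sum>i<N. vol (snd (\<theta> i)) / \<tau> (snd (\<theta> i))) / real N) = field (?m N) r (\<lambda>i. x (\<theta> i) s) s"
      using eventually_ge_at_top[of 1]
    proof eventually_elim
      case (elim N)
      show ?case
        unfolding field_parts(5)[OF m(1)[OF elim] m(2)[OF elim] processD(2)[OF m(3)[OF elim] s]]
        by (simp add: integral_uniform_count_measure \<theta>(3))
    qed
    ultimately have "(\<lambda>N. field (?m N) r (\<lambda>i. x (\<theta> i) s) s) \<longlonglongrightarrow> f s"
      by (rule Lim_transform_eventually)
    then have "(\<lambda>N. field (?m N) r (\<lambda>i. x (\<theta> i) s) s - f s) \<longlonglongrightarrow> 0"
      by (simp add: LIM_zero_iff)
    then show ?thesis
      unfolding \<epsilon>_def by (rule tendsto_rabs_zero)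
  qed
  define A where "A N = (LINT s:{0..T}|lborel. \<epsilon> N s)" for N
  \<comment> \<open>Pointwise convergence in time is integrated by dominated convergence. The shift
    to \<open>Suc N\<close> avoids the empty system, whose uniform measure is not a probability
    measure.\<close>
  have "(\<lambda>N. A (Suc N)) \<longlonglongrightarrow> (\<integral>s. 0 \<partial>(lborel :: real measure))"
    unfolding A_def set_lebesgue_integral_def
  proof (rule integral_dominated_convergence[where w = "\<lambda>s. indicator {0..T} s *\<^sub>R (2 * ((uB * qB + mB * wB) / w0))"])
    show "(\<lambda>s. indicator {0..T} s *\<^sub>R \<epsilon> (Suc N) s) \<in> borel_measurable lborel" for N
    proof -
      have "continuous_on {0..T} (\<epsilon> (Suc N))"
        unfolding \<epsilon>_def by (intro continuous_on_rabs continuous_on_diff fc field_continuous m) auto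
      then have "set_integrable lborel {0..T} (\<epsilon> (Suc N))"
        by (rule set_integrable_continuous) simp
      then show ?thesis
        unfolding set_integrable_def by (rule borel_measurable_integrable)
    qed
    show "integrable lborel (\<lambda>s. indicator {0..T} s *\<^sub>R (2 * ((uB * qB + mB * wB) / w0)))"
      using set_integrable_continuous[of T "\<lambda>_. 2 * ((uB * qB + mB * wB) / w0)" T] by (simp add: set_integrable_def)
    show "AE s in lborel. (\<lambda>N. indicator {0..T} s *\<^sub>R \<epsilon> (Suc N) s) \<longlonglongrightarrow> 0"
      using LIMSEQ_Suc[OF \<epsilon>0] by (intro AE_I2) (auto simp: indicator_def)
    show "AE s in lborel. norm (indicator {0..T} s *\<^sub>R \<epsilon> (Suc N) s) \<le> indicator {0..T} s *\<^sub>R (2 * ((uB * qB + mB * wB) / w0))" for N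
    proof (rule AE_I2)
      fix s
      have N: "1 \<le> Suc N" by simp
      have "\<epsilon> (Suc N) s \<le> 2 * ((uB * qB + mB * wB) / w0)" if s: "s \<in> {0..T}"
        using field_bound[OF m(1)[OF N] m(2)[OF N] processD(2)[OF m(3)[OF N] s] s]
          field_bound[OF \<nu>(1) R processD(2)[OF x(1) s] s]
        unfolding \<epsilon>_def f_def by linarith
      then show "norm (indicator {0..T} s *\<^sub>R \<epsilon> (Suc N) s) \<le> indicator {0..T} s *\<^sub>R (2 * ((uB * qB + mB * wB) / w0))"
        by (auto simp: indicator_def \<epsilon>_def)
    qed
  qed simp
  then have "(\<lambda>N. A (Suc N)) \<longlonglongrightarrow> 0"
    by simp
  then have A: "A \<longlonglongrightarrow> 0"
    by (rule LIMSEQ_imp_Suc)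
  have close: "\<bar>Y N i t - x (\<theta> i) t\<bar> \<le> gain * (c * A N) \<and> \<bar>K N i t - k (\<theta> i) t\<bar> \<le> gain * (c * A N)"
    if N: "1 \<le> N" and i: "i < N" and t: "t \<in> {0..T}" for N i t
  proof -
    have e: "reflected_equation T a (\<lambda>s. 1 / \<tau> (r i) * (f s - \<mu> (x (\<theta> i) s))) (\<lambda>t. \<sigma> (r i) * w i t) (x (\<theta> i)) (k (\<theta> i))"
      for i
      using eq[OF \<theta>(1), of i] by (simp add: \<theta>(2,3) w(2) f_def)
    show ?thesis
      using particle_path_stability[OF N r Y[OF N] xp[OF \<theta>(1)] kp[OF \<theta>(1)] e fc i t]
      by (simp add: A_def \<epsilon>_def)
  qed
  have YK: "Y N i \<in> paths T {0..1}" "K N i \<in> paths T UNIV" if "1 \<le> N" "i < N" for N i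
    using Y[OF that(1)] that(2) by (auto simp: particle_path_def)
  have xk: "continuous_map input_space ?P (\<lambda>p. (x p, k p))"
    using x(2) k by (simp add: continuous_map_pairedI)
  have xkm: "(\<lambda>p. (x p, k p)) \<in> \<nu> \<rightarrow>\<^sub>M borel_of ?P"
    using continuous_map_measurable[OF xk] measurable_cong_sets[OF setsE refl] by blast
  define \<Phi> where "\<Phi> = prod_bumps (path_bumps T) (path_bumps T)"
  have \<Phi>: "bump_family ?P \<Phi>"
    unfolding \<Phi>_def by (intro bump_family_prod bump_family_path T)
  show ?thesis
  proof (rule weak_conv_onI_bump[OF \<Phi>])
    show "prob_space (empirical ?P N (\<lambda>i. (Y N i, K N i)))" if "1 \<le> N" for N
      using that YK by (intro prob_space_empirical) auto
    show "prob_space (distr \<nu> (borel_of ?P) (\<lambda>p. (x p, k p)))"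
      by (rule \<nu>.prob_space_distr[OF xkm])
    fix h assume h: "h \<in> test_funs \<Phi>"
    then obtain hs where hs: "hs \<in> lists ((\<rat> \<inter> {0..}) \<times> \<Phi>)" "h = test_fun hs"
      by (auto simp: test_funs_def)
    have hc: "continuous_map ?P euclideanreal h"
      unfolding hs(2) by (rule continuous_map_test_fun[OF hs(1) bump_familyD(2)[OF \<Phi>]])
    have hm: "h \<in> borel_measurable (borel_of ?P)"
      using continuous_map_measurable[OF hc] by (simp add: borel_of_euclidean)
    have hB: "\<bar>h p\<bar> \<le> sum_list (map fst hs)" if "p \<in> topspace ?P" for p
      unfolding hs(2) using test_fun_nonneg[of hs p] test_fun_bounded[OF hs(1), of p] bump_familyD(3)[OF \<Phi> _ that]
      by auto
    obtain L where L: "0 \<le> L" "\<forall>x\<in>paths T {0..1} \<times> paths T UNIV. \<forall>y\<in>paths T {0..1} \<times> paths T UNIV. \<forall>d\<ge>0.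
        (\<forall>t\<in>{0..T}. \<bar>fst x t - fst y t\<bar> \<le> d \<and> \<bar>snd x t - snd y t\<bar> \<le> d) \<longrightarrow> \<bar>h x - h y\<bar> \<le> L * d"
      using test_fun_Lipschitz[OF T0 h[unfolded \<Phi>_def]] by blast
    have "continuous_map input_space euclideanreal (\<lambda>p. h (x p, k p))"
      using continuous_map_compose[OF xk hc] by (simp add: o_def)
    then have lim: "(\<lambda>N. (\<Sum>i<N. h (x (\<theta> i), k (\<theta> i))) / real N) \<longlonglongrightarrow> (\<integral>p. h (x p, k p) \<partial>\<nu>)"
      using hB xp kp by (intro avg[of _ "sum_list (map fst hs)"]) auto
    \<comment> \<open>A Lipschitz test function turns the error bound common to all particles into
      one for the averages.\<close>
    have "(\<lambda>N. (\<integral>p. h p \<partial>empirical ?P N (\<lambda>i. (Y N i, K N i))) - (\<Sum>i<N. h (x (\<theta> i), k (\<theta> i))) / real N) \<longlonglongrightarrow> 0"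
    proof (rule Lim_null_comparison)
      show "\<forall>\<^sub>F N in sequentially. norm ((\<integral>p. h p \<partial>empirical ?P N (\<lambda>i. (Y N i, K N i)))
          - (\<Sum>i<N. h (x (\<theta> i), k (\<theta> i))) / real N) \<le> L * (gain * (c * A N))"
        using eventually_ge_at_top[of 1]
      proof eventually_elim
        case (elim N)
        have d0: "0 \<le> gain * (c * A N)"
          using close[OF elim, of 0 0] elim T0 by (auto intro: order_trans[OF abs_ge_zero])
        have each: "\<bar>h (Y N i, K N i) - h (x (\<theta> i), k (\<theta> i))\<bar> \<le> L * (gain * (c * A N))" if "i < N" for i
          using L(2)[rule_format, of "(Y N i, K N i)" "(x (\<theta> i), k (\<theta> i))" "gain * (c * A N)"]
            YK[OF elim that] xp[OF \<theta>(1)] kp[OF \<theta>(1)] d0 close[OF elim that] by simp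
        have "(\<integral>p. h p \<partial>empirical ?P N (\<lambda>i. (Y N i, K N i))) = (\<Sum>i<N. h (Y N i, K N i)) / real N"
          using YK[OF elim] hm by (intro integral_empirical) auto
        then have "norm ((\<integral>p. h p \<partial>empirical ?P N (\<lambda>i. (Y N i, K N i))) - (\<Sum>i<N. h (x (\<theta> i), k (\<theta> i))) / real N)
          = \<bar>\<Sum>i<N. h (Y N i, K N i) - h (x (\<theta> i), k (\<theta> i))\<bar> / real N"
          by (simp add: sum_subtractf diff_divide_distrib[symmetric])
        also have "\<dots> \<le> (\<Sum>i<N. L * (gain * (c * A N))) / real N"
          using each by (intro divide_right_mono order_trans[OF sum_abs] sum_mono) auto
        also have "\<dots> = L * (gain * (c * A N))"
          using elim by simp
        finally show ?case .
      qed
      have "(\<lambda>N. L * (gain * (c * A N))) \<longlonglongrightarrow> L * (gain * (c * 0))"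
        by (intro tendsto_mult tendsto_const A)
      then show "(\<lambda>N. L * (gain * (c * A N))) \<longlonglongrightarrow> 0"
        by simp
    qed
    from tendsto_add[OF this lim]
    have "(\<lambda>N. \<integral>p. h p \<partial>empirical ?P N (\<lambda>i. (Y N i, K N i))) \<longlonglongrightarrow> (\<integral>p. h (x p, k p) \<partial>\<nu>)"
      by simp
    then show "(\<lambda>N. \<integral>p. h p \<partial>empirical ?P N (\<lambda>i. (Y N i, K N i))) \<longlonglongrightarrow>
        (\<integral>p. h p \<partial>distr \<nu> (borel_of ?P) (\<lambda>p. (x p, k p)))"
      by (simp add: integral_distr[OF xkm hm])
  qed auto
qed

text \<open>Composing the canonical solution with the input \<open>(W, R)\<close> solves the
  equation on the given probability space. By uniqueness it agrees almost surely with any solution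
  there, so all limit solutions have the same law.\<close>

lemma limit_law:
  assumes \<nu>: "prob_space \<nu>" "sets \<nu> = sets (borel_of (path_space T UNIV) \<Otimes>\<^sub>M borel_of (top_of_set I))"
    and x: "process T \<nu> x" and k: "k \<in> \<nu> \<rightarrow>\<^sub>M borel_of (path_space T UNIV)"
    and eq: "\<And>\<theta>. \<theta> \<in> topspace input_space \<Longrightarrow> reflected_equation T a
      (\<lambda>s. 1 / \<tau> (snd \<theta>) * (field \<nu> snd (\<lambda>\<theta>. x \<theta> s) s - \<mu> (x \<theta> s)))
      (\<lambda>t. \<sigma> (snd \<theta>) * (fst \<theta> t - fst \<theta> 0)) (x \<theta>) (k \<theta>)"
    and m: "prob_space m" and W: "W \<in> m \<rightarrow>\<^sub>M borel_of (path_space T UNIV)" "AE \<omega> in m. W \<omega> 0 = 0"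
    and R: "R \<in> m \<rightarrow>\<^sub>M borel_of (top_of_set I)"
    and law: "distr m (borel_of (path_space T UNIV) \<Otimes>\<^sub>M borel_of (top_of_set I)) (\<lambda>\<omega>. (W \<omega>, R \<omega>)) = \<nu>"
    and X: "limit_solution T I \<tau> \<sigma> \<mu> q' a m W R X l"
  shows "distr m (borel_of (reflected_path_space T)) (\<lambda>\<omega>. (X \<omega>, l \<omega>)) =
    distr \<nu> (borel_of (reflected_path_space T)) (\<lambda>\<theta>. (x \<theta>, k \<theta>))"
proof -
  let ?E = "borel_of (path_space T UNIV) \<Otimes>\<^sub>M borel_of (top_of_set I)"
  define g where "g \<omega> = (W \<omega>, R \<omega>)" for \<omega>
  have g: "g \<in> m \<rightarrow>\<^sub>M ?E"
    unfolding g_def using W(1) R by measurable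
  have mE: "f \<in> ?E \<rightarrow>\<^sub>M N'" if "f \<in> \<nu> \<rightarrow>\<^sub>M N'" for f :: "(real \<Rightarrow> real) \<times> real \<Rightarrow> 'z" and N'
    using that measurable_cong_sets[OF \<nu>(2) refl] by blast
  have xg: "process T m (\<lambda>\<omega>. x (g \<omega>))"
    using measurable_compose[OF g mE] x unfolding process_def by blast
  have kg: "(\<lambda>\<omega>. k (g \<omega>)) \<in> m \<rightarrow>\<^sub>M borel_of (path_space T UNIV)"
    by (rule measurable_compose[OF g mE[OF k]])
  have law': "distr m ?E g = \<nu>"
    using law by (simp add: g_def[abs_def])
  \<comment> \<open>The field depends only on the joint law of position and radius, which the change
    of variables along \<open>g\<close> preserves.\<close>
  have fld: "field m R (\<lambda>\<omega>. x (g \<omega>) s) s = field \<nu> snd (\<lambda>\<theta>. x \<theta> s) s" if s: "s \<in> {0..T}" for s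
    using field_distr[OF g measurable_snd mE[OF processD(2)[OF x s]], of s]
    unfolding law' by (simp add: g_def)
  have "limit_solution T I \<tau> \<sigma> \<mu> q' a m W R (\<lambda>\<omega>. x (g \<omega>)) (\<lambda>\<omega>. k (g \<omega>))"
    unfolding limit_solution_field[OF m R xg kg]
    using W(2) AE_space
  proof eventually_elim
    case (elim \<omega>)
    have "g \<omega> \<in> topspace input_space"
      using measurable_space[OF W(1) elim(2)] measurable_space[OF R elim(2)] by (simp add: g_def)
    then show ?case
      by (rule reflected_equation_cong[OF eq]) (use elim(1) fld in \<open>auto simp: g_def\<close>)
  qed
  then have ae: "AE \<omega> in m. X \<omega> = x (g \<omega>) \<and> l \<omega> = k (g \<omega>)"
    by (rule limit_solution_unique[OF m R X])
  have pair: "(\<lambda>\<omega>. (A \<omega>, B \<omega>)) \<in> N' \<rightarrow>\<^sub>M borel_of (reflected_path_space T)"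
    if "A \<in> N' \<rightarrow>\<^sub>M borel_of (path_space T {0..1})" "B \<in> N' \<rightarrow>\<^sub>M borel_of (path_space T UNIV)"
    for A B and N' :: "'z measure"
    by (rule measurable_borel_of_prod[OF second_countable_path_space[OF T] second_countable_path_space[OF T] that])
  have "distr m (borel_of (reflected_path_space T)) (\<lambda>\<omega>. (X \<omega>, l \<omega>)) =
      distr m (borel_of (reflected_path_space T)) (\<lambda>\<omega>. (x (g \<omega>), k (g \<omega>)))"
  proof (rule distr_cong_AE)
    show "AE \<omega> in m. (X \<omega>, l \<omega>) = (x (g \<omega>), k (g \<omega>))"
      using ae by eventually_elim simp
    show "(\<lambda>\<omega>. (X \<omega>, l \<omega>)) \<in> m \<rightarrow>\<^sub>M borel_of (reflected_path_space T)"
      using X by (intro pair) (auto simp: limit_solution_def)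
    show "(\<lambda>\<omega>. (x (g \<omega>), k (g \<omega>))) \<in> m \<rightarrow>\<^sub>M borel_of (reflected_path_space T)"
      using xg kg by (intro pair) (auto simp: process_def)
  qed (rule refl)+
  also have "\<dots> = distr (distr m ?E g) (borel_of (reflected_path_space T)) (\<lambda>\<theta>. (x \<theta>, k \<theta>))"
  proof (subst distr_distr[OF _ g])
    show "(\<lambda>\<theta>. (x \<theta>, k \<theta>)) \<in> ?E \<rightarrow>\<^sub>M borel_of (reflected_path_space T)"
      using x k by (intro mE pair) (auto simp: process_def)
  qed (simp add: o_def)
  finally show ?thesis
    by (simp only: law')
qed

end

theorem proposition2:
  fixes T p rmin rmax a :: real and I :: "real set"
    and \<tau> \<sigma> \<mu>Li q q' :: "real \<Rightarrow> real"
    and r :: "nat \<Rightarrow> real" and lam :: "real measure"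
    and M :: "'w measure" and W :: "nat \<Rightarrow> 'w \<Rightarrow> real \<Rightarrow> real"
    and \<mu>W :: "(real \<Rightarrow> real) measure"
  assumes T: "0 < T" and p: "1 \<le> p"
    and I: "0 < rmin" "rmin \<le> rmax" "I = {rmin..rmax}"
    and W: "\<And>i. brownian_motion T M (W i)"
    and W_indep: "prob_space.indep_vars M (\<lambda>_. borel_of (path_space T UNIV)) W UNIV"
    and \<mu>W: "wiener_measure T \<mu>W"
    and r: "\<And>i. r i \<in> I"
    and lam: "finite_moment_measure p I lam"
    and r_lim: "weak_conv_on (top_of_set I) (\<lambda>N. empirical (top_of_set I) N r) lam"
    and \<tau>: "\<And>x. x \<in> I \<Longrightarrow> 0 < \<tau> x" "\<exists>L. L-lipschitz_on I \<tau>" "bounded (\<tau> ` I)"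
      "\<exists>L. L-lipschitz_on I (\<lambda>x. 1 / \<tau> x)" "bounded ((\<lambda>x. 1 / \<tau> x) ` I)"
    and \<sigma>: "\<exists>L. L-lipschitz_on I \<sigma>" "bounded (\<sigma> ` I)"
    and \<mu>Li: "\<exists>L. L-lipschitz_on UNIV \<mu>Li" "bounded (range \<mu>Li)"
    and q: "\<And>t. t \<in> {0..T} \<Longrightarrow> (q has_real_derivative q' t) (at t within {0..T})"
      "continuous_on {0..T} q'"
    and a: "a \<in> {0..1}"
  shows
    "(\<forall>N\<ge>1.
        (\<exists>Y K. particle_solution T I \<tau> \<sigma> \<mu>Li q' a r M W N Y K) \<and>
        (\<forall>Y K Y' K'.
          particle_solution T I \<tau> \<sigma> \<mu>Li q' a r M W N Y K \<and>
          particle_solution T I \<tau> \<sigma> \<mu>Li q' a r M W N Y' K' \<longrightarrow>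
          (AE \<omega> in M. \<forall>i<N. Y i \<omega> = Y' i \<omega> \<and> K i \<omega> = K' i \<omega>))) \<and>
     (\<forall>(M' :: 'v measure) W' R. limit_input T I \<mu>W lam M' W' R \<longrightarrow>
        (\<exists>X k. limit_solution T I \<tau> \<sigma> \<mu>Li q' a M' W' R X k) \<and>
        (\<forall>X k Y K.
          limit_solution T I \<tau> \<sigma> \<mu>Li q' a M' W' R X k \<and>
          (\<forall>N\<ge>1. particle_solution T I \<tau> \<sigma> \<mu>Li q' a r M W N (Y N) (K N)) \<longrightarrow>
          (AE \<omega> in M.
            weak_conv_on (reflected_path_space T)
              (\<lambda>N. empirical (reflected_path_space T) N (\<lambda>i. (Y N i \<omega>, K N i \<omega>)))
              (distr M' (borel_of (reflected_path_space T)) (\<lambda>\<omega>'. (X \<omega>', k \<omega>'))))))"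
proof -
  have Ic: "compact I" "I \<noteq> {}"
    using I by auto
  obtain c where c: "\<forall>x\<in>I. \<bar>1 / \<tau> x\<bar> \<le> c"
    using \<tau>(5) by (auto simp: bounded_iff)
  obtain Lc where Lc: "Lc-lipschitz_on I (\<lambda>x. 1 / \<tau> x)"
    using \<tau>(4) by blast
  obtain Ls where Ls: "Ls-lipschitz_on I \<sigma>"
    using \<sigma>(1) by blast
  obtain sB where sB: "\<forall>x\<in>I. \<bar>\<sigma> x\<bar> \<le> sB"
    using \<sigma>(2) by (auto simp: bounded_iff)
  obtain Lm where Lm: "Lm-lipschitz_on UNIV \<mu>Li"
    using \<mu>Li(1) by blast
  obtain mB where mB: "\<forall>x. \<bar>\<mu>Li x\<bar> \<le> mB"
    using \<mu>Li(2) by (auto simp: bounded_iff)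
  have vc: "continuous_on I vol"
    unfolding vol_def by (intro continuous_intros) auto
  have wc: "continuous_on I (\<lambda>x. vol x / \<tau> x)"
    using continuous_on_mult[OF vc lipschitz_on_continuous_on[OF Lc]] by simp
  \<comment> \<open>Compactness of \<open>I\<close> and positivity of radii and
    \<open>\<tau>\<close> bound the weight away from zero.\<close>
  obtain x0 where x0: "x0 \<in> I" "\<forall>x\<in>I. vol x0 / \<tau> x0 \<le> vol x / \<tau> x"
    using continuous_attains_inf[OF Ic wc] by blast
  obtain x1 where x1: "\<forall>x\<in>I. vol x / \<tau> x \<le> vol x1 / \<tau> x1"
    using continuous_attains_sup[OF Ic wc] by blast
  have w0: "0 < vol x0 / \<tau> x0"
    using x0(1) \<tau>(1)[OF x0(1)] I by (simp add: vol_def)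
  have "bounded (vol ` I)"
    using vc Ic(1) by (intro compact_imp_bounded compact_continuous_image)
  then obtain uB where uB: "\<forall>x\<in>I. \<bar>vol x\<bar> \<le> uB"
    by (auto simp: bounded_iff)
  have "bounded (q' ` {0..T})"
    using q(2) by (intro compact_imp_bounded compact_continuous_image) auto
  then obtain qB where qB: "\<forall>t\<in>{0..T}. \<bar>q' t\<bar> \<le> qB"
    by (auto simp: bounded_iff)
  \<comment> \<open>Adding 1 to \<open>\<bar>c\<bar>\<close> and to \<open>Lm\<close> provides the
    strict positivity asked for by the locale, and the absolute value of \<open>sB\<close> its
    nonnegativity.\<close>
  interpret population T a I \<tau> \<sigma> \<mu>Li q' "\<bar>c\<bar> + 1" Lc Ls "\<bar>sB\<bar>" "Lm + 1" mB "vol x0 / \<tau> x0" "vol x1 / \<tau> x1" uB qB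
  proof
    show "0 \<le> 1 / \<tau> x \<and> 1 / \<tau> x \<le> \<bar>c\<bar> + 1" if "x \<in> I" for x
      using c that \<tau>(1)[OF that] by fastforce
    show "0 \<le> Lc" "0 \<le> Ls" "0 < Lm + 1"
      using Lc Ls Lm by (auto simp: lipschitz_on_def)
    show "\<bar>1 / \<tau> x - 1 / \<tau> y\<bar> \<le> Lc * \<bar>x - y\<bar>" if "x \<in> I" "y \<in> I" for x y
      using lipschitz_onD[OF Lc that] by (simp add: dist_real_def)
    show "\<bar>\<sigma> x - \<sigma> y\<bar> \<le> Ls * \<bar>x - y\<bar>" if "x \<in> I" "y \<in> I" for x y
      using lipschitz_onD[OF Ls that] by (simp add: dist_real_def)
    show "\<bar>\<sigma> x\<bar> \<le> \<bar>sB\<bar>" if "x \<in> I" for x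
      using sB that by fastforce
    show "\<bar>\<mu>Li x - \<mu>Li y\<bar> \<le> (Lm + 1) * \<bar>x - y\<bar>" for x y
      using lipschitz_onD[OF Lm, of x y] by (simp add: dist_real_def algebra_simps)
  qed (use T a mB w0 wc x0 x1 uB q(2) qB in auto)
  have Wm: "W i \<in> M \<rightarrow>\<^sub>M borel_of (path_space T UNIV)" for i
    using W[of i] by (simp add: brownian_motion_def)
  have W0: "AE \<omega> in M. \<forall>i. W i \<omega> 0 = 0"
    unfolding AE_all_countable using W by (simp add: brownian_motion_def)
  have exist: "\<exists>Y K. particle_solution T I \<tau> \<sigma> \<mu>Li q' a r M W N Y K" if N: "1 \<le> N" for N
  proof -
    have "AE \<omega> in M. \<forall>i<N. W i \<omega> 0 = 0"
      using W0 by eventually_elim simp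
    then show ?thesis
      by (rule particle_solution_exists[OF N r Wm])
  qed
  have unique: "AE \<omega> in M. \<forall>i<N. Y i \<omega> = Y' i \<omega> \<and> K i \<omega> = K' i \<omega>"
    if N: "1 \<le> N" and Y: "particle_solution T I \<tau> \<sigma> \<mu>Li q' a r M W N Y K"
      and Y': "particle_solution T I \<tau> \<sigma> \<mu>Li q' a r M W N Y' K'" for N Y K Y' K'
    using particle_solution_path[OF r Y] particle_solution_path[OF r Y']
  proof eventually_elim
    case (elim \<omega>)
    then show ?case
      using particle_path_unique[OF N r elim] by blast
  qed
  have lam': "prob_space lam" "sets lam = sets (borel_of (top_of_set I))"
    using lam by (auto simp: finite_moment_measure_def)
  have \<mu>W': "prob_space \<mu>W" "sets \<mu>W = sets (borel_of (path_space T UNIV))" "AE w in \<mu>W. w 0 = 0"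
    using \<mu>W by (auto simp: wiener_measure_def brownian_motion_def)
  interpret \<mu>W: prob_space \<mu>W by (rule \<mu>W'(1))
  interpret lam: prob_space lam by (rule lam'(1))
  interpret PP: pair_prob_space \<mu>W lam ..
  have setsE: "sets (\<mu>W \<Otimes>\<^sub>M lam) = sets (borel_of (path_space T UNIV) \<Otimes>\<^sub>M borel_of (top_of_set I))"
    using \<mu>W'(2) lam'(2) by (rule sets_pair_measure_cong)
  obtain x l where x: "process T (\<mu>W \<Otimes>\<^sub>M lam) x" "continuous_map input_space (path_space T {0..1}) x"
    and l: "l \<in> \<mu>W \<Otimes>\<^sub>M lam \<rightarrow>\<^sub>M borel_of (path_space T UNIV)" "continuous_map input_space (path_space T UNIV) l"
    and eq: "\<forall>\<theta>\<in>topspace input_space. reflected_equation T a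
      (\<lambda>s. 1 / \<tau> (snd \<theta>) * (field (\<mu>W \<Otimes>\<^sub>M lam) snd (\<lambda>\<theta>. x \<theta> s) s - \<mu>Li (x \<theta> s)))
      (\<lambda>t. \<sigma> (snd \<theta>) * (fst \<theta> t - fst \<theta> 0)) (x \<theta>) (l \<theta>)"
    using canonical_solution[OF PP.prob_space_axioms setsE] by blast
  \<comment> \<open>The limit input is specified by its joint law only; that the noise starts at 0
    is read off from the first marginal, the Wiener measure.\<close>
  have start: "AE \<omega> in M'. W' \<omega> 0 = 0" if input: "limit_input T I \<mu>W lam M' W' R" for M' :: "'v measure" and W' R
  proof -
    have m: "(\<lambda>\<omega>. (W' \<omega>, R \<omega>)) \<in> M' \<rightarrow>\<^sub>M borel_of (path_space T UNIV) \<Otimes>\<^sub>M borel_of (top_of_set I)"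
      using input unfolding limit_input_def by (intro measurable_Pair) auto
    have "AE w in distr (\<mu>W \<Otimes>\<^sub>M lam) \<mu>W fst. w 0 = 0"
      unfolding prob_space.distr_pair_fst[OF lam'(1)] by (rule \<mu>W'(3))
    then have "AE p in \<mu>W \<Otimes>\<^sub>M lam. fst p 0 = 0"
      by (rule AE_distrD[rotated]) simp
    moreover have "distr M' (borel_of (path_space T UNIV) \<Otimes>\<^sub>M borel_of (top_of_set I)) (\<lambda>\<omega>. (W' \<omega>, R \<omega>)) = \<mu>W \<Otimes>\<^sub>M lam"
      using input by (simp add: limit_input_def)
    ultimately have "AE p in distr M' (borel_of (path_space T UNIV) \<Otimes>\<^sub>M borel_of (top_of_set I)) (\<lambda>\<omega>. (W' \<omega>, R \<omega>)). fst p 0 = 0"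
      by (simp only:)
    from AE_distrD[OF m this] show ?thesis
      by simp
  qed
  have emp: "AE \<omega> in M. weak_conv_on input_space (\<lambda>N. empirical input_space N (\<lambda>i. (W i \<omega>, r i))) (\<mu>W \<Otimes>\<^sub>M lam)"
    by (rule empirical_input_converges[OF T W W_indep \<mu>W r lam' r_lim])
  have conv: "AE \<omega> in M. weak_conv_on (reflected_path_space T)
        (\<lambda>N. empirical (reflected_path_space T) N (\<lambda>i. (Y N i \<omega>, K N i \<omega>)))
        (distr M' (borel_of (reflected_path_space T)) (\<lambda>\<omega>'. (X \<omega>', k \<omega>')))"
    if input: "limit_input T I \<mu>W lam M' W' R" and X: "limit_solution T I \<tau> \<sigma> \<mu>Li q' a M' W' R X k"
      and Y: "\<And>N. 1 \<le> N \<Longrightarrow> particle_solution T I \<tau> \<sigma> \<mu>Li q' a r M W N (Y N) (K N)"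
    for M' :: "'v measure" and W' R X k Y K
  proof -
    have law: "distr M' (borel_of (reflected_path_space T)) (\<lambda>\<omega>'. (X \<omega>', k \<omega>')) =
        distr (\<mu>W \<Otimes>\<^sub>M lam) (borel_of (reflected_path_space T)) (\<lambda>\<theta>. (x \<theta>, l \<theta>))"
      using input eq by (intro limit_law[OF PP.prob_space_axioms setsE x(1) l(1) _ _ _ start[OF input] _ _ X])
        (auto simp: limit_input_def)
    \<comment> \<open>The solutions for different \<open>N\<close> have separate exceptional sets;
      countably many of them are merged so that one sample point serves the whole sequence.\<close>
    have "AE \<omega> in M. \<forall>N. 1 \<le> N \<longrightarrow> particle_path r (\<lambda>i. W i \<omega>) N (\<lambda>i. Y N i \<omega>) (\<lambda>i. K N i \<omega>)"
      unfolding AE_all_countable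
    proof
      show "AE \<omega> in M. 1 \<le> N \<longrightarrow> particle_path r (\<lambda>i. W i \<omega>) N (\<lambda>i. Y N i \<omega>) (\<lambda>i. K N i \<omega>)" for N
        using particle_solution_path[OF r Y, of N] by (cases "1 \<le> N") auto
    qed
    then show ?thesis
      using emp W0 AE_space
    proof eventually_elim
      case (elim \<omega>)
      show ?case
        unfolding law
      proof (rule particle_paths_converge[OF PP.prob_space_axioms setsE x l(2)])
        show "W i \<omega> \<in> paths T UNIV" for i
          using measurable_space[OF Wm elim(4)] by simp
      qed (use elim(1-3) r eq in auto)
    qed
  qed
  have limit_exist: "\<exists>X k. limit_solution T I \<tau> \<sigma> \<mu>Li q' a M' W' R X k"
    if input: "limit_input T I \<mu>W lam M' W' R" for M' :: "'v measure" and W' R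
    using input start[OF input] by (intro limit_solution_exists) (auto simp: limit_input_def)
  show ?thesis
    using exist unique limit_exist conv by blast
qed

end
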